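(* Assume the following statement (the Baum–Dąbrowski–Hajac conjecture): for every non-empty compact Hausdorff space $X$ equipped with a continuous free action of a non-trivial compact Hausdorff group $G$, there is no continuous $G$-equivariant map $X*G\to X$, where the join $X*G$ carries the diagonal $G$-action. Then the following statement holds: for every prime number $p$ and every connected finite-dimensional topological manifold $M$, there is no free continuous action of the group $\mathbb{Z}_p$ of $p$-adic integers on $M$ such that the orbit space $M/\mathbb{Z}_p$ is finite-dimensional.
   Context: For compact Hausdorff spaces $X,Y$, the topological join $X*Y$ is the quotient of $X\times Y\times[0,1]$ by the relation which, for each fixed $y_0\in Y$, identifies all points $(x,y_0,0)$ ($x\in X$), and, for each fixed $x_0\in X$, identifies all points $(x_0,y,1)$ ($y\in Y$). The diagonal action on $X*G$ is $[(x,h,t)]\cdot g=[(xg,hg,t)]$. Topological manifolds are separable and metrizable, and connected spaces are non-empty. Dimension of a separable metrizable space means covering dimension (equivalently, small or large inductive dimension). $\mathbb{Z}_p$ carries its usual profinite topology. *)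

theory Defs
  imports "HOL-Analysis.Analysis" "HOL-Algebra.Product_Groups" "HOL-Library.Equipollence"
begin

section \<open>Quotient spaces\<close>

definition quotient_topology :: "'a topology \<Rightarrow> ('a \<times> 'a) set \<Rightarrow> 'a set topology" where
  "quotient_topology X r =
     topology (\<lambda>\<U>. \<U> \<subseteq> topspace X // r \<and> openin X (\<Union>\<U>))"

lemma openin_quotient_topology:
  assumes "equiv (topspace X) r"
  shows "openin (quotient_topology X r) \<U> \<longleftrightarrow> \<U> \<subseteq> topspace X // r \<and> openin X (\<Union>\<U>)"
proof -
  have "istopology (\<lambda>\<U>. \<U> \<subseteq> topspace X // r \<and> openin X (\<Union>\<U>))"
    unfolding istopology_def
  proof (intro conjI allI impI)
    fix S T
    assume S: "S \<subseteq> topspace X // r \<and> openin X (\<Union>S)" and T: "T \<subseteq> topspace X // r \<and> openin X (\<Union>T)"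
    show "S \<inter> T \<subseteq> topspace X // r" using S by blast
    have "\<Union>(S \<inter> T) = \<Union>S \<inter> \<Union>T"
      using S T quotient_disj[OF assms] by blast
    then show "openin X (\<Union>(S \<inter> T))" using S T by auto
  next
    fix K
    assume K: "\<forall>S\<in>K. S \<subseteq> topspace X // r \<and> openin X (\<Union>S)"
    show "\<Union>K \<subseteq> topspace X // r" using K by blast
    have "\<Union>(\<Union>K) = (\<Union>S\<in>K. \<Union>S)" by blast
    then show "openin X (\<Union>(\<Union>K))" using K by auto
  qed
  then show ?thesis by (simp add: quotient_topology_def topology_inverse')
qed

lemma topspace_quotient_topology:
  assumes "equiv (topspace X) r"
  shows "topspace (quotient_topology X r) = topspace X // r"
proof -
  have "openin (quotient_topology X r) (topspace X // r)"
    by (simp add: openin_quotient_topology[OF assms] Union_quotient[OF assms])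
  then show ?thesis
    by (metis assms openin_quotient_topology openin_subset openin_topspace subset_antisym)
qed

lemma quotient_map_quotient_topology:
  assumes "equiv (topspace X) r"
  shows "quotient_map X (quotient_topology X r) (\<lambda>x. r `` {x})"
proof -
  have "{x \<in> topspace X. r `` {x} \<in> \<U>} = \<Union>\<U>" if U: "\<U> \<subseteq> topspace X // r" for \<U>
  proof (intro Set.set_eqI iffI)
    fix x assume "x \<in> {x \<in> topspace X. r `` {x} \<in> \<U>}"
    then show "x \<in> \<Union>\<U>" using equiv_class_self[OF assms] by blast
  next
    fix x assume "x \<in> \<Union>\<U>"
    then obtain C where C: "C \<in> \<U>" "x \<in> C" by blast
    then obtain y where y: "y \<in> topspace X" "C = r `` {y}"
      using U by (metis quotientE subsetD)
    then have "(y, x) \<in> r" using C by auto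
    then show "x \<in> {x \<in> topspace X. r `` {x} \<in> \<U>}"
      using C y equiv_class_eq[OF assms, of y x] equiv_type[OF assms] by auto
  qed
  then show ?thesis
    unfolding quotient_map_def topspace_quotient_topology[OF assms]
    by (auto simp: openin_quotient_topology[OF assms] quotient_def)
qed


section \<open>Topological groups and their actions\<close>

definition topological_group :: "('g, 'b) monoid_scheme \<Rightarrow> 'g topology \<Rightarrow> bool" where
  "topological_group G T \<longleftrightarrow>
     group G \<and> topspace T = carrier G \<and>
     continuous_map (prod_topology T T) T (\<lambda>(g, h). g \<otimes>\<^bsub>G\<^esub> h) \<and>
     continuous_map T T (\<lambda>g. inv\<^bsub>G\<^esub> g)"

text \<open>Actions are on the right. Values outside the carriers are irrelevant.\<close>

definition continuous_action ::
  "('g, 'b) monoid_scheme \<Rightarrow> 'g topology \<Rightarrow> 'a topology \<Rightarrow> ('a \<Rightarrow> 'g \<Rightarrow> 'a) \<Rightarrow> bool" where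
  "continuous_action G T X act \<longleftrightarrow>
     continuous_map (prod_topology X T) X (\<lambda>(x, g). act x g) \<and>
     (\<forall>x\<in>topspace X. act x \<one>\<^bsub>G\<^esub> = x) \<and>
     (\<forall>x\<in>topspace X. \<forall>g\<in>carrier G. \<forall>h\<in>carrier G. act (act x g) h = act x (g \<otimes>\<^bsub>G\<^esub> h))"

definition free_action ::
  "('g, 'b) monoid_scheme \<Rightarrow> 'a topology \<Rightarrow> ('a \<Rightarrow> 'g \<Rightarrow> 'a) \<Rightarrow> bool" where
  "free_action G X act \<longleftrightarrow>
     (\<forall>x\<in>topspace X. \<forall>g\<in>carrier G. act x g = x \<longrightarrow> g = \<one>\<^bsub>G\<^esub>)"

definition equivariant ::
  "('g, 'b) monoid_scheme \<Rightarrow> 'a topology \<Rightarrow> ('a \<Rightarrow> 'g \<Rightarrow> 'a) \<Rightarrow> ('c \<Rightarrow> 'g \<Rightarrow> 'c) \<Rightarrow> ('a \<Rightarrow> 'c) \<Rightarrow> bool"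
  where
  "equivariant G X act act' f \<longleftrightarrow>
     (\<forall>x\<in>topspace X. \<forall>g\<in>carrier G. f (act x g) = act' (f x) g)"

definition orbit_rel ::
  "('g, 'b) monoid_scheme \<Rightarrow> 'a topology \<Rightarrow> ('a \<Rightarrow> 'g \<Rightarrow> 'a) \<Rightarrow> ('a \<times> 'a) set" where
  "orbit_rel G X act = {(x, y). x \<in> topspace X \<and> (\<exists>g\<in>carrier G. y = act x g)}"

definition orbit_space ::
  "('g, 'b) monoid_scheme \<Rightarrow> 'a topology \<Rightarrow> ('a \<Rightarrow> 'g \<Rightarrow> 'a) \<Rightarrow> 'a set topology" where
  "orbit_space G X act = quotient_topology X (orbit_rel G X act)"

lemma continuous_action_closed:
  assumes "topological_group G T" "continuous_action G T X act" "x \<in> topspace X" "g \<in> carrier G"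
  shows "act x g \<in> topspace X"
proof -
  have "(x, g) \<in> topspace (prod_topology X T)"
    using assms by (simp add: topological_group_def)
  then have "(\<lambda>(x, g). act x g) (x, g) \<in> topspace X"
    using assms(2) unfolding continuous_action_def
    by (meson continuous_map_image_subset_topspace image_subset_iff)
  then show ?thesis by simp
qed

lemma equiv_orbit_rel:
  assumes "topological_group G T" "continuous_action G T X act"
  shows "equiv (topspace X) (orbit_rel G X act)"
proof -
  interpret group G using assms(1) by (simp add: topological_group_def)
  note cl = continuous_action_closed[OF assms]
  have one: "act x \<one>\<^bsub>G\<^esub> = x" if "x \<in> topspace X" for x
    using assms(2) that by (simp add: continuous_action_def)
  have mul: "act (act x g) h = act x (g \<otimes>\<^bsub>G\<^esub> h)"
    if "x \<in> topspace X" "g \<in> carrier G" "h \<in> carrier G" for x g h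
    using assms(2) that by (simp add: continuous_action_def)
  show ?thesis
  proof (rule equivI)
    show "orbit_rel G X act \<subseteq> topspace X \<times> topspace X"
      using cl by (auto simp: orbit_rel_def)
    show "refl_on (topspace X) (orbit_rel G X act)"
      using one by (auto simp: orbit_rel_def refl_on_def intro!: bexI[of _ "\<one>\<^bsub>G\<^esub>"])
    show "sym (orbit_rel G X act)"
    proof (rule symI)
      fix x y assume "(x, y) \<in> orbit_rel G X act"
      then obtain g where g: "x \<in> topspace X" "g \<in> carrier G" "y = act x g"
        by (auto simp: orbit_rel_def)
      then have "x = act y (inv\<^bsub>G\<^esub> g)" by (simp add: mul one)
      then show "(y, x) \<in> orbit_rel G X act"
        using g cl by (auto simp: orbit_rel_def intro!: bexI[of _ "inv\<^bsub>G\<^esub> g"])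
    qed
    show "trans (orbit_rel G X act)"
    proof (rule transI)
      fix x y z assume "(x, y) \<in> orbit_rel G X act" "(y, z) \<in> orbit_rel G X act"
      then obtain g h where "x \<in> topspace X" "g \<in> carrier G" "h \<in> carrier G" "z = act (act x g) h"
        by (auto simp: orbit_rel_def)
      then show "(x, z) \<in> orbit_rel G X act"
        using mul by (auto simp: orbit_rel_def intro!: bexI[of _ "g \<otimes>\<^bsub>G\<^esub> h"])
    qed
  qed
qed


section \<open>The join\<close>

definition join_rel :: "'a set \<Rightarrow> 'b set \<Rightarrow> (('a \<times> 'b \<times> real) \<times> ('a \<times> 'b \<times> real)) set" where
  "join_rel A B =
     {((x, y, t), (x', y', t')).
        x \<in> A \<and> x' \<in> A \<and> y \<in> B \<and> y' \<in> B \<and> t \<in> {0..1} \<and> t' \<in> {0..1} \<and>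
        (x = x' \<and> y = y' \<and> t = t' \<or> t = 0 \<and> t' = 0 \<and> y = y' \<or> t = 1 \<and> t' = 1 \<and> x = x')}"

definition topological_join :: "'a topology \<Rightarrow> 'b topology \<Rightarrow> ('a \<times> 'b \<times> real) set topology" where
  "topological_join X Y =
     quotient_topology (prod_topology X (prod_topology Y (top_of_set {0..1})))
       (join_rel (topspace X) (topspace Y))"

lemma equiv_join_rel: "equiv (A \<times> B \<times> {0..1}) (join_rel A B)"
  by (rule equivI) (auto simp: join_rel_def refl_on_def sym_def trans_def)

text \<open>
  A point of the join of \<open>X\<close> and \<open>G\<close> is an equivalence class of triples; the diagonal action
  moves the class elementwise. That this sends the class of \<open>(x, h, t)\<close> to the class of
  \<open>(xg, hg, t)\<close> is \<open>join_action_class\<close>.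
\<close>

definition join_action ::
  "('g, 'b) monoid_scheme \<Rightarrow> ('a \<Rightarrow> 'g \<Rightarrow> 'a) \<Rightarrow> ('a \<times> 'g \<times> real) set \<Rightarrow> 'g \<Rightarrow> ('a \<times> 'g \<times> real) set"
  where
  "join_action G act C g = (\<lambda>(x, h, t). (act x g, h \<otimes>\<^bsub>G\<^esub> g, t)) ` C"

lemma join_action_class:
  assumes "topological_group G T" "continuous_action G T X act"
    and x: "x \<in> topspace X" and h: "h \<in> carrier G" and t: "t \<in> {0..1}" and g: "g \<in> carrier G"
  shows "join_action G act (join_rel (topspace X) (carrier G) `` {(x, h, t)}) g =
         join_rel (topspace X) (carrier G) `` {(act x g, h \<otimes>\<^bsub>G\<^esub> g, t)}"
proof -
  interpret group G using assms(1) by (simp add: topological_group_def)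
  note cl = continuous_action_closed[OF assms(1,2)]
  have surjX: "\<exists>z\<in>topspace X. y = act z g" if "y \<in> topspace X" for y
  proof
    show "y = act (act y (inv\<^bsub>G\<^esub> g)) g"
      using assms(2) that g by (simp add: continuous_action_def)
    show "act y (inv\<^bsub>G\<^esub> g) \<in> topspace X" using cl that g by simp
  qed
  have surjG: "\<exists>z\<in>carrier G. k = z \<otimes>\<^bsub>G\<^esub> g" if "k \<in> carrier G" for k
    using that g by (intro bexI[of _ "k \<otimes>\<^bsub>G\<^esub> inv\<^bsub>G\<^esub> g"]) (auto simp: m_assoc)
  show ?thesis
  proof (intro Set.set_eqI iffI)
    fix z assume "z \<in> join_action G act (join_rel (topspace X) (carrier G) `` {(x, h, t)}) g"
    then show "z \<in> join_rel (topspace X) (carrier G) `` {(act x g, h \<otimes>\<^bsub>G\<^esub> g, t)}"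
      using cl x h g by (auto simp: join_action_def join_rel_def)
  next
    fix z assume z: "z \<in> join_rel (topspace X) (carrier G) `` {(act x g, h \<otimes>\<^bsub>G\<^esub> g, t)}"
    obtain y k s where zeq: "z = (y, k, s)" by (cases z)
    have yk: "y \<in> topspace X" "k \<in> carrier G" "s = t"
      using z by (auto simp: zeq join_rel_def)
    obtain y' where y': "y' \<in> topspace X" "y = act y' g" using surjX yk by blast
    obtain k' where k': "k' \<in> carrier G" "k = k' \<otimes>\<^bsub>G\<^esub> g" using surjG yk by blast
    consider "y = act x g" "k = h \<otimes>\<^bsub>G\<^esub> g" | "t = 0" "k = h \<otimes>\<^bsub>G\<^esub> g" | "t = 1" "y = act x g"
      using z by (auto simp: zeq join_rel_def)
    then have "\<exists>w \<in> join_rel (topspace X) (carrier G) `` {(x, h, t)}.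
        z = (\<lambda>(x, h, t). (act x g, h \<otimes>\<^bsub>G\<^esub> g, t)) w"
    proof cases
      case 1
      then show ?thesis using x h t zeq yk
        by (intro bexI[of _ "(x, h, t)"]) (auto simp: join_rel_def)
    next
      case 2
      then show ?thesis using x h t zeq yk y'
        by (intro bexI[of _ "(y', h, t)"]) (auto simp: join_rel_def)
    next
      case 3
      then show ?thesis using x h t zeq yk k'
        by (intro bexI[of _ "(x, k', t)"]) (auto simp: join_rel_def)
    qed
    then show "z \<in> join_action G act (join_rel (topspace X) (carrier G) `` {(x, h, t)}) g"
      unfolding join_action_def by blast
  qed
qed


section \<open>The group of p-adic integers\<close>

text \<open>
  The inverse limit of the groups \<open>\<int>/p\<^sup>n\<close>, inside their product: \<open>x n\<close> is the residue
  modulo \<open>p\<^sup>n\<close>, represented in \<open>{0..<p\<^sup>n}\<close>.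
\<close>

definition padic_carrier :: "nat \<Rightarrow> (nat \<Rightarrow> int) set" where
  "padic_carrier p = {x. \<forall>n. x n \<in> {0..<int (p ^ n)} \<and> x (Suc n) mod int (p ^ n) = x n}"

definition padic_group :: "nat \<Rightarrow> (nat \<Rightarrow> int) monoid" where
  "padic_group p =
     (product_group UNIV (\<lambda>n. integer_mod_group (p ^ n))) \<lparr>carrier := padic_carrier p\<rparr>"

definition padic_topology :: "nat \<Rightarrow> (nat \<Rightarrow> int) topology" where
  "padic_topology p =
     subtopology (product_topology (\<lambda>n. discrete_topology {0..<int (p ^ n)}) UNIV) (padic_carrier p)"

lemma topspace_padic_topology: "topspace (padic_topology p) = padic_carrier p"
  by (auto simp: padic_topology_def padic_carrier_def)

lemma subgroup_padic_carrier:
  assumes "p > 0"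
  shows "subgroup (padic_carrier p) (product_group UNIV (\<lambda>n. integer_mod_group (p ^ n)))"
proof -
  let ?P = "product_group UNIV (\<lambda>n. integer_mod_group (p ^ n))"
  have P: "group ?P" by simp
  have sub: "padic_carrier p \<subseteq> carrier ?P"
    by (auto simp: padic_carrier_def carrier_integer_mod_group)
  have mm: "(a mod int (p ^ Suc n)) mod int (p ^ n) = a mod int (p ^ n)" for a n
    by (rule mod_mod_cancel) simp
  show ?thesis
  proof (rule group.subgroupI[OF P sub])
    have "(\<lambda>n. 0) \<in> padic_carrier p" using assms by (simp add: padic_carrier_def)
    then show "padic_carrier p \<noteq> {}" by blast
  next
    fix x assume x: "x \<in> padic_carrier p"
    then have inv: "inv\<^bsub>?P\<^esub> x = (\<lambda>n. (- x n) mod int (p ^ n))"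
      using sub by (subst inv_product_group) (auto simp: fun_eq_iff PiE_iff)
    have "(- x (Suc n)) mod int (p ^ Suc n) mod int (p ^ n) = (- x n) mod int (p ^ n)" for n
    proof -
      have "x (Suc n) mod int (p ^ n) = x n" using x by (simp add: padic_carrier_def)
      then show ?thesis unfolding mm by (metis mod_minus_eq)
    qed
    then show "inv\<^bsub>?P\<^esub> x \<in> padic_carrier p"
      unfolding inv padic_carrier_def using assms by simp
  next
    fix x y assume xy: "x \<in> padic_carrier p" "y \<in> padic_carrier p"
    have mult: "x \<otimes>\<^bsub>?P\<^esub> y = (\<lambda>n. (x n + y n) mod int (p ^ n))" by (simp add: fun_eq_iff)
    have "(x (Suc n) + y (Suc n)) mod int (p ^ Suc n) mod int (p ^ n) = (x n + y n) mod int (p ^ n)" for n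
    proof -
      have "x (Suc n) mod int (p ^ n) = x n" "y (Suc n) mod int (p ^ n) = y n"
        using xy by (simp_all add: padic_carrier_def)
      then show ?thesis unfolding mm by (metis mod_add_eq)
    qed
    then show "x \<otimes>\<^bsub>?P\<^esub> y \<in> padic_carrier p"
      unfolding mult padic_carrier_def using assms by simp
  qed
qed

lemma topological_group_padic:
  assumes "p > 0"
  shows "topological_group (padic_group p) (padic_topology p)"
proof -
  let ?P = "product_group UNIV (\<lambda>n. integer_mod_group (p ^ n))"
  let ?D = "\<lambda>n. discrete_topology {0..<int (p ^ n)}"
  have P: "group ?P" by simp
  note sub = subgroup_padic_carrier[OF assms]
  have grp: "group (padic_group p)"
    unfolding padic_group_def by (rule group.subgroup_imp_group[OF P sub])
  have car: "carrier (padic_group p) = padic_carrier p" by (simp add: padic_group_def)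
  have mult: "x \<otimes>\<^bsub>padic_group p\<^esub> y = (\<lambda>n. (x n + y n) mod int (p ^ n))" for x y
    by (simp add: padic_group_def fun_eq_iff)
  have inv: "inv\<^bsub>padic_group p\<^esub> x = (\<lambda>n. (- x n) mod int (p ^ n))" if "x \<in> padic_carrier p" for x
  proof -
    have "inv\<^bsub>padic_group p\<^esub> x = inv\<^bsub>?P\<^esub> x"
      unfolding padic_group_def by (rule group.m_inv_consistent[OF P sub that])
    also have "\<dots> = (\<lambda>n. (- x n) mod int (p ^ n))"
      using subgroup.subset[OF sub] that by (subst inv_product_group) (auto simp: fun_eq_iff PiE_iff)
    finally show ?thesis .
  qed
  have proj: "continuous_map (padic_topology p) (?D n) (\<lambda>x. x n)" for n
    unfolding padic_topology_def
    by (intro continuous_map_from_subtopology continuous_map_product_projection) simp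
  have into: "continuous_map Z (padic_topology p) f"
    if "\<And>n. continuous_map Z (?D n) (\<lambda>z. f z n)" "f \<in> topspace Z \<rightarrow> padic_carrier p"
    for Z :: "'z topology" and f
    using that unfolding padic_topology_def
    by (auto simp: continuous_map_in_subtopology continuous_map_componentwise_UNIV)
  have "continuous_map (prod_topology (padic_topology p) (padic_topology p)) (padic_topology p)
          (\<lambda>(x, y). x \<otimes>\<^bsub>padic_group p\<^esub> y)"
  proof (rule into)
    fix n
    have "continuous_map (prod_topology (padic_topology p) (padic_topology p))
            (prod_topology (?D n) (?D n)) (\<lambda>z. (fst z n, snd z n))"
      unfolding continuous_map_pairwise o_def fst_conv snd_conv
      by (intro conjI continuous_map_compose[OF continuous_map_fst proj, unfolded o_def]
          continuous_map_compose[OF continuous_map_snd proj, unfolded o_def])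
    moreover have "continuous_map (prod_topology (?D n) (?D n)) (?D n)
            (\<lambda>(a, b). (a + b) mod int (p ^ n))"
      unfolding prod_topology_discrete_topology[symmetric] using assms by auto
    ultimately have "continuous_map (prod_topology (padic_topology p) (padic_topology p)) (?D n)
            ((\<lambda>(a, b). (a + b) mod int (p ^ n)) \<circ> (\<lambda>z. (fst z n, snd z n)))"
      by (rule continuous_map_compose)
    then show "continuous_map (prod_topology (padic_topology p) (padic_topology p)) (?D n)
            (\<lambda>z. (case z of (x, y) \<Rightarrow> x \<otimes>\<^bsub>padic_group p\<^esub> y) n)"
      by (simp add: o_def mult case_prod_unfold)
  next
    show "(\<lambda>(x, y). x \<otimes>\<^bsub>padic_group p\<^esub> y)
        \<in> topspace (prod_topology (padic_topology p) (padic_topology p)) \<rightarrow> padic_carrier p"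
      using group.subgroup_self[OF grp] subgroup.m_closed
      by (fastforce simp: topspace_padic_topology car)
  qed
  moreover have "continuous_map (padic_topology p) (padic_topology p) (\<lambda>x. inv\<^bsub>padic_group p\<^esub> x)"
  proof (rule into)
    fix n
    have "continuous_map (?D n) (?D n) (\<lambda>a. (- a) mod int (p ^ n))"
      using assms by auto
    from continuous_map_compose[OF proj this]
    show "continuous_map (padic_topology p) (?D n) (\<lambda>x. (inv\<^bsub>padic_group p\<^esub> x) n)"
      by (rule continuous_map_eq) (simp add: topspace_padic_topology inv)
  next
    show "(\<lambda>x. inv\<^bsub>padic_group p\<^esub> x) \<in> topspace (padic_topology p) \<rightarrow> padic_carrier p"
      using group.inv_closed[OF grp] by (auto simp: topspace_padic_topology car)
  qed
  ultimately show ?thesis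
    using grp by (simp add: topological_group_def topspace_padic_topology car)
qed

lemma Hausdorff_space_padic: "Hausdorff_space (padic_topology p)"
  unfolding padic_topology_def
  by (intro Hausdorff_space_subtopology) (simp add: Hausdorff_space_product_topology)

lemma compact_space_padic: "compact_space (padic_topology p)"
proof -
  let ?D = "\<lambda>n. discrete_topology {0..<int (p ^ n)}"
  let ?X = "product_topology ?D UNIV"
  have X: "compact_space ?X" by (simp add: compact_space_product_topology compact_space_discrete_topology)
  define S where "S n b = {x \<in> topspace ?X. x (Suc n) \<in> {a \<in> {0..<int (p ^ Suc n)}. a mod int (p ^ n) = b}}
      \<inter> {x \<in> topspace ?X. x n \<in> {b}}" for n b
  have "closedin ?X (S n b)" if "b \<in> {0..<int (p ^ n)}" for n b
    unfolding S_def using that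
    by (intro closedin_Int closedin_continuous_map_preimage[OF continuous_map_product_projection]) auto
  then have "closedin ?X (\<Union>b\<in>{0..<int (p ^ n)}. S n b)" for n
    by (intro closedin_Union) auto
  then have "closedin ?X (\<Inter>n. \<Union>b\<in>{0..<int (p ^ n)}. S n b)"
    by (intro closedin_Inter) auto
  moreover have "(\<Inter>n. \<Union>b\<in>{0..<int (p ^ n)}. S n b) = padic_carrier p"
  proof (intro equalityI subsetI)
    fix x assume x: "x \<in> (\<Inter>n. \<Union>b\<in>{0..<int (p ^ n)}. S n b)"
    have "x n \<in> {0..<int (p ^ n)} \<and> x (Suc n) mod int (p ^ n) = x n" for n
    proof -
      obtain b where "b \<in> {0..<int (p ^ n)}" "x \<in> S n b" using x by blast
      then show ?thesis by (simp add: S_def)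
    qed
    then show "x \<in> padic_carrier p" unfolding padic_carrier_def by blast
  next
    fix x assume x: "x \<in> padic_carrier p"
    have "x n \<in> {0..<int (p ^ n)} \<and> x \<in> S n (x n)" for n
      using x unfolding padic_carrier_def S_def by (simp add: PiE_iff del: of_nat_power power_Suc)
    then show "x \<in> (\<Inter>n. \<Union>b\<in>{0..<int (p ^ n)}. S n b)" by blast
  qed
  ultimately have "closedin ?X (padic_carrier p)" by simp
  then show ?thesis
    unfolding padic_topology_def using X
    by (simp add: closedin_compact_space compact_space_subtopology)
qed


section \<open>Manifolds and dimension\<close>

definition topological_manifold :: "nat \<Rightarrow> 'a topology \<Rightarrow> bool" where
  "topological_manifold n M \<longleftrightarrow>
     metrizable_space M \<and> separable_space M \<and>
     (\<forall>x\<in>topspace M. \<exists>U V. openin M U \<and> x \<in> U \<and> openin (Euclidean_space n) V \<and>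
        subtopology M U homeomorphic_space subtopology (Euclidean_space n) V)"

text \<open>Covering dimension at most \<open>n\<close>, by finite open covers.\<close>

definition covering_dim_le :: "'a topology \<Rightarrow> nat \<Rightarrow> bool" where
  "covering_dim_le X n \<longleftrightarrow>
     (\<forall>\<U>. finite \<U> \<and> (\<forall>U\<in>\<U>. openin X U) \<and> \<Union>\<U> = topspace X \<longrightarrow>
        (\<exists>\<V>. finite \<V> \<and> (\<forall>V\<in>\<V>. openin X V) \<and> \<Union>\<V> = topspace X \<and>
             (\<forall>V\<in>\<V>. \<exists>U\<in>\<U>. V \<subseteq> U) \<and>
             (\<forall>x\<in>topspace X. card {V \<in> \<V>. x \<in> V} \<le> n + 1)))"

definition finite_dimensional :: "'a topology \<Rightarrow> bool" where
  "finite_dimensional X \<longleftrightarrow> (\<exists>n. covering_dim_le X n)"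

end

theory Submission
  imports Defs
begin

text \<open>
  Suppose \<open>\<int>\<^sub>p\<close> acts freely on \<open>M\<close> with orbit space of dimension at most \<open>k\<close>. Let \<open>E q k\<close> be the
  \<open>(k+1)\<close>-fold join of \<open>\<int>/q\<close>. Covers of the orbit space give equivariant maps from invariant
  compact parts \<open>K\<close> of \<open>M\<close> to \<open>E (p\<^sup>n) k\<close> for every \<open>n\<close>. On the other hand a chart of \<open>M\<close> is
  contractible and a small subgroup \<open>p\<^sup>j\<int>\<^sub>p\<close> hardly moves it, so coning off orbits inside the chart
  gives an equivariant map from the \<open>(k+2)\<close>-fold join of that subgroup to such a \<open>K\<close>. Composing the
  two and approximating at a finite level \<open>N\<close> gives, after identifying the subgroup with \<open>\<int>\<^sub>p\<close>,
  equivariant maps \<open>E (p\<^sup>N) (k+1) \<rightarrow> E (p\<^sup>n) k\<close>. Hence the compact free \<open>\<int>\<^sub>p\<close>-space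
  \<open>X = (\<Prod>n. E (p\<^sup>n) k)\<close> has an equivariant map \<open>X * \<int>\<^sub>p \<rightarrow> X\<close>: its \<open>n\<close>-th component factors through
  \<open>E (p\<^sup>N) k * \<int>/p\<^sup>N = E (p\<^sup>N) (k+1)\<close>.
\<close>

section \<open>Compactness and suprema\<close>

text \<open>The conjecture concerns a compact space that receives a map from its own join.
  \<open>M\<close> need not be compact, and nothing shows that the invariant set \<open>K\<close>
  absorbs a further join factor, so neither can be used directly. What \<open>K\<close> gives is a
  drop from \<open>k + 2\<close> to \<open>k + 1\<close> join factors, at the price of a finer level
  \<open>N \<ge> n\<close> in the source. For \<open>N = n > 0\<close> Dold's theorem forbids such a
  map; for \<open>N > n\<close> the target is no longer free for the group acting on the source, and
  that argument stops. A single \<open>E (p^n) k\<close> is not a free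
  \<open>\<int>\<^sub>p\<close>-space either, since \<open>p^n\<close> acts trivially on it. The
  product over all \<open>n\<close> repairs both defects: an element acting trivially at every level
  is \<open>0\<close>, and each component of the join map may read its source at whatever level
  \<open>N\<close> it needs. The conjecture is assumed on one type only, so the resulting space and
  group are finally transported into that type along injections.\<close>

lemma compact_space_decseq_empty:
  fixes C :: "nat \<Rightarrow> 'a set"
  assumes "compact_space X" "\<And>n. closedin X (C n)" "\<And>n. C (Suc n) \<subseteq> C n" "(\<Inter>n. C n) = {}"
  obtains n where "C n = {}"
  using compact_space_imp_nest[of X C] assms by (metis decseq_Suc_iff)

text \<open>Both semicontinuities come from the projection to \<open>X\<close>: it is open, and it
  is closed because \<open>Y\<close> is compact; attainment of the supremum identifies the images of
  \<open>{h \<ge> a}\<close>. The maximum over a compact group plays the part of an average and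
  turns bump functions into invariant ones.\<close>

lemma continuous_map_SUP_compact:
  fixes h :: "'a \<times> 'b \<Rightarrow> real"
  assumes Y: "compact_space Y" "topspace Y \<noteq> {}"
    and h: "continuous_map (prod_topology X Y) euclideanreal h"
  shows "continuous_map X euclideanreal (\<lambda>x. SUP y\<in>topspace Y. h (x, y))"
    and "\<And>x y. x \<in> topspace X \<Longrightarrow> y \<in> topspace Y \<Longrightarrow> h (x, y) \<le> (SUP y\<in>topspace Y. h (x, y))"
    and "\<And>x. x \<in> topspace X \<Longrightarrow> \<exists>y\<in>topspace Y. (SUP y\<in>topspace Y. h (x, y)) = h (x, y)"
proof -
  let ?s = "\<lambda>x. SUP y\<in>topspace Y. h (x, y)"
  have max: "\<exists>y\<in>topspace Y. \<forall>z\<in>topspace Y. h (x, z) \<le> h (x, y)" if x: "x \<in> topspace X" for x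
  proof -
    have "continuous_map Y (prod_topology X Y) (\<lambda>y. (x, y))"
      using x by (simp add: continuous_map_pairwise o_def)
    from continuous_map_compose[OF this h]
    have "continuous_map Y euclideanreal (\<lambda>y. h (x, y))" by (simp add: o_def)
    then have "compactin euclideanreal ((\<lambda>y. h (x, y)) ` topspace Y)"
      using Y(1) image_compactin compact_space_def by blast
    then have "compact ((\<lambda>y. h (x, y)) ` topspace Y)" by (simp add: compactin_euclidean_iff)
    with Y(2) show ?thesis using compact_attains_sup[of "(\<lambda>y. h (x, y)) ` topspace Y"] by auto
  qed
  then show att: "\<exists>y\<in>topspace Y. ?s x = h (x, y)" if "x \<in> topspace X" for x
    using cSup_eq_maximum that by (smt (verit, best) imageE image_eqI)
  have le: "h (x, y) \<le> ?s x" if "x \<in> topspace X" "y \<in> topspace Y" for x y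
  proof (rule cSUP_upper[OF that(2)])
    show "bdd_above ((\<lambda>y. h (x, y)) ` topspace Y)" using max[OF that(1)] by (auto simp: bdd_above_def)
  qed
  then show "\<And>x y. x \<in> topspace X \<Longrightarrow> y \<in> topspace Y \<Longrightarrow> h (x, y) \<le> ?s x" by blast
  show "continuous_map X euclideanreal ?s"
    unfolding continuous_map_upper_lower_semicontinuous_lte
  proof (intro conjI allI)
    fix a
    have "closedin (prod_topology X Y) {z \<in> topspace (prod_topology X Y). h z \<in> {a..}}"
      by (rule closedin_continuous_map_preimage[OF h]) simp
    then have "closedin X (fst ` {z \<in> topspace (prod_topology X Y). h z \<in> {a..}})"
      using closed_map_fst[OF Y(1)] unfolding closed_map_def by blast
    moreover have "topspace X - fst ` {z \<in> topspace (prod_topology X Y). h z \<in> {a..}}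
       = {x \<in> topspace X. ?s x < a}"
      using att le by (force simp: image_iff)
    ultimately show "openin X {x \<in> topspace X. ?s x < a}" by (metis openin_diff openin_topspace)
  next
    fix a
    have "openin (prod_topology X Y) {z \<in> topspace (prod_topology X Y). h z \<in> {a<..}}"
      by (rule openin_continuous_map_preimage[OF h]) simp
    then have "openin X (fst ` {z \<in> topspace (prod_topology X Y). h z \<in> {a<..}})"
      using open_map_fst unfolding open_map_def by blast
    moreover have "topspace X - fst ` {z \<in> topspace (prod_topology X Y). h z \<in> {a<..}}
       = {x \<in> topspace X. ?s x \<le> a}"
      using att le by (force simp: image_iff)
    ultimately show "closedin X {x \<in> topspace X. ?s x \<le> a}" by (metis closedin_diff closedin_topspace)
  qed
qed

section \<open>Arithmetic and topology of the p-adic integers\<close>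

lemma carrier_padic_group [simp]: "carrier (padic_group p) = padic_carrier p"
  by (simp add: padic_group_def)

text \<open>Written with \<open>int p ^ n\<close> because the simplifier turns
  \<open>int (p ^ n)\<close> into it; later statements keep this form.\<close>

lemma mult_padic_group [simp]: "x \<otimes>\<^bsub>padic_group p\<^esub> y = (\<lambda>n. (x n + y n) mod int p ^ n)"
  by (simp add: padic_group_def fun_eq_iff)

lemma one_padic_group [simp]: "\<one>\<^bsub>padic_group p\<^esub> = (\<lambda>n. 0)"
  by (simp add: padic_group_def fun_eq_iff)

lemma group_padic: "p > 0 \<Longrightarrow> group (padic_group p)"
  using topological_group_padic by (simp add: topological_group_def)

lemma padic_zero_carrier: "p > 0 \<Longrightarrow> (\<lambda>n. 0) \<in> padic_carrier p"
  using group.is_monoid[OF group_padic, THEN monoid.one_closed] by simp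

lemma padic_add_carrier:
  "\<lbrakk>p > 0; x \<in> padic_carrier p; y \<in> padic_carrier p\<rbrakk> \<Longrightarrow> (\<lambda>n. (x n + y n) mod int p ^ n) \<in> padic_carrier p"
  using group.is_monoid[OF group_padic, THEN monoid.m_closed, of p x y] by simp

lemma padic_carrier_range: "x \<in> padic_carrier p \<Longrightarrow> x n \<in> {0..<int p ^ n}"
  by (simp add: padic_carrier_def)

lemma padic_mod_self: "x \<in> padic_carrier p \<Longrightarrow> x n mod int p ^ n = x n"
  using padic_carrier_range[of x p n] by simp

lemma padic_coherent:
  assumes "x \<in> padic_carrier p" "m \<le> n"
  shows "x n mod int p ^ m = x m"
  using assms(2)
proof (induction n rule: dec_induct)
  case base
  then show ?case using padic_mod_self[OF assms(1)] by simp
next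
  case (step n)
  have "x (Suc n) mod int p ^ m = x (Suc n) mod int p ^ n mod int p ^ m"
    using step by (intro mod_mod_cancel[symmetric] le_imp_power_dvd) auto
  also have "x (Suc n) mod int p ^ n = x n" using assms(1) by (simp add: padic_carrier_def)
  finally show ?case using step by simp
qed

lemma padic_carrierI:
  assumes "p > 0" "\<And>n. x n mod int p ^ n = x n" "\<And>n. x (Suc n) mod int p ^ n = x n"
  shows "x \<in> padic_carrier p"
proof -
  have "x n \<in> {0..<int p ^ n}" for n
    using assms(1) assms(2)[of n] pos_mod_bound[of "int p ^ n" "x n"] pos_mod_sign[of "int p ^ n" "x n"]
    by simp
  then show ?thesis using assms(3) by (simp add: padic_carrier_def)
qed

lemma padic_neg_carrier:
  assumes "p > 0" "x \<in> padic_carrier p"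
  shows "(\<lambda>n. (- x n) mod int p ^ n) \<in> padic_carrier p"
proof (rule padic_carrierI[OF assms(1)])
  fix n
  have "(- x (Suc n)) mod int p ^ Suc n mod int p ^ n = (- x (Suc n)) mod int p ^ n"
    by (rule mod_mod_cancel) simp
  then show "(- x (Suc n)) mod int p ^ Suc n mod int p ^ n = (- x n) mod int p ^ n"
    using padic_coherent[OF assms(2), of n "Suc n"] by (metis lessI less_imp_le mod_minus_eq)
qed simp

lemma inv_padic_group:
  assumes "p > 0" "x \<in> padic_carrier p"
  shows "inv\<^bsub>padic_group p\<^esub> x = (\<lambda>n. (- x n) mod int p ^ n)"
  using assms padic_neg_carrier[OF assms]
  by (intro group.inv_equality group_padic) (auto simp: fun_eq_iff mod_simps)

lemma padic_int_carrier:
  assumes "p > 0"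
  shows "(\<lambda>n. a mod int p ^ n) \<in> padic_carrier p"
  by (rule padic_carrierI[OF assms]) (auto intro!: mod_mod_cancel)

lemma continuous_map_padic_proj:
  "continuous_map (padic_topology p) (discrete_topology {0..<int p ^ n}) (\<lambda>x. x n)"
proof -
  have "continuous_map (padic_topology p) (discrete_topology {0..<int (p ^ n)}) (\<lambda>x. x n)"
    unfolding padic_topology_def
    by (intro continuous_map_from_subtopology
      continuous_map_product_projection[where X = "\<lambda>n. discrete_topology {0..<int (p ^ n)}"]) simp
  then show ?thesis by simp
qed

lemma continuous_map_into_padic:
  assumes "\<And>n. continuous_map Z (discrete_topology {0..<int p ^ n}) (\<lambda>z. f z n)"
    "f \<in> topspace Z \<rightarrow> padic_carrier p"
  shows "continuous_map Z (padic_topology p) f"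
  using assms unfolding padic_topology_def
  by (auto simp: continuous_map_in_subtopology continuous_map_componentwise_UNIV)

text \<open>A condition on the value of a continuous map into a discrete space is clopen. With the
  vanishing of a residue as \<open>P\<close> it gives the open subgroups, with its negation their
  compact complements.\<close>

lemma padic_proj_clopen:
  "openin (padic_topology p) {g \<in> padic_carrier p. P (g n)}"
  "closedin (padic_topology p) {g \<in> padic_carrier p. P (g n)}"
proof -
  have eq: "{g \<in> padic_carrier p. P (g n)}
    = {g \<in> topspace (padic_topology p). g n \<in> {a \<in> {0..<int p ^ n}. P a}}"
    using padic_carrier_range by (auto simp: topspace_padic_topology)
  show "openin (padic_topology p) {g \<in> padic_carrier p. P (g n)}" unfolding eq
    by (rule openin_continuous_map_preimage[OF continuous_map_padic_proj]) auto
  show "closedin (padic_topology p) {g \<in> padic_carrier p. P (g n)}" unfolding eq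
    by (rule closedin_continuous_map_preimage[OF continuous_map_padic_proj]) auto
qed

section \<open>Joins of copies of a finite cyclic group\<close>

text \<open>
  A point of the \<open>(k+1)\<close>-fold join of \<open>\<int>/q\<close> is a family of weights \<open>w i a\<close> for colours
  \<open>i \<le> k\<close> and residues \<open>a\<close>, where each colour uses at most one residue. Residues are encoded
  by \<open>q\<close>-periodicity in \<open>a\<close>, so that \<open>\<int>/q\<close> acts by plain translation.
\<close>

definition coloured :: "nat \<Rightarrow> int \<Rightarrow> (nat \<Rightarrow> int \<Rightarrow> real) \<Rightarrow> bool" where
  "coloured k q w \<longleftrightarrow>
     (\<forall>i a. 0 \<le> w i a) \<and> (\<forall>i a b. a mod q = b mod q \<longrightarrow> w i a = w i b) \<and> (\<forall>i a. k < i \<longrightarrow> w i a = 0) \<and>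
     (\<forall>i a b. w i a * w i b \<noteq> 0 \<longrightarrow> a mod q = b mod q)"

definition total :: "nat \<Rightarrow> int \<Rightarrow> (nat \<Rightarrow> int \<Rightarrow> real) \<Rightarrow> real" where
  "total k q w = (\<Sum>i\<le>k. \<Sum>a\<in>{0..<q}. w i a)"

definition join_weights :: "nat \<Rightarrow> int \<Rightarrow> (nat \<Rightarrow> int \<Rightarrow> real) set" where
  "join_weights k q = {w. coloured k q w \<and> total k q w = 1}"

text \<open>Translation by an integer that is not reduced: on periodic \<open>w\<close> only its
  residue matters, so \<open>g\<close> acts at level \<open>n\<close> by
  \<open>shift (g n)\<close>.\<close>

definition shift :: "int \<Rightarrow> (nat \<Rightarrow> int \<Rightarrow> real) \<Rightarrow> nat \<Rightarrow> int \<Rightarrow> real" where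
  "shift h w = (\<lambda>i a. w i (a - h))"

lemma colouredD:
  assumes "coloured k q w"
  shows "0 \<le> w i a" "a mod q = b mod q \<Longrightarrow> w i a = w i b" "k < i \<Longrightarrow> w i a = 0"
    "w i a \<noteq> 0 \<Longrightarrow> w i b \<noteq> 0 \<Longrightarrow> a mod q = b mod q"
proof -
  note * = assms[unfolded coloured_def]
  note c1 = *[THEN conjunct1, rule_format] and r1 = *[THEN conjunct2]
  note c2 = r1[THEN conjunct1, rule_format] and r2 = r1[THEN conjunct2]
  note c3 = r2[THEN conjunct1, rule_format] and c4 = r2[THEN conjunct2, rule_format]
  show "0 \<le> w i a" by (rule c1)
  show "a mod q = b mod q \<Longrightarrow> w i a = w i b" by (rule c2)
  show "k < i \<Longrightarrow> w i a = 0" by (rule c3)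
  show "w i a \<noteq> 0 \<Longrightarrow> w i b \<noteq> 0 \<Longrightarrow> a mod q = b mod q" by (rule c4) simp
qed

lemma colouredI:
  assumes "\<And>i a. 0 \<le> w i a" "\<And>i a b. a mod q = b mod q \<Longrightarrow> w i a = w i b" "\<And>i a. k < i \<Longrightarrow> w i a = 0"
    "\<And>i a b. w i a \<noteq> 0 \<Longrightarrow> w i b \<noteq> 0 \<Longrightarrow> a mod q = b mod q"
  shows "coloured k q w"
  unfolding coloured_def
proof (intro conjI allI impI)
  fix i a b
  assume "w i a * w i b \<noteq> 0"
  then show "a mod q = b mod q" using assms(4)[of i a b] by simp
qed (fact assms)+

lemma bij_betw_translate_mod:
  assumes "0 < (q::int)"
  shows "bij_betw (\<lambda>h. (h + c) mod q) {0..<q} {0..<q}"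
proof (rule bij_betw_byWitness[where f' = "\<lambda>h. (h - c) mod q"])
  have "x mod q = x" if "x \<in> {0..<q}" for x using that by simp
  then show "\<forall>a\<in>{0..<q}. ((a + c) mod q - c) mod q = a" "\<forall>a\<in>{0..<q}. ((a - c) mod q + c) mod q = a"
    by (simp_all add: mod_simps)
qed (use assms in auto)

lemma coloured_shift:
  assumes "coloured k q w"
  shows "coloured k q (shift h w)"
proof (rule colouredI, unfold shift_def)
  fix i and a b :: int
  show "0 \<le> w i (a - h)" "k < i \<Longrightarrow> w i (a - h) = 0" using colouredD(1,3)[OF assms] by auto
  show "w i (a - h) = w i (b - h)" if "a mod q = b mod q"
    using that by (intro colouredD(2)[OF assms]) (rule mod_diff_cong, auto)
  assume "w i (a - h) \<noteq> 0" "w i (b - h) \<noteq> 0"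
  then have "(a - h) mod q = (b - h) mod q" by (rule colouredD(4)[OF assms])
  then have "((a - h) + h) mod q = ((b - h) + h) mod q" by (rule mod_add_cong) simp
  then show "a mod q = b mod q" by simp
qed

lemma total_shift:
  assumes "coloured k q w" "0 < q"
  shows "total k q (shift h w) = total k q w"
proof -
  have "(\<Sum>a\<in>{0..<q}. w i (a - h)) = (\<Sum>a\<in>{0..<q}. w i a)" for i
  proof -
    have "(\<Sum>a\<in>{0..<q}. w i (a - h)) = (\<Sum>a\<in>{0..<q}. w i ((a + - h) mod q))"
      by (intro sum.cong refl colouredD(2)[OF assms(1)]) (simp add: mod_simps)
    also have "\<dots> = (\<Sum>a\<in>{0..<q}. w i a)"
      by (rule sum.reindex_bij_betw[OF bij_betw_translate_mod[OF assms(2)]])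
    finally show ?thesis .
  qed
  then show ?thesis by (simp add: total_def shift_def)
qed

lemma shift_join_weights: "\<lbrakk>w \<in> join_weights k q; 0 < q\<rbrakk> \<Longrightarrow> shift h w \<in> join_weights k q"
  by (simp add: join_weights_def coloured_shift total_shift)

lemma total_pos:
  assumes "coloured k q w" "0 < q" "w i a \<noteq> 0"
  shows "0 < total k q w"
proof -
  have i: "i \<le> k" using assms colouredD(3) by (metis not_le)
  have eq: "w i (a mod q) = w i a" by (rule colouredD(2)[OF assms(1)]) simp
  have pos: "w i (a mod q) > 0" using colouredD(1)[OF assms(1), of i a] eq assms(3) by simp
  have "0 < (\<Sum>a\<in>{0..<q}. w i a)"
    using assms(2) pos colouredD(1)[OF assms(1)] by (intro sum_pos2[of _ "a mod q"]) auto
  then show ?thesis unfolding total_def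
    using i colouredD(1)[OF assms(1)] by (intro sum_pos2[of _ i]) (auto intro!: sum_nonneg)
qed

lemma normalise_join_weights:
  assumes "coloured k q w" "0 < q" "w i a \<noteq> 0"
  shows "(\<lambda>i a. w i a / total k q w) \<in> join_weights k q"
proof -
  have pos: "0 < total k q w" by (rule total_pos[OF assms])
  have "coloured k q (\<lambda>i a. w i a / total k q w)"
  proof (rule colouredI)
    fix i and a b :: int
    show "0 \<le> w i a / total k q w" using pos colouredD(1)[OF assms(1)] by simp
    show "w i a / total k q w = w i b / total k q w" if "a mod q = b mod q"
      using colouredD(2)[OF assms(1) that] by simp
    show "w i a / total k q w = 0" if "k < i" using colouredD(3)[OF assms(1) that] by simp
    show "a mod q = b mod q" if "w i a / total k q w \<noteq> 0" "w i b / total k q w \<noteq> 0"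
      using that by (intro colouredD(4)[OF assms(1), of i]) auto
  qed
  moreover have "total k q (\<lambda>i a. w i a / total k q w) = 1"
    using pos unfolding total_def by (simp flip: sum_divide_distrib)
  ultimately show ?thesis by (simp add: join_weights_def)
qed

text \<open>A colour uses at most one residue, so the sum over representatives has only one nonzero
  term.\<close>

lemma sum_colour:
  assumes "coloured k q w" "0 < q" "w i a \<noteq> 0"
  shows "(\<Sum>b\<in>{0..<q}. w i b) = w i a"
proof -
  have "(\<Sum>b\<in>{0..<q}. w i b) = (\<Sum>b\<in>{a mod q}. w i b)"
    using assms(2) colouredD(4)[OF assms(1) assms(3)]
    by (intro sum.mono_neutral_right) auto
  also have "\<dots> = w i a" using colouredD(2)[OF assms(1), of "a mod q" a i] by simp
  finally show ?thesis .
qed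

text \<open>Pigeonhole over \<open>k + 1\<close> colours, each carrying a single weight. This bound
  is the source of the truncation factor in \<open>join_map\<close> and of the tolerance in the
  approximation at a finite level.\<close>

lemma join_weights_large:
  assumes "w \<in> join_weights k q"  "0 < q"
  obtains i a where "i \<le> k" "w i a \<ge> 1 / (k + 1)"
proof (rule ccontr)
  assume N: "\<not> thesis"
  have L: "i \<le> k \<Longrightarrow> \<not> 1 / (k + 1) \<le> w i a" for i a using N that by blast
  then have small: "w i a < 1 / (k + 1)" if "i \<le> k" for i a using L[OF that, of a] by linarith
  have c: "coloured k q w" "total k q w = 1" using assms by (auto simp: join_weights_def)
  have col: "(\<Sum>a\<in>{0..<q}. w i a) < 1 / (k + 1)" if i: "i \<le> k" for i
  proof (cases "\<exists>a. w i a \<noteq> 0")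
    case True
    then obtain a where "w i a \<noteq> 0" by blast
    then show ?thesis using sum_colour[OF c(1) assms(2), of i a] small[OF i, of a] by simp
  next
    case False
    then show ?thesis by simp
  qed
  have "total k q w < (\<Sum>i\<le>k. 1 / (k + 1))"
    unfolding total_def by (intro sum_strict_mono col) auto
  then show False using c(2) by simp
qed

lemma join_weights_le_1:
  assumes "w \<in> join_weights k q" "0 < q"
  shows "w i a \<le> 1"
proof (cases "w i a = 0")
  case False
  have c: "coloured k q w" "total k q w = 1" using assms by (auto simp: join_weights_def)
  have "w i a = (\<Sum>b\<in>{0..<q}. w i b)" using sum_colour[OF c(1) assms(2) False] by simp
  also have "\<dots> \<le> total k q w" unfolding total_def
  proof (rule member_le_sum[where f = "\<lambda>i. \<Sum>b\<in>{0..<q}. w i b"])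
    show "i \<in> {..k}" using colouredD(3)[OF c(1), of i a] False by (cases "i \<le> k") auto
  qed (auto intro!: sum_nonneg colouredD(1)[OF c(1)])
  finally show ?thesis using c by simp
qed simp

section \<open>Free actions of the p-adic integers on compact spaces\<close>

lemma continuous_map_compose2:
  assumes "continuous_map (prod_topology X Y) Z (\<lambda>(x, y). h x y)" "continuous_map W X f" "continuous_map W Y g"
  shows "continuous_map W Z (\<lambda>w. h (f w) (g w))"
  using continuous_map_compose[OF continuous_map_pairedI[OF assms(2,3)] assms(1)] by (simp add: o_def)

text \<open>The tube lemma: the complement is the image of a closed set under the projection along
  the compact set \<open>C\<close>.\<close>

lemma openin_forall_compactin:
  assumes T: "compactin T C" and f: "continuous_map (prod_topology X T) Y (\<lambda>(x, c). f x c)" and A: "openin Y A"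
  shows "openin X {x \<in> topspace X. \<forall>c\<in>C. f x c \<in> A}"
proof -
  have C: "C \<subseteq> topspace T" "compact_space (subtopology T C)"
    using T by (auto simp: compactin_subspace)
  have f': "continuous_map (prod_topology X (subtopology T C)) Y (\<lambda>(x, c). f x c)"
    unfolding prod_topology_subtopology by (rule continuous_map_from_subtopology[OF f])
  have "closedin (prod_topology X (subtopology T C))
      {z \<in> topspace (prod_topology X (subtopology T C)). (\<lambda>(x, c). f x c) z \<in> topspace Y - A}"
    by (rule closedin_continuous_map_preimage[OF f']) (use A in auto)
  then have "closedin X (fst ` {z \<in> topspace (prod_topology X (subtopology T C)). (\<lambda>(x, c). f x c) z \<in> topspace Y - A})"
    using closed_map_fst[OF C(2)] unfolding closed_map_def by blast
  then have "openin X (topspace X - fst ` {z \<in> topspace (prod_topology X (subtopology T C)). (\<lambda>(x, c). f x c) z \<in> topspace Y - A})"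
    by blast
  moreover have "f x c \<in> topspace Y" if "x \<in> topspace X" "c \<in> C" for x c
    using continuous_map_image_subset_topspace[OF f] that C(1) by (auto simp: subset_eq)
  then have "topspace X - fst ` {z \<in> topspace (prod_topology X (subtopology T C)). (\<lambda>(x, c). f x c) z \<in> topspace Y - A}
    = {x \<in> topspace X. \<forall>c\<in>C. f x c \<in> A}"
    using C(1) by (force simp: image_iff)
  ultimately show ?thesis by simp
qed

text \<open>The indicator of \<open>L\<close> may jump only where \<open>u\<close> vanishes, because
  \<open>L\<close> is clopen in \<open>L \<union> L'\<close>. Sets \<open>{> a}\<close> with
  \<open>a \<ge> 0\<close> stay inside \<open>L\<close>, and sets \<open>{< a}\<close> with
  \<open>a > 0\<close> gain all of \<open>L'\<close>.\<close>

lemma continuous_map_times_indicator: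
  assumes u: "continuous_map X euclideanreal u" "\<And>x. x \<in> topspace X \<Longrightarrow> 0 \<le> u x"
    and L: "openin X L" and L': "openin X L'" "L \<inter> L' = {}"
    and supp: "\<And>x. x \<in> topspace X \<Longrightarrow> u x \<noteq> 0 \<Longrightarrow> x \<in> L \<union> L'"
  shows "continuous_map X euclideanreal (\<lambda>x. u x * indicat_real L x)"
  unfolding continuous_map_upper_lower_semicontinuous_lt
proof (intro conjI allI)
  fix a
  have up: "openin X {x \<in> topspace X. u x \<in> {a<..}}"
    by (rule openin_continuous_map_preimage[OF u(1)]) simp
  have lo: "openin X {x \<in> topspace X. u x \<in> {..<a}}"
    by (rule openin_continuous_map_preimage[OF u(1)]) simp
  have sub: "L \<subseteq> topspace X" "L' \<subseteq> topspace X" using L L' openin_subset by auto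
  show "openin X {x \<in> topspace X. a < u x * indicat_real L x}"
  proof (cases "a < 0")
    case True
    then have "{x \<in> topspace X. a < u x * indicat_real L x} = topspace X"
      using u(2) by (force simp: indicator_def)
    then show ?thesis by simp
  next
    case False
    then have "{x \<in> topspace X. a < u x * indicat_real L x} = {x \<in> topspace X. u x \<in> {a<..}} \<inter> L"
      by (auto simp: indicator_def split: if_splits)
    then show ?thesis using up L by auto
  qed
  show "openin X {x \<in> topspace X. u x * indicat_real L x < a}"
  proof (cases "a \<le> 0")
    case True
    then have "{x \<in> topspace X. u x * indicat_real L x < a} = {}"
      using u(2) by (force simp: indicator_def)
    then show ?thesis by (metis openin_empty)
  next
    case False
    then have "{x \<in> topspace X. u x * indicat_real L x < a} = {x \<in> topspace X. u x \<in> {..<a}} \<union> L'"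
      using supp L'(2) sub by (fastforce simp: indicator_def split: if_splits)
    then show ?thesis using lo L' by auto
  qed
qed

locale padic_space =
  fixes p :: nat and X :: "'a topology" and act :: "'a \<Rightarrow> (nat \<Rightarrow> int) \<Rightarrow> 'a"
  assumes p: "p > 0"
    and action: "continuous_action (padic_group p) (padic_topology p) X act"
    and free: "free_action (padic_group p) X act"
begin

section \<open>Translates of points under the action\<close>

lemma act_closed: "x \<in> topspace X \<Longrightarrow> g \<in> padic_carrier p \<Longrightarrow> act x g \<in> topspace X"
  using continuous_action_closed[OF topological_group_padic[OF p] action] by simp

lemma act_zero: "x \<in> topspace X \<Longrightarrow> act x (\<lambda>n. 0) = x"
  using action by (simp add: continuous_action_def)

lemma act_act:
  "x \<in> topspace X \<Longrightarrow> g \<in> padic_carrier p \<Longrightarrow> h \<in> padic_carrier p \<Longrightarrow>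
    act (act x g) h = act x (\<lambda>n. (g n + h n) mod int p ^ n)"
  using action by (simp add: continuous_action_def)

lemma act_inverse:
  assumes "x \<in> topspace X" "g \<in> padic_carrier p"
  shows "act (act x g) (\<lambda>n. (- g n) mod int p ^ n) = x"
    "act (act x (\<lambda>n. (- g n) mod int p ^ n)) g = x"
  using assms by (simp_all add: act_act padic_neg_carrier[OF p] mod_simps act_zero)

lemma act_difference:
  assumes "x \<in> topspace X" "g \<in> padic_carrier p" "h \<in> padic_carrier p"
  shows "act (act x g) (\<lambda>n. (h n - g n) mod int p ^ n) = act x h"
proof -
  have c: "(\<lambda>n. (h n - g n) mod int p ^ n) \<in> padic_carrier p"
    using padic_add_carrier[OF p assms(3) padic_neg_carrier[OF p assms(2)]] by (simp add: mod_simps)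
  have "(\<lambda>n. (g n + (h n - g n) mod int p ^ n) mod int p ^ n) = h"
    using padic_mod_self[OF assms(3)] by (simp add: mod_simps)
  then show ?thesis using assms c by (simp add: act_act)
qed

lemma continuous_map_act:
  assumes "continuous_map Z X f" "continuous_map Z (padic_topology p) g"
  shows "continuous_map Z X (\<lambda>z. act (f z) (g z))"
proof -
  have "continuous_map (prod_topology X (padic_topology p)) X (\<lambda>(x, g). act x g)"
    using action by (simp add: continuous_action_def)
  from continuous_map_compose2[OF this assms] show ?thesis .
qed

lemma continuous_map_act_fixed:
  "g \<in> padic_carrier p \<Longrightarrow> continuous_map X X (\<lambda>x. act x g)"
  by (rule continuous_map_act) (auto simp: topspace_padic_topology)

text \<open>The fibres of a continuous equivariant map from the invariant open set
  \<open>\<Union>a. L a\<close> to the cyclic group of order \<open>p^n\<close>, with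
  \<open>L a\<close> over the residue of \<open>a\<close>. Indexing by all integers keeps the
  translation rule free of reductions.\<close>

definition slices :: "nat \<Rightarrow> (int \<Rightarrow> 'a set) \<Rightarrow> bool" where
  "slices n L \<longleftrightarrow>
     (\<forall>a. openin X (L a)) \<and> (\<forall>a b. a mod int p ^ n = b mod int p ^ n \<longrightarrow> L a = L b) \<and>
     (\<forall>a b z. z \<in> L a \<and> z \<in> L b \<longrightarrow> a mod int p ^ n = b mod int p ^ n) \<and>
     (\<forall>a z g. z \<in> L a \<and> g \<in> padic_carrier p \<longrightarrow> act z g \<in> L (a + g n))"

lemma slicesD:
  assumes "slices n L"
  shows "openin X (L a)" "a mod int p ^ n = b mod int p ^ n \<Longrightarrow> L a = L b"
    "z \<in> L a \<Longrightarrow> z \<in> L b \<Longrightarrow> a mod int p ^ n = b mod int p ^ n"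
    "z \<in> L a \<Longrightarrow> g \<in> padic_carrier p \<Longrightarrow> act z g \<in> L (a + g n)"
proof -
  note * = assms[unfolded slices_def]
  note c1 = *[THEN conjunct1, rule_format] and r1 = *[THEN conjunct2]
  note c2 = r1[THEN conjunct1, rule_format] and r2 = r1[THEN conjunct2]
  note c3 = r2[THEN conjunct1, rule_format] and c4 = r2[THEN conjunct2, rule_format]
  show "openin X (L a)" by (rule c1)
  show "a mod int p ^ n = b mod int p ^ n \<Longrightarrow> L a = L b" by (rule c2)
  show "z \<in> L a \<Longrightarrow> z \<in> L b \<Longrightarrow> a mod int p ^ n = b mod int p ^ n" by (rule c3) simp
  show "z \<in> L a \<Longrightarrow> g \<in> padic_carrier p \<Longrightarrow> act z g \<in> L (a + g n)" by (rule c4) simp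
qed

lemma slices_act_iff:
  assumes "slices n L" "z \<in> topspace X" "g \<in> padic_carrier p"
  shows "act z g \<in> L a \<longleftrightarrow> z \<in> L (a - g n)"
proof
  assume "act z g \<in> L a"
  from slicesD(4)[OF assms(1) this padic_neg_carrier[OF p assms(3)]]
  have "z \<in> L (a + (- g n) mod int p ^ n)" by (simp add: act_inverse assms)
  moreover have "L (a + (- g n) mod int p ^ n) = L (a - g n)"
    by (rule slicesD(2)[OF assms(1)]) (simp add: mod_simps)
  ultimately show "z \<in> L (a - g n)" by simp
next
  assume "z \<in> L (a - g n)"
  from slicesD(4)[OF assms(1) this assms(3)] show "act z g \<in> L a" by simp
qed

text \<open>
  The elements with non-zero residue form a compact set that moves \<open>x\<close>; a neighbourhood \<open>B\<close>
  of \<open>x\<close> disjoint from its translates by them gives the slices.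
\<close>

lemma slices_exist:
  assumes H: "Hausdorff_space X" and x: "x \<in> topspace X"
  shows "\<exists>L. slices n L \<and> x \<in> L 0"
proof -
  let ?q = "int p ^ n"
  define C where "C = {g \<in> padic_carrier p. g n \<noteq> 0}"
  have C: "compactin (padic_topology p) C"
    using padic_proj_clopen(2)[of p "\<lambda>a. a \<noteq> 0" n] compact_space_padic unfolding C_def
    by (rule closedin_compact_space[rotated])
  have cx: "continuous_map (padic_topology p) X (\<lambda>g. act x g)"
    by (rule continuous_map_act) (use x in auto)
  have "compactin X (act x ` C)" by (rule image_compactin[OF C cx])
  moreover have "x \<notin> act x ` C"
    using free x unfolding free_action_def C_def by (force simp: fun_eq_iff)
  ultimately obtain A A' where A: "openin X A" "openin X A'" "x \<in> A" "act x ` C \<subseteq> A'" "disjnt A A'"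
    using H x unfolding Hausdorff_space_compact_sets
    by (metis compactin_sing disjnt_insert1 disjnt_empty1 insert_subset)
  define B where "B = A \<inter> {y \<in> topspace X. \<forall>g\<in>C. act y g \<in> A'}"
  have B: "openin X B" unfolding B_def
    using action A C by (intro openin_Int openin_forall_compactin) (auto simp: continuous_action_def)
  have xB: "x \<in> B" using A x by (auto simp: B_def)
  have BC: "g n = 0" if "y \<in> B" "act y g \<in> B" "g \<in> padic_carrier p" for y g
    using that A(5) unfolding B_def C_def disjnt_def by blast
  \<comment> \<open>\<open>L a\<close> consists of the translates of \<open>B\<close> by elements of
    residue \<open>a\<close>. It is expressed through the inverse \<open>g\<close>, of residue
    \<open>- a\<close>, so that it is visibly a union of preimages of the open set
    \<open>B\<close>.\<close>
  define L where "L a = {z \<in> topspace X. \<exists>g\<in>padic_carrier p. g n mod ?q = (- a) mod ?q \<and> act z g \<in> B}" for a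
  have "slices n L" unfolding slices_def
  proof (intro conjI allI impI)
    fix a
    have "L a = (\<Union>g\<in>{g \<in> padic_carrier p. g n mod ?q = (- a) mod ?q}. {z \<in> topspace X. act z g \<in> B})"
      unfolding L_def by blast
    also have "openin X \<dots>"
      by (intro openin_Union) (auto intro!: openin_continuous_map_preimage[OF continuous_map_act_fixed B])
    finally show "openin X (L a)" .
  next
    fix a b :: int
    assume "a mod ?q = b mod ?q"
    then have "(- a) mod ?q = (- b) mod ?q" by (rule mod_minus_cong)
    then show "L a = L b" by (simp add: L_def)
  next
    fix a b z
    assume "z \<in> L a \<and> z \<in> L b"
    then obtain g h where gh: "z \<in> topspace X" "g \<in> padic_carrier p" "h \<in> padic_carrier p"
      "g n mod ?q = (- a) mod ?q" "h n mod ?q = (- b) mod ?q" "act z g \<in> B" "act z h \<in> B"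
      unfolding L_def by blast
    have "(\<lambda>n. (h n - g n) mod int p ^ n) \<in> padic_carrier p"
      using padic_add_carrier[OF p gh(3) padic_neg_carrier[OF p gh(2)]] by (simp add: mod_simps)
    from BC[OF gh(6) _ this] have "(h n - g n) mod ?q = 0" using gh by (simp add: act_difference)
    then have "?q dvd h n - g n" by presburger
    then have "h n mod ?q = g n mod ?q" by (simp add: mod_eq_dvd_iff)
    then have "(- a) mod ?q = (- b) mod ?q" using gh by simp
    then have "(- (- a)) mod ?q = (- (- b)) mod ?q" by (rule mod_minus_cong)
    then show "a mod ?q = b mod ?q" by simp
  next
    fix a z h
    assume "z \<in> L a \<and> h \<in> padic_carrier p"
    then obtain g where g: "z \<in> topspace X" "h \<in> padic_carrier p" "g \<in> padic_carrier p"
      "g n mod ?q = (- a) mod ?q" "act z g \<in> B"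
      unfolding L_def by blast
    let ?d = "\<lambda>n. (g n - h n) mod int p ^ n"
    have d: "?d \<in> padic_carrier p"
      using padic_add_carrier[OF p g(3) padic_neg_carrier[OF p g(2)]] by (simp add: mod_simps)
    have "act (act z h) ?d \<in> B" using g by (simp add: act_difference)
    moreover have "?d n mod ?q = (- (a + h n)) mod ?q"
    proof -
      have "(g n - h n) mod ?q = ((- a) - h n) mod ?q" by (rule mod_diff_cong[OF g(4)]) simp
      then show ?thesis by simp
    qed
    ultimately show "act z h \<in> L (a + h n)"
      unfolding L_def using d act_closed[OF g(1,2)] by (intro CollectI conjI bexI[of _ ?d])
  qed
  moreover have "x \<in> L 0"
    unfolding L_def mem_Collect_eq
  proof (intro conjI bexI[of _ "\<lambda>n. 0"])
    show "act x (\<lambda>n. 0) \<in> B" using xB act_zero[OF x] by simp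
  qed (use x padic_zero_carrier[OF p] in auto)
  ultimately show ?thesis by blast
qed

text \<open>Urysohn functions supported in members of the cover are replaced by their maxima over
  orbits; invariance of the members keeps the supports inside them. Compactness leaves finitely many
  functions.\<close>

lemma invariant_bumps:
  assumes X: "compact_space X" "Hausdorff_space X" and V: "\<And>V. V \<in> \<V> \<Longrightarrow> openin X V"
    and inv: "\<And>V x g. V \<in> \<V> \<Longrightarrow> x \<in> V \<Longrightarrow> g \<in> padic_carrier p \<Longrightarrow> act x g \<in> V"
    and cov: "\<Union>\<V> = topspace X"
  obtains f :: "'a set \<Rightarrow> 'a \<Rightarrow> real" where
    "\<And>V. continuous_map X euclideanreal (f V)"
    "\<And>V x. x \<in> topspace X \<Longrightarrow> 0 \<le> f V x"
    "\<And>V x. x \<in> topspace X \<Longrightarrow> f V x \<noteq> 0 \<Longrightarrow> V \<in> \<V> \<and> x \<in> V"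
    "\<And>V x g. x \<in> topspace X \<Longrightarrow> g \<in> padic_carrier p \<Longrightarrow> f V (act x g) = f V x"
    "\<And>x. x \<in> topspace X \<Longrightarrow> \<exists>V\<in>\<V>. f V x \<noteq> 0"
proof -
  let ?T = "padic_topology p"
  have T: "compact_space ?T" "topspace ?T \<noteq> {}"
    using compact_space_padic padic_zero_carrier[OF p] by (auto simp: topspace_padic_topology)
  have cr: "completely_regular_space X"
    using X compact_Hausdorff_or_regular_imp_normal_space normal_imp_completely_regular_space by blast
  have "\<exists>V h. V \<in> \<V> \<and> x \<in> V \<and> continuous_map X (top_of_set {0..1::real}) h \<and> h x = 1 \<and> (\<forall>y\<in>topspace X - V. h y = 0)"
    if x: "x \<in> topspace X" for x
  proof -
    obtain V where Vx: "V \<in> \<V>" "x \<in> V" using cov x by blast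
    have "closedin X (topspace X - V)" using V[OF Vx(1)] by blast
    then obtain h where h: "continuous_map X (top_of_set {0..1::real}) h" "h x = 0" "h ` (topspace X - V) \<subseteq> {1}"
      using cr x Vx unfolding completely_regular_space_def by blast
    \<comment> \<open>Complete regularity yields a function that is \<open>0\<close> at
      \<open>x\<close> and \<open>1\<close> off \<open>V\<close>; it is turned upside down to become
      a bump at \<open>x\<close>.\<close>
    have "continuous_map X (top_of_set {0..1::real}) (\<lambda>y. 1 - h y)"
      using h(1) by (auto simp: continuous_map_in_subtopology intro!: continuous_intros)
    then show ?thesis using Vx h by (intro exI[of _ V] exI[of _ "\<lambda>y. 1 - h y"]) auto
  qed
  then obtain W h where W: "\<And>x. x \<in> topspace X \<Longrightarrow> W x \<in> \<V> \<and> x \<in> W x"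
    and h: "\<And>x. x \<in> topspace X \<Longrightarrow> continuous_map X (top_of_set {0..1::real}) (h x)"
     "\<And>x. x \<in> topspace X \<Longrightarrow> h x x = 1" "\<And>x y. x \<in> topspace X \<Longrightarrow> y \<in> topspace X - W x \<Longrightarrow> h x y = 0"
    by metis
  have h0: "0 \<le> h x y" if "x \<in> topspace X" "y \<in> topspace X" for x y
    using h(1)[OF that(1)] that(2) by (auto simp: continuous_map_in_subtopology)
  define H where "H x y = (SUP g\<in>topspace ?T. h x (act y g))" for x y
  have hc: "continuous_map (prod_topology X ?T) euclideanreal (\<lambda>(y, g). h x (act y g))" if "x \<in> topspace X" for x
    using continuous_map_compose[of "prod_topology X ?T" X "\<lambda>(y, g). act y g" euclideanreal "h x"]
      h(1)[OF that] action unfolding continuous_action_def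
    by (auto simp: o_def case_prod_unfold continuous_map_in_subtopology)
  have Hc: "continuous_map X euclideanreal (H x)" if "x \<in> topspace X" for x
    using continuous_map_SUP_compact(1)[OF T hc[OF that]] unfolding H_def by simp
  have Hle: "h x (act y g) \<le> H x y" if "x \<in> topspace X" "y \<in> topspace X" "g \<in> padic_carrier p" for x y g
    using continuous_map_SUP_compact(2)[OF T hc[OF that(1)] that(2), of g] that(3) unfolding H_def topspace_padic_topology by simp
  have Hatt: "\<exists>g\<in>padic_carrier p. H x y = h x (act y g)" if "x \<in> topspace X" "y \<in> topspace X" for x y
    using continuous_map_SUP_compact(3)[OF T hc[OF that(1)] that(2)] unfolding H_def topspace_padic_topology by simp
  have Hinv1: "H x (act y g) \<le> H x y" if *: "x \<in> topspace X" "y \<in> topspace X" "g \<in> padic_carrier p" for x y g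
  proof -
    obtain k where k: "k \<in> padic_carrier p" "H x (act y g) = h x (act (act y g) k)"
      using Hatt[OF *(1) act_closed[OF *(2,3)]] by blast
    then show ?thesis using Hle[OF *(1,2) padic_add_carrier[OF p *(3) k(1)]] * by (simp add: act_act)
  qed
  have Hinv: "H x (act y g) = H x y" if "x \<in> topspace X" "y \<in> topspace X" "g \<in> padic_carrier p" for x y g
    using Hinv1[OF that] Hinv1[OF that(1) act_closed[OF that(2,3)] padic_neg_carrier[OF p that(3)]]
      act_inverse(1)[OF that(2,3)] by simp
  have Hpos: "0 \<le> H x y" if "x \<in> topspace X" "y \<in> topspace X" for x y
    using Hatt[OF that] h0[OF that(1)] act_closed[OF that(2)] by auto
  have Hsupp: "y \<in> W x" if *: "x \<in> topspace X" "y \<in> topspace X" "H x y \<noteq> 0" for x y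
  proof -
    obtain g where g: "g \<in> padic_carrier p" "h x (act y g) \<noteq> 0" using Hatt[OF *(1,2)] *(3) by auto
    then have "act y g \<in> W x" using h(3)[OF *(1)] act_closed[OF *(2) g(1)] by blast
    from inv[OF _ this padic_neg_carrier[OF p g(1)]] show ?thesis
      using W *(1) act_inverse(1)[OF *(2) g(1)] by simp
  qed
  have Hself: "0 < H x x" if "x \<in> topspace X" for x
    using Hle[OF that that padic_zero_carrier[OF p]] by (simp add: act_zero that h)
  have "openin X {y \<in> topspace X. H x y \<in> {0<..}}" if "x \<in> topspace X" for x
    by (rule openin_continuous_map_preimage[OF Hc[OF that]]) simp
  then have "\<exists>\<F>. finite \<F> \<and> \<F> \<subseteq> (\<lambda>x. {y \<in> topspace X. H x y \<in> {0<..}}) ` topspace X \<and> topspace X \<subseteq> \<Union>\<F>"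
    using Hself by (intro compactinD[OF X(1)[unfolded compact_space_def]]) auto
  then obtain \<F> where F: "finite \<F>" "\<F> \<subseteq> (\<lambda>x. {y \<in> topspace X. H x y \<in> {0<..}}) ` topspace X" "topspace X \<subseteq> \<Union>\<F>"
    by blast
  from finite_subset_image[OF F(1,2)]
  obtain I where I: "finite I" "I \<subseteq> topspace X" "topspace X \<subseteq> (\<Union>x\<in>I. {y \<in> topspace X. H x y \<in> {0<..}})"
    using F(3) by blast
  \<comment> \<open>Several chosen points may have been assigned the same \<open>V\<close>; their
    bumps are added. For all other sets the sum is empty and \<open>f V\<close> is
    \<open>0\<close>.\<close>
  define f where "f V y = (\<Sum>x\<in>{x \<in> I. W x = V}. H x y)" for V y
  show thesis
  proof (rule that[of f])
    fix V
    show "continuous_map X euclideanreal (f V)"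
      unfolding f_def using I by (intro continuous_map_sum) (auto intro: Hc)
    show "0 \<le> f V x" if "x \<in> topspace X" for x
      unfolding f_def using I that by (intro sum_nonneg) (auto intro: Hpos)
    show VV: "V \<in> \<V> \<and> x \<in> V" if x: "x \<in> topspace X" and ne: "f V x \<noteq> 0" for x
    proof -
      have "\<exists>y\<in>{x \<in> I. W x = V}. H y x \<noteq> 0" using ne unfolding f_def by (meson sum.neutral)
      then obtain y where y: "y \<in> I" "W y = V" "H y x \<noteq> 0" by blast
      then have "y \<in> topspace X" using I by blast
      then show ?thesis using Hsupp[OF _ x y(3)] W[of y] y(2) by simp
    qed
    show "f V (act x g) = f V x" if "x \<in> topspace X" "g \<in> padic_carrier p" for x g
      unfolding f_def using I that by (intro sum.cong) (auto intro: Hinv)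
  next
    fix x assume x: "x \<in> topspace X"
    then obtain y where y: "y \<in> I" "0 < H y x" using I by auto
    have "0 < f (W y) x" unfolding f_def
      by (rule sum_pos2[of _ y]) (use y I x in \<open>auto intro: Hpos\<close>)
    then show "\<exists>V\<in>\<V>. f V x \<noteq> 0" using W y I by force
  qed
qed

text \<open>
  Passing from a cover of order \<open>k + 1\<close> to \<open>k + 1\<close> colours: the sets on which the members of
  a subfamily \<open>S\<close> of the bumps dominate the sum of all others are disjoint for different
  \<open>S\<close> of the same cardinality.
\<close>

lemma equivariant_join_weights:
  assumes X: "compact_space X" "Hausdorff_space X"
    and dim: "\<And>\<U>. \<lbrakk>finite \<U>; \<And>U. U \<in> \<U> \<Longrightarrow> openin X U;
        \<And>U x g. \<lbrakk>U \<in> \<U>; x \<in> U; g \<in> padic_carrier p\<rbrakk> \<Longrightarrow> act x g \<in> U; \<Union>\<U> = topspace X\<rbrakk> \<Longrightarrow>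
      \<exists>\<V>. finite \<V> \<and> (\<forall>V\<in>\<V>. openin X V) \<and> (\<forall>V\<in>\<V>. \<forall>x\<in>V. \<forall>g\<in>padic_carrier p. act x g \<in> V) \<and>
        \<Union>\<V> = topspace X \<and> (\<forall>V\<in>\<V>. \<exists>U\<in>\<U>. V \<subseteq> U) \<and> (\<forall>x\<in>topspace X. card {V \<in> \<V>. x \<in> V} \<le> k + 1)"
  obtains \<psi> where
    "\<forall>x\<in>topspace X. \<psi> x \<in> join_weights k (int p ^ n)"
    "\<forall>i a. continuous_map X euclideanreal (\<lambda>x. \<psi> x i a)"
    "\<forall>x\<in>topspace X. \<forall>g\<in>padic_carrier p. \<psi> (act x g) = shift (g n) (\<psi> x)"
proof -
  let ?q = "int p ^ n"
  have q: "0 < ?q" using p by simp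
  obtain L where L: "\<And>x. x \<in> topspace X \<Longrightarrow> slices n (L x) \<and> x \<in> L x 0"
    using slices_exist[OF X(2), where n = n] by metis
  define U where "U x = (\<Union>a. L x a)" for x
  have Uo: "openin X (U x)" if "x \<in> topspace X" for x
    unfolding U_def using L[OF that] slicesD(1) by blast
  have Uinv: "act y g \<in> U x" if "x \<in> topspace X" "y \<in> U x" "g \<in> padic_carrier p" for x y g
    using that L[OF that(1)] slicesD(4) unfolding U_def by blast
  have "\<exists>\<F>. finite \<F> \<and> \<F> \<subseteq> U ` topspace X \<and> topspace X \<subseteq> \<Union>\<F>"
  proof (rule compactinD[OF X(1)[unfolded compact_space_def]])
    show "topspace X \<subseteq> \<Union>(U ` topspace X)" using L unfolding U_def by blast
  qed (use Uo in auto)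
  then obtain \<F> where F: "finite \<F>" "\<F> \<subseteq> U ` topspace X" "topspace X \<subseteq> \<Union>\<F>"
    by blast
  from finite_subset_image[OF F(1,2)]
  obtain I where I: "finite I" "I \<subseteq> topspace X" "topspace X \<subseteq> \<Union>(U ` I)"
    using F(3) by blast
  have "\<exists>\<V>. finite \<V> \<and> (\<forall>V\<in>\<V>. openin X V) \<and> (\<forall>V\<in>\<V>. \<forall>x\<in>V. \<forall>g\<in>padic_carrier p. act x g \<in> V) \<and>
        \<Union>\<V> = topspace X \<and> (\<forall>V\<in>\<V>. \<exists>W\<in>U ` I. V \<subseteq> W) \<and> (\<forall>x\<in>topspace X. card {V \<in> \<V>. x \<in> V} \<le> k + 1)"
  proof (rule dim)
    show "\<Union>(U ` I) = topspace X" using I Uo openin_subset by blast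
  qed (use I Uo Uinv in auto)
  then obtain \<V> where V: "finite \<V>" "\<And>V. V \<in> \<V> \<Longrightarrow> openin X V"
     "\<And>V x g. V \<in> \<V> \<Longrightarrow> x \<in> V \<Longrightarrow> g \<in> padic_carrier p \<Longrightarrow> act x g \<in> V"
     "\<Union>\<V> = topspace X" "\<And>V. V \<in> \<V> \<Longrightarrow> \<exists>x\<in>I. V \<subseteq> U x"
     "\<And>x. x \<in> topspace X \<Longrightarrow> card {V \<in> \<V>. x \<in> V} \<le> k + 1"
    by (auto 0 3)
  \<comment> \<open>A member refining some \<open>U x\<close> inherits the slices of
    \<open>x\<close>, so each member carries an equivariant map to the cyclic group of order
    \<open>p^n\<close>.\<close>
  have "\<exists>K. slices n K \<and> V \<subseteq> (\<Union>a. K a)" if "V \<in> \<V>" for V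
    using V(5)[OF that] L I unfolding U_def by blast
  then obtain K where K: "\<And>V. V \<in> \<V> \<Longrightarrow> slices n (K V)" "\<And>V. V \<in> \<V> \<Longrightarrow> V \<subseteq> (\<Union>a. K V a)"
    by metis
  obtain f where f: "\<And>V. continuous_map X euclideanreal (f V)"
    "\<And>V x. x \<in> topspace X \<Longrightarrow> 0 \<le> f V x"
    "\<And>V x. x \<in> topspace X \<Longrightarrow> f V x \<noteq> 0 \<Longrightarrow> V \<in> \<V> \<and> x \<in> V"
    "\<And>V x g. x \<in> topspace X \<Longrightarrow> g \<in> padic_carrier p \<Longrightarrow> f V (act x g) = f V x"
    "\<And>x. x \<in> topspace X \<Longrightarrow> \<exists>V\<in>\<V>. f V x \<noteq> 0"
    using invariant_bumps[OF X V(2,3,4)] by blast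
  define out where "out S x = (\<Sum>V\<in>\<V> - S. f V x)" for S x
  define u where "u S x = (\<Prod>V\<in>S. max 0 (f V x - out S x))" for S x
  \<comment> \<open>Colour \<open>i\<close> belongs to subfamilies of size \<open>i + 1\<close>, so
    the colours \<open>0, ..., k\<close> match the sizes \<open>1, ..., k + 1\<close>.\<close>
  define C where "C i = {S. S \<subseteq> \<V> \<and> card S = Suc i}" for i
  have C: "finite (C i)" "S \<in> C i \<Longrightarrow> finite S \<and> S \<subseteq> \<V> \<and> S \<noteq> {} \<and> card S = Suc i" for i S
  proof -
    show "finite (C i)" unfolding C_def using V(1) by (intro finite_subset[OF _ finite_Pow_iff[THEN iffD2, OF V(1)]]) auto
    show "S \<in> C i \<Longrightarrow> finite S \<and> S \<subseteq> \<V> \<and> S \<noteq> {} \<and> card S = Suc i"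
      unfolding C_def using V(1) by (auto intro: finite_subset)
  qed
  have u_cont: "continuous_map X euclideanreal (u S)" if "S \<in> C i" for S i
    unfolding u_def out_def using C(2)[OF that] V(1)
    by (intro continuous_intros f) (auto intro: continuous_map_sum f)
  have u_nonneg: "0 \<le> u S x" for S x
    unfolding u_def by (intro prod_nonneg) auto
  have u_dom: "f V x > out S x \<and> V \<in> S" if "u S x \<noteq> 0" "S \<in> C i" "V \<in> S" for S x i V
  proof -
    have "max 0 (f V x - out S x) \<noteq> 0" using that C(2)[OF that(2)] unfolding u_def by auto
    then show ?thesis using that by auto
  qed
  have out_ge: "f V x \<le> out S x" if "x \<in> topspace X" "V \<in> \<V>" "V \<notin> S" for S x V
    unfolding out_def using that V(1) by (intro member_le_sum) (auto intro: f(2))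
  have out_nonneg: "0 \<le> out S x" if "x \<in> topspace X" for S x
    unfolding out_def using that by (intro sum_nonneg) (auto intro: f(2))
  have u_inv: "u S (act x g) = u S x" if "x \<in> topspace X" "g \<in> padic_carrier p" for S x g
    unfolding u_def out_def using f(4)[OF that] by simp
  have u_unique: "S = S'"
    if *: "x \<in> topspace X" "u S x \<noteq> 0" "u S' x \<noteq> 0" "S \<in> C i" "S' \<in> C i" for S S' x i
  proof (rule ccontr)
    assume ne: "S \<noteq> S'"
    \<comment> \<open>Equal size excludes inclusion in either direction, so each family has a member
      outside the other; each of the two bumps would have to exceed the other one.\<close>
    have "\<not> S \<subseteq> S'" "\<not> S' \<subseteq> S"
      using ne C(2)[OF *(4)] C(2)[OF *(5)] card_subset_eq by metis+
    then obtain V V' where VV: "V \<in> S" "V \<notin> S'" "V' \<in> S'" "V' \<notin> S" by blast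
    then have "f V x < f V' x" "f V' x < f V x"
      using u_dom[OF *(2,4) VV(1)] u_dom[OF *(3,5) VV(3)] C(2)[OF *(4)] C(2)[OF *(5)]
        out_ge[OF *(1), of V S'] out_ge[OF *(1), of V' S] by force+
    then show False by simp
  qed
  \<comment> \<open>Any member of \<open>S\<close> will do: where \<open>u S\<close> is nonzero all
    bumps of \<open>S\<close> are positive, so the point lies in every member.\<close>
  define c where "c S = K (SOME V. V \<in> S)" for S
  have c: "slices n (c S)" "\<And>x. x \<in> topspace X \<Longrightarrow> u S x \<noteq> 0 \<Longrightarrow> x \<in> (\<Union>a. c S a)" if "S \<in> C i" for S i
  proof -
    have S: "(SOME V. V \<in> S) \<in> S" using C(2)[OF that] by (simp add: some_in_eq)
    then show "slices n (c S)" unfolding c_def using C(2)[OF that] by (intro K) blast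
    fix x assume x: "x \<in> topspace X" and "u S x \<noteq> 0"
    from u_dom[OF this(2) that S] out_nonneg[OF x, of S] have "f (SOME V. V \<in> S) x \<noteq> 0" by simp
    then show "x \<in> (\<Union>a. c S a)" using f(3)[OF x] K(2) unfolding c_def by blast
  qed
  define \<psi>0 where "\<psi>0 x i a = (if i \<le> k then \<Sum>S\<in>C i. u S x * indicat_real (c S a) x else 0)" for x i a
  have nz: "\<exists>S\<in>C i. u S x \<noteq> 0 \<and> x \<in> c S a" if "\<psi>0 x i a \<noteq> 0" for x i a
  proof -
    have "\<exists>S\<in>C i. u S x * indicat_real (c S a) x \<noteq> 0"
      using that unfolding \<psi>0_def by (meson sum.neutral)
    then show ?thesis by (auto simp: indicator_def split: if_splits)
  qed
  have col: "coloured k ?q (\<psi>0 x)" if x: "x \<in> topspace X" for x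
  proof (rule colouredI)
    fix i and a b :: int
    show "0 \<le> \<psi>0 x i a" unfolding \<psi>0_def by (auto intro!: sum_nonneg u_nonneg mult_nonneg_nonneg)
    show "\<psi>0 x i a = 0" if "k < i" using that by (simp add: \<psi>0_def)
    show "\<psi>0 x i a = \<psi>0 x i b" if ab: "a mod ?q = b mod ?q"
    proof -
      have "c S a = c S b" if "S \<in> C i" for S by (rule slicesD(2)[OF c(1)[OF that] ab])
      then show ?thesis unfolding \<psi>0_def by (simp cong: sum.cong)
    qed
    assume "\<psi>0 x i a \<noteq> 0" "\<psi>0 x i b \<noteq> 0"
    then obtain S S' where S: "S \<in> C i" "u S x \<noteq> 0" "x \<in> c S a" "S' \<in> C i" "u S' x \<noteq> 0" "x \<in> c S' b"
      using nz[of x i a] nz[of x i b] by blast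
    then have "S = S'" by (intro u_unique[OF x]) auto
    then show "a mod ?q = b mod ?q" using slicesD(3)[OF c(1)[OF S(1)] S(3)] S(6) by simp
  qed
  have pos: "\<exists>i a. \<psi>0 x i a \<noteq> 0" if x: "x \<in> topspace X" for x
  proof -
    \<comment> \<open>The family of all bumps nonzero at \<open>x\<close> leaves nothing outside it,
      so \<open>u S x\<close> is a product of positive numbers. The order of the cover bounds its
      size by \<open>k + 1\<close>, hence its colour by \<open>k\<close>.\<close>
    define S where "S = {V \<in> \<V>. f V x \<noteq> 0}"
    have S: "S \<subseteq> \<V>" "finite S" "S \<noteq> {}" using V(1) f(5)[OF x] unfolding S_def by auto
    have "card S \<le> card {V \<in> \<V>. x \<in> V}"
      using V(1) f(3)[OF x] unfolding S_def by (intro card_mono) auto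
    then have ck: "card S \<le> k + 1" using V(6)[OF x] by simp
    define i where "i = card S - 1"
    have i: "card S = Suc i" "i \<le> k" using S ck unfolding i_def by (auto simp: card_gt_0_iff Suc_diff_1)
    have SC: "S \<in> C i" using S i by (simp add: C_def)
    have "out S x = 0" unfolding out_def S_def by (intro sum.neutral) auto
    then have "u S x = (\<Prod>V\<in>S. f V x)" unfolding u_def using f(2)[OF x] by (simp add: max_absorb2)
    then have uS: "u S x \<noteq> 0" using S(2) unfolding S_def by simp
    then obtain a where a: "x \<in> c S a" using c(2)[OF SC x] by blast
    have "0 < (\<Sum>S\<in>C i. u S x * indicat_real (c S a) x)"
      by (rule sum_pos2[OF C(1) SC]) (use uS u_nonneg[of S x] a u_nonneg in \<open>auto simp: less_le\<close>)
    then have "\<psi>0 x i a \<noteq> 0" using i by (simp add: \<psi>0_def)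
    then show ?thesis by blast
  qed
  have cont0: "continuous_map X euclideanreal (\<lambda>x. \<psi>0 x i a)" for i a
  proof (cases "i \<le> k")
    case True
    have "continuous_map X euclideanreal (\<lambda>x. u S x * indicat_real (c S a) x)" if S: "S \<in> C i" for S
    \<comment> \<open>On the support of \<open>u S\<close> the slices cover everything, so the
      slices of other residues supply the complementary open set.\<close>
    proof (rule continuous_map_times_indicator[OF u_cont[OF S] u_nonneg, where L' = "\<Union>b\<in>{b. b mod ?q \<noteq> a mod ?q}. c S b"])
      show "openin X (c S a)" by (rule slicesD(1)[OF c(1)[OF S]])
      show "openin X (\<Union>b\<in>{b. b mod ?q \<noteq> a mod ?q}. c S b)"
        using slicesD(1)[OF c(1)[OF S]] by (intro openin_Union) auto
      show "c S a \<inter> (\<Union>b\<in>{b. b mod ?q \<noteq> a mod ?q}. c S b) = {}"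
        using slicesD(3)[OF c(1)[OF S]] by blast
      fix x assume "x \<in> topspace X" "u S x \<noteq> 0"
      then obtain b where "x \<in> c S b" using c(2)[OF S] by blast
      then show "x \<in> c S a \<union> (\<Union>b\<in>{b. b mod ?q \<noteq> a mod ?q}. c S b)"
        using slicesD(2)[OF c(1)[OF S], of a b] by (cases "b mod ?q = a mod ?q") auto
    qed
    then show ?thesis unfolding \<psi>0_def if_P[OF True] by (intro continuous_map_sum C(1))
  next
    case False
    then show ?thesis by (simp add: \<psi>0_def)
  qed
  have equi: "\<psi>0 (act x g) = shift (g n) (\<psi>0 x)" if x: "x \<in> topspace X" and g: "g \<in> padic_carrier p" for x g
  proof (intro ext)
    fix i a
    have "u S (act x g) * indicat_real (c S a) (act x g) = u S x * indicat_real (c S (a - g n)) x" if "S \<in> C i" for S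
      using slices_act_iff[OF c(1)[OF that] x g, of a] u_inv[OF x g] by (simp add: indicator_def)
    then show "\<psi>0 (act x g) i a = shift (g n) (\<psi>0 x) i a"
      unfolding \<psi>0_def shift_def by (simp cong: sum.cong)
  qed
  show thesis
  proof (rule that[of "\<lambda>x i a. \<psi>0 x i a / total k ?q (\<psi>0 x)"]; intro allI ballI)
    show "(\<lambda>i a. \<psi>0 x i a / total k ?q (\<psi>0 x)) \<in> join_weights k ?q" if x: "x \<in> topspace X" for x
      using normalise_join_weights[OF col[OF x] q] pos[OF x] by blast
    show "continuous_map X euclideanreal (\<lambda>x. \<psi>0 x i a / total k ?q (\<psi>0 x))" for i a
    proof (rule continuous_map_real_divide[OF cont0])
      show "continuous_map X euclideanreal (\<lambda>x. total k ?q (\<psi>0 x))"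
        unfolding total_def by (intro continuous_map_sum cont0) auto
      show "total k ?q (\<psi>0 x) \<noteq> 0" if x: "x \<in> topspace X" for x
        using total_pos[OF col[OF x] q] pos[OF x] by (metis less_irrefl)
    qed
    show "(\<lambda>i a. \<psi>0 (act x g) i a / total k ?q (\<psi>0 (act x g))) = shift (g n) (\<lambda>i a. \<psi>0 x i a / total k ?q (\<psi>0 x))"
      if x: "x \<in> topspace X" and g: "g \<in> padic_carrier p" for x g
      unfolding equi[OF x g] total_shift[OF col[OF x] q] by (simp add: shift_def)
  qed
qed

end

section \<open>Equivariant maps into a manifold\<close>

lemma openin_Collect_all_less:
  fixes n :: nat
  assumes "\<And>j. j < n \<Longrightarrow> openin X {x \<in> topspace X. P j x}"
  shows "openin X {x \<in> topspace X. \<forall>j<n. P j x}"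
  using assms
proof (induction n)
  case (Suc n)
  have "{x \<in> topspace X. \<forall>j<Suc n. P j x} = {x \<in> topspace X. \<forall>j<n. P j x} \<inter> {x \<in> topspace X. P n x}"
    by (auto simp: less_Suc_eq)
  with Suc show ?case by (simp add: openin_Int)
qed simp

lemma Euclidean_space_box:
  assumes V: "openin (Euclidean_space n) V" and y0: "y0 \<in> V"
  obtains e where "0 < e" "\<And>y. y \<in> topspace (Euclidean_space n) \<Longrightarrow> (\<And>i. i < n \<Longrightarrow> \<bar>y i - y0 i\<bar> \<le> e) \<Longrightarrow> y \<in> V"
proof -
  obtain W where W: "openin (powertop_real UNIV) W" "V = W \<inter> {x. \<forall>i\<ge>n. x i = 0}"
    using V unfolding Euclidean_space_def openin_subtopology by blast
  have "y0 \<in> W" using W y0 by blast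
  from product_topology_open_contains_basis[OF W(1) this]
  obtain B where B: "y0 \<in> (\<Pi>\<^sub>E i\<in>UNIV. B i)" "\<And>i. open (B i :: real set)" "(\<Pi>\<^sub>E i\<in>UNIV. B i) \<subseteq> W"
    by auto
  have "\<exists>e>0. cball (y0 i) e \<subseteq> B i" for i
    using B(1) B(2)[of i] open_contains_cball[of "B i"] by (auto simp: PiE_iff)
  then obtain e where e: "\<And>i. e i > 0" "\<And>i. cball (y0 i) (e i) \<subseteq> B i" by metis
  \<comment> \<open>Only the first \<open>n\<close> coordinates matter, the others being
    \<open>0\<close> in all points of the space; the inserted \<open>1\<close> keeps the minimum
    meaningful for \<open>n = 0\<close>.\<close>
  define \<epsilon> where "\<epsilon> = Min (insert 1 (e ` {..<n}))"
  show thesis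
  proof (rule that[of \<epsilon>])
    show "0 < \<epsilon>" unfolding \<epsilon>_def using e(1) by (subst Min_gr_iff) auto
    fix y assume y: "y \<in> topspace (Euclidean_space n)" "\<And>i. i < n \<Longrightarrow> \<bar>y i - y0 i\<bar> \<le> \<epsilon>"
    have "y i \<in> B i" for i
    proof (cases "i < n")
      case True
      have "\<epsilon> \<le> e i" unfolding \<epsilon>_def using True by (intro Min_le) auto
      then have "y i \<in> cball (y0 i) (e i)" using y(2)[OF True] by (simp add: dist_real_def abs_minus_commute)
      then show ?thesis using e(2) by blast
    next
      case False
      then have "y i = 0" "y0 i = 0" using y(1) y0 W(2) by (auto simp: topspace_Euclidean_space)
      then show ?thesis using PiE_mem[OF B(1) UNIV_I, of i] by simp
    qed
    then have "y \<in> W" using B(3) by blast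
    then show "y \<in> V" using W(2) y(1) by (simp add: topspace_Euclidean_space)
  qed
qed

text \<open>Concentric boxes in a chart, contracted along straight lines to their common centre, a
  contraction that preserves every box. Open boxes fit between consecutive ones; this leaves room
  for a small group element to move a point one box outwards.\<close>

lemma manifold_contractible_neighbourhoods:
  assumes M: "topological_manifold n M" and x0: "x0 \<in> topspace M"
  obtains D :: "nat \<Rightarrow> 'a set" and O' :: "nat \<Rightarrow> 'a set" and c :: "'a \<Rightarrow> real \<Rightarrow> 'a" where
    "x0 \<in> D 0" "\<forall>i\<le>l. compactin M (D i)"
    "\<forall>i<l. openin M (O' i) \<and> D i \<subseteq> O' i \<and> O' i \<subseteq> D (Suc i)"
    "continuous_map (prod_topology (subtopology M (D l)) (top_of_set {0..1})) M (\<lambda>(x, s). c x s)"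
    "\<forall>i\<le>l. \<forall>x\<in>D i. \<forall>s\<in>{0..1}. c x s \<in> D i"
    "\<forall>x\<in>D l. c x 0 = x \<and> c x 1 = x0" "\<forall>i j. i \<le> j \<longrightarrow> D i \<subseteq> D j"
proof -
  obtain U V where UV: "openin M U" "x0 \<in> U" "openin (Euclidean_space n) V"
    "subtopology M U homeomorphic_space subtopology (Euclidean_space n) V"
    using M x0 unfolding topological_manifold_def by blast
  let ?E = "subtopology (Euclidean_space n) V"
  obtain f g where fg: "homeomorphic_maps (subtopology M U) ?E f g"
    using UV(4) unfolding homeomorphic_space_def by blast
  have Us: "topspace (subtopology M U) = U" using openin_subset[OF UV(1)] by auto
  have Vs: "topspace ?E = V" using openin_subset[OF UV(3)] by auto
  have f: "continuous_map (subtopology M U) ?E f" and g: "continuous_map ?E (subtopology M U) g"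
    and gf: "\<And>x. x \<in> U \<Longrightarrow> g (f x) = x" and fg': "\<And>y. y \<in> V \<Longrightarrow> f (g y) = y"
    using fg unfolding homeomorphic_maps_def Us Vs by auto
  have fV: "f x \<in> V" if "x \<in> U" for x
    using continuous_map_image_subset_topspace[OF f] that unfolding Us Vs by blast
  have gU: "g y \<in> U" if "y \<in> V" for y
    using continuous_map_image_subset_topspace[OF g] that unfolding Us Vs by blast
  have f_zero: "f x i = 0" if "x \<in> U" "i \<ge> n" for x i
    using fV[OF that(1)] openin_subset[OF UV(3)] that(2) by (auto simp: topspace_Euclidean_space)
  define y0 where "y0 = f x0"
  have y0: "y0 \<in> V" unfolding y0_def by (rule fV[OF UV(2)])
  have y0_zero: "y0 i = 0" if "i \<ge> n" for i unfolding y0_def using f_zero[OF UV(2) that] .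
  obtain e where e: "0 < e" "\<And>y. y \<in> topspace (Euclidean_space n) \<Longrightarrow> (\<And>i. i < n \<Longrightarrow> \<bar>y i - y0 i\<bar> \<le> e) \<Longrightarrow> y \<in> V"
    using Euclidean_space_box[OF UV(3) y0] by blast
  \<comment> \<open>Radii in equal steps, positive at \<open>i = 0\<close> and reaching the
    admissible \<open>e\<close> exactly at \<open>i = l\<close>.\<close>
  define r where "r i = e * (real i + 1) / (real l + 1)" for i
  have r: "0 < r i" "i < j \<Longrightarrow> r i < r j" "i \<le> l \<Longrightarrow> r i \<le> e" for i j
  proof -
    show "0 < r i" unfolding r_def using e(1) by (intro divide_pos_pos mult_pos_pos) auto
    show "i < j \<Longrightarrow> r i < r j" unfolding r_def using e(1)
      by (intro divide_strict_right_mono mult_strict_left_mono) auto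
    show "i \<le> l \<Longrightarrow> r i \<le> e" unfolding r_def using e(1) by (auto simp: field_simps)
  qed
  have r_mono: "r i \<le> r j" if "i \<le> j" for i j using r(2)[of i j] that by (cases "i = j") auto
  define D where "D i = {x \<in> U. \<forall>j<n. \<bar>f x j - y0 j\<bar> \<le> r i}" for i
  define Q where "Q i = {x \<in> U. \<forall>j<n. \<bar>f x j - y0 j\<bar> < r (Suc i)}" for i
  define c where "c x s = g (\<lambda>j. (1 - s) * f x j + s * y0 j)" for x s
  have f_comp: "continuous_map (subtopology M U) euclideanreal (\<lambda>x. f x j)" for j
  proof -
    have "continuous_map (subtopology M U) (powertop_real UNIV) f"
      using f unfolding Euclidean_space_def by (blast intro: continuous_map_into_fulltopology)
    then show ?thesis by (simp add: continuous_map_componentwise_UNIV)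
  qed
  have comp: "compactin M (D i)" if i: "i \<le> l" for i
  proof -
    \<comment> \<open>The box as a product of compact sets, with the coordinates from
      \<open>n\<close> on pinned to \<open>0\<close>; compactness is Tychonoff, and \<open>g\<close>
      carries it back to \<open>M\<close>.\<close>
    let ?B = "\<Pi>\<^sub>E j\<in>UNIV. if j < n then {y0 j - r i..y0 j + r i} else {0}"
    have "compactin (powertop_real UNIV) ?B"
      unfolding compactin_PiE by (auto simp: compactin_euclidean_iff)
    moreover have B: "?B \<subseteq> V"
    proof
      fix y assume y: "y \<in> ?B"
      have yj: "y j \<in> (if j < n then {y0 j - r i..y0 j + r i} else {0})" for j
        using PiE_mem[OF y UNIV_I, of j] .
      show "y \<in> V"
      proof (rule e(2))
        have "y j = 0" if "n \<le> j" for j using yj[of j] that by simp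
        then show "y \<in> topspace (Euclidean_space n)" by (simp add: topspace_Euclidean_space)
        fix j assume "j < n"
        then show "\<bar>y j - y0 j\<bar> \<le> e" using yj[of j] r(3)[OF i] by auto
      qed
    qed
    ultimately have "compactin ?E ?B"
      using openin_subset[OF UV(3)] unfolding Euclidean_space_def subtopology_subtopology
      by (auto simp: compactin_subtopology topspace_Euclidean_space)
    from image_compactin[OF this g] have "compactin (subtopology M U) (g ` ?B)" .
    moreover have "g ` ?B = D i"
    proof (intro equalityI subsetI)
      fix x assume "x \<in> g ` ?B"
      then obtain y where y: "y \<in> ?B" "x = g y" by blast
      have yj: "y j \<in> (if j < n then {y0 j - r i..y0 j + r i} else {0})" for j
        using PiE_mem[OF y(1) UNIV_I, of j] .
      have "\<bar>y j - y0 j\<bar> \<le> r i" if "j < n" for j using yj[of j] that by auto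
      moreover have "y \<in> V" using y(1) B by blast
      ultimately show "x \<in> D i" unfolding D_def using gU fg' y(2) by simp
    next
      fix x assume x: "x \<in> D i"
      have "f x \<in> ?B"
      proof (rule PiE_I)
        fix j show "f x j \<in> (if j < n then {y0 j - r i..y0 j + r i} else {0})"
        proof (cases "j < n")
          case True
          then have "\<bar>f x j - y0 j\<bar> \<le> r i" using x unfolding D_def by blast
          then show ?thesis using True by (simp add: abs_le_iff)
        next
          case False
          then show ?thesis using x f_zero unfolding D_def by simp
        qed
      qed simp
      then have "g (f x) \<in> g ` ?B" by (rule imageI)
      moreover have "g (f x) = x" using x gf unfolding D_def by simp
      ultimately show "x \<in> g ` ?B" by (simp only:)
    qed
    ultimately show ?thesis by (simp add: compactin_subtopology)
  qed
  have Q: "openin M (Q i) \<and> D i \<subseteq> Q i \<and> Q i \<subseteq> D (Suc i)" for i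
  proof (intro conjI)
    have "openin (subtopology M U) {x \<in> topspace (subtopology M U). \<forall>j<n. \<bar>f x j - y0 j\<bar> < r (Suc i)}"
    proof (rule openin_Collect_all_less)
      fix j
      have "continuous_map (subtopology M U) euclideanreal (\<lambda>x. \<bar>f x j - y0 j\<bar>)"
        by (intro continuous_intros f_comp)
      from openin_continuous_map_preimage[OF this, of "{..<r (Suc i)}"]
      show "openin (subtopology M U) {x \<in> topspace (subtopology M U). \<bar>f x j - y0 j\<bar> < r (Suc i)}" by simp
    qed
    then have "openin (subtopology M U) (Q i)" unfolding Q_def Us .
    then show "openin M (Q i)" using UV(1) by (rule openin_trans_full)
    have "r i < r (Suc i)" by (rule r(2)) simp
    then show "D i \<subseteq> Q i" unfolding D_def Q_def using le_less_trans by blast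
    show "Q i \<subseteq> D (Suc i)" unfolding D_def Q_def using less_imp_le by blast
  qed
  have seg: "(\<lambda>j. (1 - s) * f x j + s * y0 j) \<in> topspace (Euclidean_space n)"
    "j < n \<Longrightarrow> \<bar>(1 - s) * f x j + s * y0 j - y0 j\<bar> \<le> r i"
    if x: "x \<in> D i" and s: "s \<in> {0..1}" for x s i j
  proof -
    show "(\<lambda>j. (1 - s) * f x j + s * y0 j) \<in> topspace (Euclidean_space n)"
      using x f_zero y0_zero unfolding D_def by (simp add: topspace_Euclidean_space)
    assume "j < n"
    then have le: "\<bar>f x j - y0 j\<bar> \<le> r i" using x unfolding D_def by blast
    have "(1 - s) * f x j + s * y0 j - y0 j = (1 - s) * (f x j - y0 j)" by (simp add: algebra_simps)
    then have "\<bar>(1 - s) * f x j + s * y0 j - y0 j\<bar> = (1 - s) * \<bar>f x j - y0 j\<bar>"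
      using s by (simp add: abs_mult)
    also have "\<dots> \<le> 1 * r i" using s le by (intro mult_mono) auto
    finally show "\<bar>(1 - s) * f x j + s * y0 j - y0 j\<bar> \<le> r i" by simp
  qed
  have segV: "(\<lambda>j. (1 - s) * f x j + s * y0 j) \<in> V" if "x \<in> D i" "s \<in> {0..1}" "i \<le> l" for x s i
    using seg[OF that(1,2)] r(3)[OF that(3)] by (intro e(2)) (auto intro: order_trans)
  show thesis
  proof (rule that[of D Q c])
    show "x0 \<in> D 0" unfolding D_def y0_def using UV(2) r(1)[of 0] by simp
    show "\<forall>i\<le>l. compactin M (D i)" using comp by blast
    show "\<forall>i<l. openin M (Q i) \<and> D i \<subseteq> Q i \<and> Q i \<subseteq> D (Suc i)" using Q by blast
    let ?P = "prod_topology (subtopology M (D l)) (top_of_set {0..1::real})"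
    have DU: "D l \<subseteq> U" unfolding D_def by blast
    have tP: "topspace ?P = D l \<times> {0..1}" using DU openin_subset[OF UV(1)] by auto
    have fst: "continuous_map ?P (subtopology M U) fst"
      using continuous_map_fst[of "subtopology M (D l)" "top_of_set {0..1::real}"] DU
      by (auto simp: continuous_map_in_subtopology)
    have snd: "continuous_map ?P euclideanreal snd"
      by (rule continuous_map_into_fulltopology[OF continuous_map_snd])
    have fj: "continuous_map ?P euclideanreal (\<lambda>z. f (fst z) j)" for j
      using continuous_map_compose[OF fst f_comp[of j]] by (simp add: o_def)
    \<comment> \<open>The explicit zeros from \<open>n\<close> on allow a coordinatewise check; they
      change nothing, since both ends of the segment vanish there.\<close>
    have "continuous_map ?P (Euclidean_space n)
       (\<lambda>z j. if j < n then (1 - snd z) * f (fst z) j + snd z * y0 j else 0)"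
      unfolding continuous_map_componentwise_Euclidean_space
      by (intro allI impI continuous_intros fj snd)
    moreover have "(\<lambda>j. if j < n then (1 - snd z) * f (fst z) j + snd z * y0 j else 0) =
       (\<lambda>j. (1 - snd z) * f (fst z) j + snd z * y0 j)" if "z \<in> topspace ?P" for z
      using that DU f_zero y0_zero unfolding tP by (auto simp: fun_eq_iff)
    ultimately have "continuous_map ?P (Euclidean_space n) (\<lambda>z j. (1 - snd z) * f (fst z) j + snd z * y0 j)"
      by (rule continuous_map_eq)
    then have "continuous_map ?P ?E (\<lambda>z j. (1 - snd z) * f (fst z) j + snd z * y0 j)"
      using segV[of _ l] unfolding continuous_map_in_subtopology tP by auto
    from continuous_map_compose[OF this g]
    have "continuous_map ?P (subtopology M U) (\<lambda>(x, s). c x s)"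
      by (simp add: o_def c_def case_prod_unfold)
    then show "continuous_map ?P M (\<lambda>(x, s). c x s)" by (rule continuous_map_into_fulltopology)
    have "c x s \<in> D i" if *: "i \<le> l" "x \<in> D i" "s \<in> {0..1}" for i x s
      using seg(2)[OF *(2,3)] segV[OF *(2,3,1)] gU fg' unfolding c_def D_def by simp
    then show "\<forall>i\<le>l. \<forall>x\<in>D i. \<forall>s\<in>{0..1}. c x s \<in> D i" by blast
    have "c x 0 = x \<and> c x 1 = x0" if "x \<in> D l" for x
      using that gf UV(2) unfolding c_def D_def y0_def by simp
    then show "\<forall>x\<in>D l. c x 0 = x \<and> c x 1 = x0" by blast
    have "D i \<subseteq> D j" if "i \<le> j" for i j
      using r_mono[OF that] unfolding D_def by (blast intro: order_trans)
    then show "\<forall>i j. i \<le> j \<longrightarrow> D i \<subseteq> D j" by blast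
  qed
qed

section \<open>Small subgroups of the p-adic integers\<close>

context padic_space
begin

text \<open>The pairs of a point of \<open>D\<close> and an element with vanishing
  \<open>j\<close>-th residue that leave \<open>U\<close> form decreasing compact sets. A pair in
  all of them has group element \<open>0\<close>, which does not move the point out of
  \<open>U\<close>; so one of the sets is empty.\<close>

lemma small_subgroup:
  assumes D: "compactin X D" and U: "openin X U" "D \<subseteq> U"
  obtains j where "\<And>x g. x \<in> D \<Longrightarrow> g \<in> padic_carrier p \<Longrightarrow> g j = 0 \<Longrightarrow> act x g \<in> U"
proof -
  let ?P = "prod_topology (subtopology X D) (padic_topology p)"
  define C where "C j = {z \<in> topspace ?P. (case z of (x, g) \<Rightarrow> act x g) \<in> topspace X - U} \<inter>
     {z \<in> topspace ?P. snd z \<in> {g \<in> padic_carrier p. g j = 0}}" for j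
  have DX: "D \<subseteq> topspace X" using D compactin_subset_topspace by blast
  have tP: "topspace ?P = D \<times> padic_carrier p" using DX by (auto simp: topspace_padic_topology)
  have "continuous_map ?P X (\<lambda>(x, g). act x g)"
    using action unfolding continuous_action_def prod_topology_subtopology
    by (blast intro: continuous_map_from_subtopology)
  then have clo: "closedin ?P (C j)" for j
    unfolding C_def using U(1)
    by (intro closedin_Int closedin_continuous_map_preimage[OF _ closedin_diff]
      closedin_continuous_map_preimage[OF continuous_map_snd padic_proj_clopen(2)]) auto
  have "\<exists>j. C j = {}"
  proof (rule compact_space_decseq_empty)
    show "compact_space ?P"
      using D compact_space_padic by (auto simp: compact_space_prod_topology compactin_subspace)
    show "closedin ?P (C j)" for j by (rule clo)
    have "g j = 0" if "g \<in> padic_carrier p" "g (Suc j) = 0" for g j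
      using padic_coherent[OF that(1), of j "Suc j"] that(2) by simp
    then show "C (Suc j) \<subseteq> C j" for j unfolding C_def by auto
    show "(\<Inter>j. C j) = {}"
    proof (rule ccontr)
      assume "(\<Inter>j. C j) \<noteq> {}"
      then obtain x g where xg: "\<And>j. (x, g) \<in> C j" by auto
      then have xg': "g = (\<lambda>n. 0)" "x \<in> D" "act x g \<notin> U" unfolding C_def tP by (auto simp: fun_eq_iff)
      then have "act x g = x" using act_zero DX by blast
      then show False using xg' U(2) by auto
    qed
  qed blast
  then obtain j where j: "C j = {}" by blast
  show thesis
  proof (rule that[of j])
    fix x g assume xg: "x \<in> D" "g \<in> padic_carrier p" "g j = 0"
    then have "(x, g) \<notin> C j" using j by blast
    then show "act x g \<in> U" using xg DX act_closed unfolding C_def tP by auto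
  qed
qed

text \<open>The largest of finitely many exponents serves every step, because a vanishing residue
  forces all lower residues to vanish.\<close>

lemma small_subgroup_chain:
  assumes "\<And>i. i < l \<Longrightarrow> compactin X (D i)" "\<And>i. i < l \<Longrightarrow> openin X (U i) \<and> D i \<subseteq> U i \<and> U i \<subseteq> D (Suc i)"
  obtains j where "\<forall>i<l. \<forall>x\<in>D i. \<forall>g\<in>padic_carrier p. g j = 0 \<longrightarrow> act x g \<in> D (Suc i)"
proof -
  have "\<exists>j. \<forall>x\<in>D i. \<forall>g\<in>padic_carrier p. g j = 0 \<longrightarrow> act x g \<in> D (Suc i)" if "i < l" for i
    using small_subgroup[OF assms(1)[OF that], of "U i"] assms(2)[OF that] by (meson subsetD)
  then obtain j where j: "\<And>i x g. i < l \<Longrightarrow> x \<in> D i \<Longrightarrow> g \<in> padic_carrier p \<Longrightarrow> g (j i) = 0 \<Longrightarrow> act x g \<in> D (Suc i)"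
    by metis
  show thesis
  proof (rule that[of "Max (insert 0 (j ` {..<l}))"], intro allI ballI impI)
    fix i x g assume *: "i < l" "x \<in> D i" "g \<in> padic_carrier p" "g (Max (insert 0 (j ` {..<l}))) = 0"
    have "j i \<le> Max (insert 0 (j ` {..<l}))" using *(1) by (intro Max_ge) auto
    from padic_coherent[OF *(3) this] have "g (j i) = 0" using *(4) by simp
    then show "act x g \<in> D (Suc i)" using j * by blast
  qed
qed

lemma padic_multiple:
  assumes "g \<in> padic_carrier p"
  shows "(\<lambda>n. (a * g n) mod int p ^ n) \<in> padic_carrier p"
proof (rule padic_carrierI[OF p])
  fix n
  have "(a * g (Suc n)) mod int p ^ Suc n mod int p ^ n = (a * g (Suc n)) mod int p ^ n"
    by (rule mod_mod_cancel) simp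
  also have "\<dots> = (a * (g (Suc n) mod int p ^ n)) mod int p ^ n" by (simp add: mod_simps)
  also have "g (Suc n) mod int p ^ n = g n" by (rule padic_coherent[OF assms]) simp
  finally show "(a * g (Suc n)) mod int p ^ Suc n mod int p ^ n = (a * g n) mod int p ^ n" .
qed simp

text \<open>Restricting the action to the subgroup \<open>p\<^sup>j\<int>\<^sub>p\<close>, identified with \<open>\<int>\<^sub>p\<close>.\<close>

lemma padic_space_multiple:
  "padic_space p X (\<lambda>x g. act x (\<lambda>n. (int p ^ j * g n) mod int p ^ n))"
proof
  let ?m = "\<lambda>g n. (int p ^ j * g n) mod int p ^ n"
  let ?T = "padic_topology p"
  show "0 < p" by (rule p)
  have cm: "continuous_map ?T ?T ?m"
  proof (rule continuous_map_into_padic)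
    fix n
    have "continuous_map (discrete_topology {0..<int p ^ n}) (discrete_topology {0..<int p ^ n})
       (\<lambda>a. (int p ^ j * a) mod int p ^ n)" using p by auto
    from continuous_map_compose[OF continuous_map_padic_proj this]
    show "continuous_map ?T (discrete_topology {0..<int p ^ n}) (\<lambda>g. ?m g n)" by (simp add: o_def)
  qed (use padic_multiple in \<open>auto simp: topspace_padic_topology\<close>)
  show "continuous_action (padic_group p) ?T X (\<lambda>x g. act x (?m g))"
    unfolding continuous_action_def
  proof (intro conjI ballI)
    have "continuous_map (prod_topology X ?T) X (\<lambda>z. act (fst z) (?m (snd z)))"
      using continuous_map_compose[OF continuous_map_snd cm, of X]
      by (intro continuous_map_act continuous_map_fst) (simp add: o_def)
    then show "continuous_map (prod_topology X ?T) X (\<lambda>(x, g). act x (?m g))"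
      by (simp add: case_prod_unfold)
    fix x assume x: "x \<in> topspace X"
    show "act x (?m \<one>\<^bsub>padic_group p\<^esub>) = x" using act_zero[OF x] by simp
    fix g h assume gh: "g \<in> carrier (padic_group p)" "h \<in> carrier (padic_group p)"
    have "(\<lambda>n. (?m g n + ?m h n) mod int p ^ n) = ?m (g \<otimes>\<^bsub>padic_group p\<^esub> h)"
      by (simp add: mod_simps distrib_left)
    then show "act (act x (?m g)) (?m h) = act x (?m (g \<otimes>\<^bsub>padic_group p\<^esub> h))"
      using x gh padic_multiple by (simp add: act_act)
  qed
  show "free_action (padic_group p) X (\<lambda>x g. act x (?m g))"
    unfolding free_action_def
  proof (intro ballI impI)
    fix x g assume x: "x \<in> topspace X" and g: "g \<in> carrier (padic_group p)" and eq: "act x (?m g) = x"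
    have "?m g = (\<lambda>n. 0)"
      using free x g eq padic_multiple[of g "int p ^ j"] unfolding free_action_def by simp
    \<comment> \<open>Multiplication by \<open>p^j\<close> is injective on the p-adic integers, but
      not modulo \<open>p^n\<close>; reading the equation \<open>j\<close> levels higher recovers
      the residue at level \<open>n\<close>.\<close>
    then have "(int p ^ j * g (n + j)) mod int p ^ (n + j) = 0" for n by (metis (full_types))
    then have "int p ^ n dvd g (n + j)" for n
      using p by (simp add: power_add mult.commute[of _ "int p ^ j"] mod_eq_0_iff_dvd)
    then have "g n = 0" for n
      using padic_coherent[of g p n "n + j"] g by simp
    then show "g = \<one>\<^bsub>padic_group p\<^esub>" by (simp add: fun_eq_iff)
  qed
qed

end

text \<open>A small action together with a contraction. Each of the \<open>m + 1\<close> colours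
  uses two translations, one before and one after the cone, and each translation costs one set of
  the chain; hence its length \<open>2 * (m + 1)\<close>.\<close>

locale padic_contraction = padic_space p X act
  for p :: nat and X :: "'a topology" and act +
  fixes m :: nat and x0 :: 'a and D :: "nat \<Rightarrow> 'a set" and c :: "'a \<Rightarrow> real \<Rightarrow> 'a"
  assumes x0: "x0 \<in> D 0"
    and D_sub: "\<And>i. i \<le> 2 * (m + 1) \<Longrightarrow> D i \<subseteq> topspace X"
    and D_mono: "\<And>i j. i \<le> j \<Longrightarrow> D i \<subseteq> D j"
    and c_cont: "continuous_map (prod_topology (subtopology X (D (2 * (m + 1)))) (top_of_set {0..1})) X (\<lambda>(x, s). c x s)"
    and c_D: "\<And>i x s. i \<le> 2 * (m + 1) \<Longrightarrow> x \<in> D i \<Longrightarrow> s \<in> {0..1} \<Longrightarrow> c x s \<in> D i"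
    and c_0: "\<And>x. x \<in> D (2 * (m + 1)) \<Longrightarrow> c x 0 = x"
    and c_1: "\<And>x. x \<in> D (2 * (m + 1)) \<Longrightarrow> c x 1 = x0"
    and act_D: "\<And>i x g. i < 2 * (m + 1) \<Longrightarrow> x \<in> D i \<Longrightarrow> g \<in> padic_carrier p \<Longrightarrow> act x g \<in> D (Suc i)"
begin

text \<open>
  A map from the iterated join of copies of \<open>\<int>\<^sub>p\<close>: the point with weights \<open>t\<close> and group
  elements \<open>g\<close> is obtained by coning off, one colour after the other, in coordinates translated
  by \<open>g i\<close>. Truncating \<open>(m + 1) t\<^sub>i\<close> at \<open>1\<close> instead of normalising partial sums makes the map
  continuous in all of \<open>t\<close>; some weight is at least \<open>1 / (m + 1)\<close>, and from there on everything
  before is forgotten and the map is equivariant.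
\<close>

primrec join_map :: "(nat \<Rightarrow> real) \<Rightarrow> (nat \<Rightarrow> nat \<Rightarrow> int) \<Rightarrow> nat \<Rightarrow> 'a" where
  "join_map t g 0 = x0"
| "join_map t g (Suc i) =
     act (c (act (join_map t g i) (\<lambda>n. (- g i n) mod int p ^ n)) (min 1 ((real m + 1) * t i))) (g i)"

lemma join_map_in_D:
  assumes t: "\<And>i. t i \<in> {0..1}" and g: "\<And>i. g i \<in> padic_carrier p"
  shows "i \<le> m + 1 \<Longrightarrow> join_map t g i \<in> D (2 * i)"
proof (induction i)
  case (Suc i)
  then have IH: "join_map t g i \<in> D (2 * i)" and i: "i \<le> m" by auto
  have "act (join_map t g i) (\<lambda>n. (- g i n) mod int p ^ n) \<in> D (Suc (2 * i))"
    using IH i by (intro act_D padic_neg_carrier p g) auto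
  then have "c (act (join_map t g i) (\<lambda>n. (- g i n) mod int p ^ n)) (min 1 ((real m + 1) * t i)) \<in> D (Suc (2 * i))"
    using i t[of i] by (intro c_D) auto
  then have "join_map t g (Suc i) \<in> D (Suc (Suc (2 * i)))"
    using i g unfolding join_map.simps by (intro act_D) auto
  then show ?case by simp
qed (use x0 in simp)

lemma join_map_step:
  assumes t: "\<And>i. t i \<in> {0..1}" and g: "\<And>i. g i \<in> padic_carrier p" and i: "i \<le> m"
    and h: "h \<in> padic_carrier p"
  shows "join_map t g i \<in> topspace X" "act (join_map t g i) h \<in> D (2 * (m + 1))"
    "c (act (join_map t g i) h) (min 1 ((real m + 1) * t i)) \<in> topspace X"
proof -
  have th: "join_map t g i \<in> D (2 * i)" using join_map_in_D[of t g, OF t g] i by simp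
  then show "join_map t g i \<in> topspace X" using D_sub[of "2 * i"] i by auto
  have "act (join_map t g i) h \<in> D (Suc (2 * i))" using th i h by (intro act_D) auto
  then show D: "act (join_map t g i) h \<in> D (2 * (m + 1))" using D_mono[of "Suc (2 * i)" "2 * (m + 1)"] i by auto
  have "c (act (join_map t g i) h) (min 1 ((real m + 1) * t i)) \<in> D (2 * (m + 1))"
    using D t[of i] by (intro c_D) auto
  then show "c (act (join_map t g i) h) (min 1 ((real m + 1) * t i)) \<in> topspace X"
    using D_sub[of "2 * (m + 1)"] by auto
qed

text \<open>At weight \<open>0\<close> the cone does nothing, so the two translations around it
  cancel. This is the identification that makes \<open>join_map\<close> a map on a join.\<close>

lemma join_map_cong:
  assumes t: "\<And>i. t i \<in> {0..1}" and g: "\<And>i. g i \<in> padic_carrier p" and g': "\<And>i. g' i \<in> padic_carrier p"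
    and eq: "\<And>i. i \<le> m \<Longrightarrow> t i = 0 \<or> g i = g' i"
  shows "i \<le> m + 1 \<Longrightarrow> join_map t g i = join_map t g' i"
proof (induction i)
  case (Suc i)
  then have IH: "join_map t g i = join_map t g' i" and i: "i \<le> m" by auto
  show ?case
  proof (cases "t i = 0")
    case True
    have "join_map t k (Suc i) = join_map t k i" if k: "\<And>i. k i \<in> padic_carrier p" for k
      using True c_0[OF join_map_step(2)[of t k, OF t k i padic_neg_carrier[OF p k[of i]]]]
        act_inverse(2)[OF join_map_step(1)[of t k, OF t k i k] k[of i]] by simp
    then show ?thesis using g g' IH by metis
  next
    case False
    then show ?thesis using IH eq[OF i] by simp
  qed
qed simp

lemma join_map_equivariant:
  assumes t: "\<And>i. t i \<in> {0..1}" and g: "\<And>i. g i \<in> padic_carrier p" and h: "h \<in> padic_carrier p"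
    and l: "l \<le> m" "1 \<le> (real m + 1) * t l"
  shows "join_map t (\<lambda>i n. (g i n + h n) mod int p ^ n) (m + 1) = act (join_map t g (m + 1)) h"
proof -
  let ?g = "\<lambda>i n. (g i n + h n) mod int p ^ n"
  have g': "?g i \<in> padic_carrier p" for i by (rule padic_add_carrier[OF p g h])
  have "i \<le> m + 1 \<longrightarrow> join_map t ?g i = act (join_map t g i) h" if "Suc l \<le> i" for i
    using that
  proof (induction i rule: dec_induct)
    case base
    have *: "join_map t k (Suc l) = act x0 (k l)" if k: "\<And>i. k i \<in> padic_carrier p" for k
      using c_1[OF join_map_step(2)[of t k, OF t k l(1) padic_neg_carrier[OF p k[of l]]]] l(2)
      by (simp add: min_absorb1)
    have "x0 \<in> topspace X" using x0 D_sub[of 0] by auto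
    then show ?case unfolding *[of ?g, OF g'] *[of g, OF g] using g h by (simp add: act_act)
  next
    case (step i)
    show ?case
    proof
      assume i: "Suc i \<le> m + 1"
      let ?C = "c (act (join_map t g i) (\<lambda>n. (- g i n) mod int p ^ n)) (min 1 ((real m + 1) * t i))"
      have IH: "join_map t ?g i = act (join_map t g i) h" using step i by simp
      \<comment> \<open>Moving by \<open>h\<close> and then back by \<open>g i + h\<close> is the
        same as moving back by \<open>g i\<close>: the cone sees the old point, and \<open>h\<close>
        survives only in the outer translation.\<close>
      have "(\<lambda>n. (h n + (- ((g i n + h n) mod int p ^ n)) mod int p ^ n) mod int p ^ n) =
        (\<lambda>n. (- g i n) mod int p ^ n)"
        by (simp add: mod_simps)
      then have "act (act (join_map t g i) h) (\<lambda>n. (- ?g i n) mod int p ^ n) =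
         act (join_map t g i) (\<lambda>n. (- g i n) mod int p ^ n)"
        using join_map_step(1)[of t g i, OF t g _ h] i h padic_neg_carrier[OF p g'[of i]] by (simp add: act_act)
      then have "join_map t ?g (Suc i) = act ?C (?g i)" unfolding join_map.simps IH by simp
      also have "\<dots> = act (act ?C (g i)) h"
        using act_act[OF join_map_step(3)[of t g i, OF t g _ padic_neg_carrier[OF p g[of i]]] g h] i by simp
      finally show "join_map t ?g (Suc i) = act (join_map t g (Suc i)) h" by simp
    qed
  qed
  from this[of "m + 1"] l show ?thesis by simp
qed

lemma continuous_map_join_map:
  assumes t: "\<And>i. continuous_map Z (top_of_set {0..1}) (\<lambda>z. t z i)"
    and g: "\<And>i. continuous_map Z (padic_topology p) (\<lambda>z. g z i)"
  shows "i \<le> m + 1 \<Longrightarrow> continuous_map Z X (\<lambda>z. join_map (t z) (g z) i)"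
proof (induction i)
  case 0
  then show ?case using x0 D_sub[of 0] by auto
next
  case (Suc i)
  have neg: "continuous_map Z (padic_topology p) (\<lambda>z n. (- g z i n) mod int p ^ n)" for i
  proof -
    have "continuous_map (padic_topology p) (padic_topology p) (\<lambda>g. inv\<^bsub>padic_group p\<^esub> g)"
      using topological_group_padic[OF p] by (simp add: topological_group_def)
    from continuous_map_compose[OF g[of i] this]
    show ?thesis
      by (rule continuous_map_eq)
        (use continuous_map_image_subset_topspace[OF g[of i]] in \<open>auto simp: o_def inv_padic_group[OF p] topspace_padic_topology\<close>)
  qed
  have tz: "t z i \<in> {0..1}" if "z \<in> topspace Z" for z i
    using continuous_map_image_subset_topspace[OF t[of i]] that by auto
  have gz: "g z i \<in> padic_carrier p" if "z \<in> topspace Z" for z i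
    using continuous_map_image_subset_topspace[OF g[of i]] that by (auto simp: topspace_padic_topology)
  have "continuous_map Z X (\<lambda>z. act (join_map (t z) (g z) i) (\<lambda>n. (- g z i n) mod int p ^ n))"
    using Suc by (intro continuous_map_act neg) auto
  moreover have "act (join_map (t z) (g z) i) (\<lambda>n. (- g z i n) mod int p ^ n) \<in> D (2 * (m + 1))" if "z \<in> topspace Z" for z
    using join_map_step(2)[of "t z" "g z", OF tz[OF that] gz[OF that] _ padic_neg_carrier[OF p gz[OF that, of i]]] Suc by simp
  ultimately have 1: "continuous_map Z (subtopology X (D (2 * (m + 1))))
      (\<lambda>z. act (join_map (t z) (g z) i) (\<lambda>n. (- g z i n) mod int p ^ n))"
    by (auto simp: continuous_map_in_subtopology)
  have "continuous_map Z euclideanreal (\<lambda>z. min 1 ((real m + 1) * t z i))"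
    by (intro continuous_intros continuous_map_into_fulltopology[OF t])
  then have 2: "continuous_map Z (top_of_set {0..1}) (\<lambda>z. min 1 ((real m + 1) * t z i))"
    using tz by (auto simp: continuous_map_in_subtopology)
  show ?case unfolding join_map.simps
    by (intro continuous_map_act g continuous_map_compose2[OF c_cont 1 2])
qed

end

section \<open>Descending to joins of finite cyclic groups\<close>

text \<open>Uniform continuity by compactness: triples \<open>(t, g, g')\<close> with
  \<open>g\<close> and \<open>g'\<close> congruent at level \<open>N\<close> and values at least
  \<open>e\<close> apart form decreasing closed sets. In the intersection \<open>g = g'\<close>, so
  it is empty.\<close>

lemma padic_uniform:
  fixes \<phi> :: "'t \<Rightarrow> (nat \<Rightarrow> nat \<Rightarrow> int) \<Rightarrow> real"
  assumes T: "compact_space T" and e: "0 < e"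
    and cont: "continuous_map (prod_topology T (product_topology (\<lambda>_. padic_topology p) UNIV)) euclideanreal (\<lambda>(t, g). \<phi> t g)"
  obtains N where "\<And>t g g'. \<lbrakk>t \<in> topspace T; \<And>i. g i \<in> padic_carrier p; \<And>i. g' i \<in> padic_carrier p; \<And>i. g i N = g' i N\<rbrakk>
    \<Longrightarrow> \<bar>\<phi> t g - \<phi> t g'\<bar> < e"
proof -
  let ?G = "product_topology (\<lambda>_::nat. padic_topology p) UNIV"
  let ?P = "prod_topology T (prod_topology ?G ?G)"
  define A where "A = {z \<in> topspace ?P. \<bar>\<phi> (fst z) (fst (snd z)) - \<phi> (fst z) (snd (snd z))\<bar> \<in> {e..}}"
  define C where "C N = A \<inter> (\<Inter>i. {z \<in> topspace ?P. fst (snd z) i N = snd (snd z) i N})" for N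
  have tG: "topspace ?G = {g. \<forall>i. g i \<in> padic_carrier p}"
    by (auto simp: topspace_padic_topology PiE_iff)
  have pr: "continuous_map ?P ?G (\<lambda>z. fst (snd z))" "continuous_map ?P ?G (\<lambda>z. snd (snd z))"
    using continuous_map_compose[OF continuous_map_snd continuous_map_fst, of T ?G ?G]
      continuous_map_compose[OF continuous_map_snd continuous_map_snd, of T ?G ?G] by (simp_all add: o_def)
  have "continuous_map ?P euclideanreal (\<lambda>z. \<bar>\<phi> (fst z) (fst (snd z)) - \<phi> (fst z) (snd (snd z))\<bar>)"
    by (intro continuous_intros continuous_map_compose2[OF cont] continuous_map_fst pr)
  from closedin_continuous_map_preimage[OF this, of "{e..}"]
  have A: "closedin ?P A" unfolding A_def by simp
  have coord: "continuous_map ?P (discrete_topology {0..<int p ^ N}) (\<lambda>z. f z i N)"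
    if "continuous_map ?P ?G f" for f :: "'t \<times> (nat \<Rightarrow> nat \<Rightarrow> int) \<times> (nat \<Rightarrow> nat \<Rightarrow> int) \<Rightarrow> nat \<Rightarrow> nat \<Rightarrow> int" and i N
  proof -
    have "continuous_map ?P (padic_topology p) (\<lambda>z. f z i)"
      using that by (simp add: continuous_map_componentwise_UNIV)
    from continuous_map_compose[OF this continuous_map_padic_proj[of p N]] show ?thesis by (simp add: o_def)
  qed
  have "closedin ?P {z \<in> topspace ?P. fst (snd z) i N = snd (snd z) i N}" for i N
    by (rule closedin_continuous_maps_eq[OF _ coord[OF pr(1)] coord[OF pr(2)]]) simp
  then have clo: "closedin ?P (C N)" for N unfolding C_def by (intro closedin_Int A closedin_Inter) auto
  have "\<exists>N. C N = {}"
  proof (rule compact_space_decseq_empty)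
    show "compact_space ?P"
      using T compact_space_padic by (simp add: compact_space_prod_topology compact_space_product_topology)
    show "closedin ?P (C N)" for N by (rule clo)
    have "g N = g' N" if "g \<in> padic_carrier p" "g' \<in> padic_carrier p" "g (Suc N) = g' (Suc N)" for g g' N
      using padic_coherent[OF that(1), of N "Suc N"] padic_coherent[OF that(2), of N "Suc N"] that(3) by simp
    then show "C (Suc N) \<subseteq> C N" for N unfolding C_def using tG by auto
    show "(\<Inter>N. C N) = {}"
    proof (rule ccontr)
      assume "(\<Inter>N. C N) \<noteq> {}"
      then obtain z where z: "\<And>N. z \<in> C N" by blast
      then have "fst (snd z) i N = snd (snd z) i N" for i N unfolding C_def by blast
      then have "fst (snd z) = snd (snd z)" by (intro ext)
      moreover have "z \<in> A" using z unfolding C_def by blast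
      ultimately show False using e unfolding A_def by simp
    qed
  qed blast
  then obtain N where N: "C N = {}" by blast
  show thesis
  proof (rule that[of N])
    fix t and g g' :: "nat \<Rightarrow> nat \<Rightarrow> int"
    assume *: "t \<in> topspace T" "\<And>i. g i \<in> padic_carrier p" "\<And>i. g' i \<in> padic_carrier p" "\<And>i. g i N = g' i N"
    have "g \<in> topspace ?G" "g' \<in> topspace ?G" unfolding tG using *(2,3) by auto
    then have P: "(t, g, g') \<in> topspace ?P" using *(1) by (simp only: topspace_prod_topology mem_Times_iff fst_conv snd_conv)
    show "\<bar>\<phi> t g - \<phi> t g'\<bar> < e"
    proof (rule ccontr)
      assume "\<not> \<bar>\<phi> t g - \<phi> t g'\<bar> < e"
      then have "(t, g, g') \<in> A" using P unfolding A_def mem_Collect_eq fst_conv snd_conv by simp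
      then have "(t, g, g') \<in> C N" using P *(4) unfolding C_def by (simp only: Int_iff INT_iff mem_Collect_eq fst_conv snd_conv) blast
      then show False using N by blast
    qed
  qed
qed

lemma continuous_on_coordinates:
  "continuous_on S (\<lambda>w::'a \<Rightarrow> 'b \<Rightarrow> 'c::topological_space. w i a)"
  by (rule continuous_on_product_then_coordinatewise[OF continuous_on_product_then_coordinatewise[OF continuous_on_id]])

lemma join_weights_colour_sum:
  assumes "w \<in> join_weights k q" "0 < q"
  shows "(\<Sum>a\<in>{0..<q}. w i a) \<in> {0..1}"
proof (cases "\<exists>a. w i a \<noteq> 0")
  case True
  then obtain a where a: "w i a \<noteq> 0" by blast
  have c: "coloured k q w" using assms by (simp add: join_weights_def)
  show ?thesis using sum_colour[OF c assms(2) a] join_weights_le_1[OF assms] colouredD(1)[OF c] by simp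
qed simp

text \<open>
  The map \<open>\<Phi>\<close> on the join of copies of \<open>\<int>\<^sub>p\<close> is restricted to integer representatives of
  \<open>\<int>/p\<^sup>N\<close>. The result is equivariant only up to a small error; the product over all
  translates is exactly equivariant, and it keeps the colouring because it vanishes
  wherever one factor does.
\<close>

lemma finite_level_map:
  fixes \<Phi> :: "(nat \<Rightarrow> real) \<Rightarrow> (nat \<Rightarrow> nat \<Rightarrow> int) \<Rightarrow> nat \<Rightarrow> int \<Rightarrow> real"
  assumes p: "p > 0"
    and cont: "\<And>i a. continuous_map (prod_topology (product_topology (\<lambda>_. top_of_set {0..1}) UNIV)
        (product_topology (\<lambda>_. padic_topology p) UNIV)) euclideanreal (\<lambda>(t, g). \<Phi> t g i a)"
    and JW: "\<And>t g. \<lbrakk>\<And>i. t i \<in> {0..1}; \<And>i. g i \<in> padic_carrier p\<rbrakk> \<Longrightarrow> \<Phi> t g \<in> join_weights k (int p ^ n)"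
    and supp: "\<And>t g g'. \<lbrakk>\<And>i. t i \<in> {0..1}; \<And>i. g i \<in> padic_carrier p; \<And>i. g' i \<in> padic_carrier p;
        \<And>i. i \<le> m \<Longrightarrow> t i = 0 \<or> g i = g' i\<rbrakk> \<Longrightarrow> \<Phi> t g = \<Phi> t g'"
    and equi: "\<And>t g h l. \<lbrakk>\<And>i. t i \<in> {0..1}; \<And>i. g i \<in> padic_carrier p; h \<in> padic_carrier p; l \<le> m; 1 \<le> (real m + 1) * t l\<rbrakk>
        \<Longrightarrow> \<Phi> t (\<lambda>i n. (g i n + h n) mod int p ^ n) = shift (h n) (\<Phi> t g)"
  obtains N F where "n \<le> N"
    "\<forall>w\<in>join_weights m (int p ^ N). F w \<in> join_weights k (int p ^ n)"
    "\<forall>w\<in>join_weights m (int p ^ N). \<forall>h. F (shift h w) = shift h (F w)"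
    "\<forall>i a. continuous_map (top_of_set (join_weights m (int p ^ N))) euclideanreal (\<lambda>w. F w i a)"
proof -
  let ?T = "product_topology (\<lambda>_::nat. top_of_set {0..1::real}) UNIV"
  let ?G = "product_topology (\<lambda>_::nat. padic_topology p) UNIV"
  let ?q = "int p ^ n"
  have q: "0 < ?q" using p by simp
  have T: "compact_space ?T"
    by (simp add: compact_space_product_topology compact_space_subtopology compactin_euclidean_iff)
  have tT: "t \<in> topspace ?T \<longleftrightarrow> (\<forall>i. t i \<in> {0..1})" for t by (auto simp: PiE_iff)
  have "\<exists>N. \<forall>t g g'. (\<forall>i. t i \<in> {0..1}) \<and> (\<forall>i. g i \<in> padic_carrier p) \<and> (\<forall>i. g' i \<in> padic_carrier p) \<and> (\<forall>i. g i N = g' i N)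
     \<longrightarrow> \<bar>\<Phi> t g i a - \<Phi> t g' i a\<bar> < 1 / (k + 1)" for i a
  proof -
    \<comment> \<open>The tolerance is the size that at least one weight of every value of
      \<open>\<Phi>\<close> attains, so that such a weight survives the approximation.\<close>
    have pos: "0 < 1 / real (k + 1)" by simp
    show ?thesis by (rule padic_uniform[OF T pos cont[of i a]]) (use tT in meson)
  qed
  then obtain N0 where N0: "\<And>i a t g g'. \<lbrakk>\<And>i. t i \<in> {0..1}; \<And>i. g i \<in> padic_carrier p; \<And>i. g' i \<in> padic_carrier p;
     \<And>l. g l (N0 i a) = g' l (N0 i a)\<rbrakk> \<Longrightarrow> \<bar>\<Phi> t g i a - \<Phi> t g' i a\<bar> < 1 / (k + 1)"
    by metis
  \<comment> \<open>Periodicity in \<open>a\<close> leaves finitely many coordinates to control, and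
    coherence lets the largest of their levels serve for all.\<close>
  define N where "N = Max (insert n ((\<lambda>(i, a). N0 i a) ` ({..k} \<times> {0..<?q})))"
  have N_ge: "n \<le> N" "i \<le> k \<Longrightarrow> a \<in> {0..<?q} \<Longrightarrow> N0 i a \<le> N" for i a
    unfolding N_def by (intro Max_ge; force)+
  let ?q' = "int p ^ N"
  let ?J = "join_weights m ?q'"
  have q': "0 < ?q'" using p by simp
  have dvd: "?q dvd ?q'" by (rule le_imp_power_dvd[OF N_ge(1)])
  have close: "\<bar>\<Phi> t g i a - \<Phi> t g' i a\<bar> < 1 / (k + 1)"
    if t: "\<And>i. t i \<in> {0..1}" and g: "\<And>i. g i \<in> padic_carrier p" and g': "\<And>i. g' i \<in> padic_carrier p"
      and eq: "\<And>i. g i N = g' i N" and i: "i \<le> k" for t g g' i a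
  proof -
    have ar: "a mod ?q \<in> {0..<?q}" using q by simp
    have "g l (N0 i (a mod ?q)) = g' l (N0 i (a mod ?q))" for l
      using padic_coherent[OF g N_ge(2)[OF i ar]] padic_coherent[OF g' N_ge(2)[OF i ar]] eq by metis
    then have "\<bar>\<Phi> t g i (a mod ?q) - \<Phi> t g' i (a mod ?q)\<bar> < 1 / (k + 1)"
      by (intro N0 t g g')
    moreover have "\<Phi> t x i (a mod ?q) = \<Phi> t x i a" if "\<And>i. x i \<in> padic_carrier p" for x
      using JW[of t x, OF t that] unfolding join_weights_def by (intro colouredD(2)[where q = ?q and k = k]) auto
    ultimately show ?thesis using g g' by simp
  qed
  define lift where "lift a = (\<lambda>n. a mod int p ^ n)" for a
  have lift: "lift a \<in> padic_carrier p" for a unfolding lift_def by (rule padic_int_carrier[OF p])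
  \<comment> \<open>\<open>tw w i\<close> is the weight of colour \<open>i\<close> and
    \<open>aw w i\<close> the residue it uses. For a colour of weight \<open>0\<close> that residue
    is arbitrary, and by \<open>supp\<close> it does not influence \<open>\<Phi>w\<close>.\<close>
  define tw where "tw w i = (\<Sum>a\<in>{0..<?q'}. w i a)" for w :: "nat \<Rightarrow> int \<Rightarrow> real" and i
  define aw where "aw w i = (SOME a. w i a \<noteq> 0) mod ?q'" for w :: "nat \<Rightarrow> int \<Rightarrow> real" and i
  define \<Phi>w where "\<Phi>w w = \<Phi> (tw w) (\<lambda>i. lift (aw w i))" for w
  have col: "coloured m ?q' w" if "w \<in> ?J" for w using that by (simp add: join_weights_def)
  have tw: "tw w i \<in> {0..1}" if "w \<in> ?J" for w i
    unfolding tw_def using join_weights_colour_sum[OF that q'] .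
  have aw_range: "aw w i \<in> {0..<?q'}" for w i unfolding aw_def using q' by simp
  have aw: "a mod ?q' = aw w i" if w: "w \<in> ?J" and a: "w i a \<noteq> 0" for w i a
  proof -
    have "w i (SOME a. w i a \<noteq> 0) \<noteq> 0" using a by (rule someI)
    from colouredD(4)[OF col[OF w] a this] show ?thesis by (simp add: aw_def)
  qed
  have tw_aw: "w i (aw w i) \<noteq> 0" if w: "w \<in> ?J" and t: "tw w i \<noteq> 0" for w i
  proof -
    have "\<exists>a\<in>{0..<?q'}. w i a \<noteq> 0" using t unfolding tw_def by (meson sum.neutral)
    then obtain a where a: "w i a \<noteq> 0" by blast
    have "w i (a mod ?q') = w i a" by (rule colouredD(2)[OF col[OF w]]) simp
    then show ?thesis using a aw[OF w a] by simp
  qed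
  have \<Phi>w_JW: "\<Phi>w w \<in> join_weights k ?q" if "w \<in> ?J" for w
    unfolding \<Phi>w_def using tw[OF that] lift by (intro JW)
  define I where "I = PiE {..m} (\<lambda>_. {0..<?q'})"
  \<comment> \<open>The points whose colour \<open>i\<close> uses no residue but
    \<open>\<alpha> i\<close>: finitely many closed simplices covering the join. On each of them the
    group elements are constant, so only the weights vary.\<close>
  define cell where "cell \<alpha> = ?J \<inter> {w. \<forall>i a. i \<le> m \<and> a \<in> {0..<?q'} \<and> a \<noteq> \<alpha> i \<longrightarrow> w i a = 0}" for \<alpha> :: "nat \<Rightarrow> int"
  have \<Phi>w_cell: "\<Phi>w w = \<Phi> (tw w) (\<lambda>i. lift (\<alpha> i))" if "w \<in> cell \<alpha>" for w \<alpha>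
    unfolding \<Phi>w_def
  proof (rule supp)
    have w: "w \<in> ?J" using that by (simp add: cell_def)
    show "tw w i \<in> {0..1}" for i by (rule tw[OF w])
    fix i assume i: "i \<le> m"
    show "tw w i = 0 \<or> lift (aw w i) = lift (\<alpha> i)"
    proof (cases "tw w i = 0")
      case False
      then have "aw w i = \<alpha> i" using tw_aw[OF w False] aw_range[of w i] that i unfolding cell_def by blast
      then show ?thesis by simp
    qed simp
  qed (rule lift)+
  have \<Phi>w_cont: "continuous_map (top_of_set ?J) euclideanreal (\<lambda>w. \<Phi>w w j b)" for j b
  proof (rule pasting_lemma_closed[where I = I and T = cell and f = "\<lambda>\<alpha> w. \<Phi> (tw w) (\<lambda>i. lift (\<alpha> i)) j b"])
    show "finite I" unfolding I_def by (intro finite_PiE) auto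
    show "closedin (top_of_set ?J) (cell \<alpha>)" for \<alpha>
      unfolding cell_def
      by (intro closedin_closed_Int closed_Collect_all closed_Collect_imp closed_Collect_eq
        continuous_on_coordinates continuous_on_const) simp
    show "continuous_map (subtopology (top_of_set ?J) (cell \<alpha>)) euclideanreal (\<lambda>w. \<Phi> (tw w) (\<lambda>i. lift (\<alpha> i)) j b)" for \<alpha>
    proof (rule continuous_map_compose2[OF cont])
      have "continuous_map (top_of_set ?J) euclideanreal (\<lambda>w. tw w i)" for i
        unfolding tw_def by (auto intro!: continuous_intros continuous_on_coordinates)
      then have "continuous_map (top_of_set ?J) (top_of_set {0..1}) (\<lambda>w. tw w i)" for i
        unfolding continuous_map_in_subtopology
      proof
        show "(\<lambda>w. tw w i) \<in> topspace (top_of_set ?J) \<rightarrow> {0..1}" using tw by (intro Pi_I) simp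
      qed
      then have "continuous_map (subtopology (top_of_set ?J) (cell \<alpha>)) (top_of_set {0..1}) (\<lambda>w. tw w i)" for i
        by (rule continuous_map_from_subtopology)
      then show "continuous_map (subtopology (top_of_set ?J) (cell \<alpha>)) ?T tw"
        by (simp add: continuous_map_componentwise_UNIV)
      show "continuous_map (subtopology (top_of_set ?J) (cell \<alpha>)) ?G (\<lambda>w i. lift (\<alpha> i))"
        unfolding continuous_map_componentwise_UNIV using lift by (simp add: topspace_padic_topology)
    qed
    show "\<Phi> (tw w) (\<lambda>i. lift (\<alpha> i)) j b = \<Phi> (tw w) (\<lambda>i. lift (\<beta> i)) j b"
      if "w \<in> topspace (top_of_set ?J) \<inter> cell \<alpha> \<inter> cell \<beta>" for \<alpha> \<beta> w
      using \<Phi>w_cell[of w \<alpha>] \<Phi>w_cell[of w \<beta>] that by simp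
    fix w assume "w \<in> topspace (top_of_set ?J)"
    then have w: "w \<in> ?J" by simp
    define \<alpha> where "\<alpha> = restrict (aw w) {..m}"
    have "\<alpha> \<in> I" unfolding I_def \<alpha>_def using aw_range by auto
    moreover have "w \<in> cell \<alpha>"
      using w aw[OF w] unfolding cell_def \<alpha>_def by force
    ultimately show "\<exists>\<alpha>. \<alpha> \<in> I \<and> w \<in> cell \<alpha> \<and> \<Phi>w w j b = \<Phi> (tw w) (\<lambda>i. lift (\<alpha> i)) j b"
      using \<Phi>w_cell[of w \<alpha>] by metis
  qed
  \<comment> \<open>The index \<open>b + h\<close> undoes the translation of \<open>w\<close> by
    \<open>h\<close>, so where \<open>\<Phi>\<close> is equivariant all factors are close to
    \<open>\<Phi>w w j b\<close>.\<close>
  define F0 where "F0 w j b = (\<Prod>h\<in>{0..<?q'}. \<Phi>w (shift h w) j (b + h))" for w j b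
  have sJ: "shift h w \<in> ?J" if "w \<in> ?J" for h w by (rule shift_join_weights[OF that q'])
  have cw: "coloured k ?q (\<Phi>w w)" if "w \<in> ?J" for w using \<Phi>w_JW[OF that] by (simp add: join_weights_def)
  have F0_zero: "\<Phi>w w j b \<noteq> 0" if "F0 w j b \<noteq> 0" for w j b
  proof -
    have "(0::int) \<in> {0..<?q'}" using q' by simp
    then have "\<Phi>w (shift 0 w) j (b + 0) \<noteq> 0" using that unfolding F0_def by (meson prod_zero finite_atLeastLessThan_int)
    moreover have "shift 0 w = w" by (simp add: shift_def)
    ultimately show ?thesis by simp
  qed
  have F0_col: "coloured k ?q (F0 w)" if w: "w \<in> ?J" for w
  proof (rule colouredI)
    fix i and a b :: int
    show "0 \<le> F0 w i a" unfolding F0_def by (intro prod_nonneg colouredD(1)[OF cw[OF sJ[OF w]]])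
    show "F0 w i a = F0 w i b" if "a mod ?q = b mod ?q"
      unfolding F0_def using that
      by (intro prod.cong refl colouredD(2)[OF cw[OF sJ[OF w]]] mod_add_cong)
    show "F0 w i a = 0" if "k < i" using colouredD(3)[OF cw[OF w] that] F0_zero by blast
    show "a mod ?q = b mod ?q" if "F0 w i a \<noteq> 0" "F0 w i b \<noteq> 0"
      using colouredD(4)[OF cw[OF w]] that F0_zero by blast
  qed
  \<comment> \<open>Some source weight is at least \<open>1 / (m + 1)\<close>, which makes
    \<open>\<Phi>\<close> equivariant at this point. Some value of \<open>\<Phi>w w\<close> is at
    least \<open>1 / (k + 1)\<close>, while every factor differs from it by strictly less; so no
    factor vanishes.\<close>
  have F0_pos: "\<exists>j b. F0 w j b \<noteq> 0" if w: "w \<in> ?J" for w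
  proof -
    obtain j b where jb: "j \<le> k" "1 / (k + 1) \<le> \<Phi>w w j b"
      by (rule join_weights_large[OF \<Phi>w_JW[OF w] q])
    obtain l a where la: "l \<le> m" "1 / (m + 1) \<le> w l a"
      by (rule join_weights_large[OF w q'])
    have "0 < 1 / real (m + 1)" by simp
    then have wla: "w l a \<noteq> 0" using la(2) by linarith
    have tl: "1 \<le> (real m + 1) * tw w l"
      using la(2) unfolding tw_def sum_colour[OF col[OF w] q' wla] by (simp add: field_simps)
    have "\<Phi>w (shift h w) j (b + h) \<noteq> 0" if h: "h \<in> {0..<?q'}" for h
    proof -
      have tws: "tw (shift h w) = tw w"
      proof
        fix i
        have "(\<Sum>a\<in>{0..<?q'}. w i (a - h)) = (\<Sum>a\<in>{0..<?q'}. w i ((a + - h) mod ?q'))"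
          by (intro sum.cong refl colouredD(2)[OF col[OF w]]) (simp add: mod_simps)
        also have "\<dots> = (\<Sum>a\<in>{0..<?q'}. w i a)"
          by (rule sum.reindex_bij_betw[OF bij_betw_translate_mod[OF q']])
        finally show "tw (shift h w) i = tw w i" by (simp add: tw_def shift_def)
      qed
      let ?g = "\<lambda>i. lift (aw w i)"
      let ?gh = "\<lambda>i n. (lift (aw w i) n + lift h n) mod int p ^ n"
      \<comment> \<open>The lift of a residue sum and the sum of the lifts agree modulo
        \<open>p^N\<close>, but a carry may separate them beyond that level; this is the only error.
        Colours of weight \<open>0\<close>, whose residue is arbitrary, are simply given the
        sum.\<close>
      let ?g1 = "\<lambda>i. if tw w i = 0 then ?gh i else lift (aw (shift h w) i)"
      have gh: "?gh i \<in> padic_carrier p" for i by (rule padic_add_carrier[OF p lift lift])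
      have g1: "?g1 i \<in> padic_carrier p" for i using gh[of i] lift by simp
      have g1N: "?g1 i N = ?gh i N" for i
      proof (cases "tw w i = 0")
        case False
        have "w i (aw w i) \<noteq> 0" by (rule tw_aw[OF w False])
        then have "shift h w i (aw w i + h) \<noteq> 0" by (simp add: shift_def)
        from aw[OF sJ[OF w] this] have "aw (shift h w) i = (aw w i + h) mod ?q'" by simp
        then show ?thesis using False by (simp add: lift_def mod_simps)
      qed simp
      have "\<Phi>w (shift h w) = \<Phi> (tw w) ?g1"
        unfolding \<Phi>w_def tws by (rule supp) (use tw[OF w] g1 lift in auto)
      moreover have "\<bar>\<Phi> (tw w) ?g1 j (b + h) - \<Phi> (tw w) ?gh j (b + h)\<bar> < 1 / (k + 1)"
        by (rule close[OF tw[OF w] g1 gh g1N jb(1)])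
      moreover have "\<Phi> (tw w) ?gh = shift (lift h n) (\<Phi>w w)"
        unfolding \<Phi>w_def by (rule equi[of "tw w" ?g "lift h" l, OF tw[OF w] lift lift la(1) tl])
      moreover have "shift (lift h n) (\<Phi>w w) j (b + h) = \<Phi>w w j b"
        unfolding shift_def lift_def by (rule colouredD(2)[OF cw[OF w]]) (simp add: mod_simps)
      ultimately show ?thesis using jb(2) by auto
    qed
    then have "F0 w j b \<noteq> 0" unfolding F0_def by (subst prod_zero_iff) auto
    then show ?thesis by blast
  qed
  have F0_equi: "F0 (shift s w) = shift s (F0 w)" if w: "w \<in> ?J" for s w
  proof (intro ext)
    fix j b
    \<comment> \<open>As a function of \<open>h\<close> this factor has period \<open>p^N\<close>,
      because \<open>p^n\<close> divides \<open>p^N\<close>. Translating \<open>w\<close> therefore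
      only permutes the factors of the product.\<close>
    let ?f = "\<lambda>h. \<Phi>w (shift h w) j (b - s + h)"
    have "?f h = ?f (h mod ?q')" for h
    proof -
      have "shift h w = shift (h mod ?q') w"
        unfolding shift_def by (intro ext colouredD(2)[OF col[OF w]]) (simp add: mod_simps)
      moreover have "\<Phi>w (shift (h mod ?q') w) j (b - s + h) = \<Phi>w (shift (h mod ?q') w) j (b - s + h mod ?q')"
      proof (rule colouredD(2)[OF cw[OF sJ[OF w]]])
        have "(b - s + h mod ?q') mod ?q = (b - s + h mod ?q' mod ?q) mod ?q" by (simp add: mod_simps)
        also have "h mod ?q' mod ?q = h mod ?q" by (rule mod_mod_cancel[OF dvd])
        finally show "(b - s + h) mod ?q = (b - s + h mod ?q') mod ?q" by (simp add: mod_simps)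
      qed
      ultimately show ?thesis by simp
    qed
    then have "(\<Prod>h\<in>{0..<?q'}. ?f (h + s)) = (\<Prod>h\<in>{0..<?q'}. ?f ((h + s) mod ?q'))"
      by (intro prod.cong refl)
    also have "\<dots> = (\<Prod>h\<in>{0..<?q'}. ?f h)"
      by (rule prod.reindex_bij_betw[OF bij_betw_translate_mod[OF q']])
    finally have "(\<Prod>h\<in>{0..<?q'}. ?f (h + s)) = shift s (F0 w) j b"
      by (simp add: F0_def shift_def)
    moreover have "\<Phi>w (shift h (shift s w)) j (b + h) = ?f (h + s)" for h
      by (simp add: shift_def algebra_simps)
    ultimately show "F0 (shift s w) j b = shift s (F0 w) j b" by (simp add: F0_def)
  qed
  have F0_cont: "continuous_map (top_of_set ?J) euclideanreal (\<lambda>w. F0 w j b)" for j b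
    unfolding F0_def
  proof (rule continuous_map_prod)
    fix h
    have "continuous_on ?J (shift h)"
      unfolding shift_def by (intro continuous_on_coordinatewise_then_product continuous_on_coordinates)
    then have "continuous_map (top_of_set ?J) (top_of_set ?J) (shift h)"
      using sJ by (auto simp: continuous_map_in_subtopology)
    from continuous_map_compose[OF this \<Phi>w_cont[of j "b + h"]]
    show "continuous_map (top_of_set ?J) euclideanreal (\<lambda>w. \<Phi>w (shift h w) j (b + h))" by (simp add: o_def)
  qed simp
  show thesis
  proof (rule that[of N "\<lambda>w i a. F0 w i a / total k ?q (F0 w)"]; (intro allI ballI)?)
    show "n \<le> N" by (rule N_ge)
    show "(\<lambda>i a. F0 w i a / total k ?q (F0 w)) \<in> join_weights k ?q" if w: "w \<in> ?J" for w
      using normalise_join_weights[OF F0_col[OF w] q] F0_pos[OF w] by blast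
    show "(\<lambda>i a. F0 (shift h w) i a / total k ?q (F0 (shift h w))) = shift h (\<lambda>i a. F0 w i a / total k ?q (F0 w))"
      if w: "w \<in> ?J" for w h
      unfolding F0_equi[OF w] total_shift[OF F0_col[OF w] q] by (simp add: shift_def)
    show "continuous_map (top_of_set ?J) euclideanreal (\<lambda>w. F0 w i a / total k ?q (F0 w))" for i a
    proof (rule continuous_map_real_divide[OF F0_cont])
      show "continuous_map (top_of_set ?J) euclideanreal (\<lambda>w. total k ?q (F0 w))"
        unfolding total_def by (intro continuous_map_sum F0_cont) auto
      fix w assume "w \<in> topspace (top_of_set ?J)"
      then have w: "w \<in> ?J" by simp
      show "total k ?q (F0 w) \<noteq> 0"
        using total_pos[OF F0_col[OF w] q] F0_pos[OF w] by (metis less_irrefl)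
    qed
  qed
qed

section \<open>Orbit spaces and equivariant maps to joins of finite cyclic groups\<close>

text \<open>Merges residues modulo \<open>Q * q\<close> in blocks of length \<open>Q\<close>, so
  \<open>b\<close> goes to \<open>b div Q\<close>. This is no group homomorphism, but it turns
  translation by \<open>Q * h\<close> into translation by \<open>h\<close>, as is needed when only
  the subgroup of multiples of \<open>p^j\<close> acts.\<close>

definition coarsen :: "int \<Rightarrow> (nat \<Rightarrow> int \<Rightarrow> real) \<Rightarrow> nat \<Rightarrow> int \<Rightarrow> real" where
  "coarsen Q w = (\<lambda>i a. \<Sum>r\<in>{0..<Q}. w i (Q * a + r))"

lemma coarsen_shift: "coarsen Q (shift (Q * h) w) = shift h (coarsen Q w)"
  by (simp add: coarsen_def shift_def algebra_simps)

lemma coarsen_join_weights: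
  assumes w: "w \<in> join_weights k (Q * q)" and Q: "0 < Q" and q: "0 < q"
  shows "coarsen Q w \<in> join_weights k q"
proof -
  have c: "coloured k (Q * q) w" and tot: "total k (Q * q) w = 1" using w by (auto simp: join_weights_def)
  have "coloured k q (coarsen Q w)"
  proof (rule colouredI)
    fix i and a b :: int
    show "0 \<le> coarsen Q w i a" unfolding coarsen_def by (intro sum_nonneg colouredD(1)[OF c])
    show "coarsen Q w i a = 0" if "k < i" unfolding coarsen_def using colouredD(3)[OF c that] by simp
    show "coarsen Q w i a = coarsen Q w i b" if ab: "a mod q = b mod q"
    proof -
      have "(Q * a) mod (Q * q) = (Q * b) mod (Q * q)" using ab by (simp add: mult_mod_right[symmetric])
      then have "w i (Q * a + r) = w i (Q * b + r)" for r
        by (intro colouredD(2)[OF c] mod_add_cong) auto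
      then show ?thesis by (simp add: coarsen_def)
    qed
    assume "coarsen Q w i a \<noteq> 0" "coarsen Q w i b \<noteq> 0"
    then have "\<exists>r\<in>{0..<Q}. w i (Q * a + r) \<noteq> 0" "\<exists>r\<in>{0..<Q}. w i (Q * b + r) \<noteq> 0"
      unfolding coarsen_def by (meson sum.neutral)+
    then obtain r s where rs: "r \<in> {0..<Q}" "s \<in> {0..<Q}" "w i (Q * a + r) \<noteq> 0" "w i (Q * b + s) \<noteq> 0"
      by blast
    \<comment> \<open>Reduction modulo \<open>Q\<close> forces the offsets \<open>r\<close> and
      \<open>s\<close> to agree; what remains can be divided by \<open>Q\<close>.\<close>
    have eq: "(Q * a + r) mod (Q * q) = (Q * b + s) mod (Q * q)" by (rule colouredD(4)[OF c rs(3,4)])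
    then have "(Q * a + r) mod (Q * q) mod Q = (Q * b + s) mod (Q * q) mod Q" by simp
    then have "(Q * a + r) mod Q = (Q * b + s) mod Q" by (simp add: mod_mod_cancel)
    then have "r = s" using rs by simp
    then have "Q * q dvd Q * a - Q * b" using eq by (simp add: mod_eq_dvd_iff)
    then have "q dvd a - b" using Q by (simp add: right_diff_distrib[symmetric])
    then show "a mod q = b mod q" by (simp add: mod_eq_dvd_iff)
  qed
  moreover have "total k q (coarsen Q w) = 1"
  proof -
    have bij: "bij_betw (\<lambda>(a, r). Q * a + r) ({0..<q} \<times> {0..<Q}) {0..<Q * q}"
    proof (rule bij_betw_byWitness[where f' = "\<lambda>b. (b div Q, b mod Q)"])
      show "\<forall>z\<in>{0..<q} \<times> {0..<Q}. (\<lambda>b. (b div Q, b mod Q)) ((\<lambda>(a, r). Q * a + r) z) = z"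
        using Q by auto
      show "\<forall>b\<in>{0..<Q * q}. (\<lambda>(a, r). Q * a + r) ((\<lambda>b. (b div Q, b mod Q)) b) = b" by simp
      have "Q * a + r < Q * q" if "a < q" "r < Q" for a r
      proof -
        have "Q * a + r < Q * a + Q" using that by simp
        also have "\<dots> = Q * (a + 1)" by (simp add: algebra_simps)
        also have "\<dots> \<le> Q * q" using that Q by (intro mult_left_mono) auto
        finally show ?thesis .
      qed
      then show "(\<lambda>(a, r). Q * a + r) ` ({0..<q} \<times> {0..<Q}) \<subseteq> {0..<Q * q}" using Q by auto
      have "b div Q < q" if "b < Q * q" for b
      proof (rule ccontr)
        assume "\<not> b div Q < q"
        then have "Q * q \<le> Q * (b div Q)" using Q by (intro mult_left_mono) auto
        also have "\<dots> \<le> b" using mult_div_mod_eq[of Q b] pos_mod_sign[OF Q, of b] by linarith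
        finally show False using that by simp
      qed
      then show "(\<lambda>b. (b div Q, b mod Q)) ` {0..<Q * q} \<subseteq> {0..<q} \<times> {0..<Q}"
        using Q by (auto simp: pos_imp_zdiv_nonneg_iff)
    qed
    have "(\<Sum>a\<in>{0..<q}. coarsen Q w i a) = (\<Sum>b\<in>{0..<Q * q}. w i b)" for i
    proof -
      have "(\<Sum>a\<in>{0..<q}. coarsen Q w i a) = (\<Sum>z\<in>{0..<q} \<times> {0..<Q}. w i (case z of (a, r) \<Rightarrow> Q * a + r))"
        unfolding coarsen_def by (simp add: sum.cartesian_product case_prod_unfold)
      also have "\<dots> = (\<Sum>b\<in>{0..<Q * q}. w i b)" by (rule sum.reindex_bij_betw[OF bij])
      finally show ?thesis .
    qed
    then show ?thesis using tot by (simp add: total_def)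
  qed
  ultimately show ?thesis by (simp add: join_weights_def)
qed

text \<open>Dimension is known for the orbit space of all of \<open>M\<close>, while the cover lives
  on \<open>K\<close>. Adding the complement of the closed invariant set \<open>K\<close> makes each
  member open and saturated in \<open>M\<close>; the refinement found downstairs is pulled back and
  cut down to \<open>K\<close>.\<close>

lemma orbit_cover_refinement:
  assumes sp: "padic_space p M act" and dim: "covering_dim_le (orbit_space (padic_group p) M act) k"
    and K: "closedin M K" "K \<noteq> {}" and Kinv: "\<And>x g. x \<in> K \<Longrightarrow> g \<in> padic_carrier p \<Longrightarrow> act x g \<in> K"
    and U: "finite \<U>" "\<And>U. U \<in> \<U> \<Longrightarrow> openin (subtopology M K) U"
      "\<And>U x g. U \<in> \<U> \<Longrightarrow> x \<in> U \<Longrightarrow> g \<in> padic_carrier p \<Longrightarrow> act x g \<in> U" "\<Union>\<U> = K"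
  shows "\<exists>\<V>. finite \<V> \<and> (\<forall>V\<in>\<V>. openin (subtopology M K) V) \<and> (\<forall>V\<in>\<V>. \<forall>x\<in>V. \<forall>g\<in>padic_carrier p. act x g \<in> V) \<and>
        \<Union>\<V> = K \<and> (\<forall>V\<in>\<V>. \<exists>U\<in>\<U>. V \<subseteq> U) \<and> (\<forall>x\<in>K. card {V \<in> \<V>. x \<in> V} \<le> k + 1)"
proof -
  interpret padic_space p M act by (rule sp)
  let ?r = "orbit_rel (padic_group p) M act"
  let ?O = "orbit_space (padic_group p) M act"
  have eq: "equiv (topspace M) ?r" by (rule equiv_orbit_rel[OF topological_group_padic[OF p] action])
  have openO: "openin ?O \<W> \<longleftrightarrow> \<W> \<subseteq> topspace M // ?r \<and> openin M (\<Union>\<W>)" for \<W>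
    unfolding orbit_space_def by (rule openin_quotient_topology[OF eq])
  have topO: "topspace ?O = topspace M // ?r"
    unfolding orbit_space_def by (rule topspace_quotient_topology[OF eq])
  have KM: "K \<subseteq> topspace M" using K(1) closedin_subset by blast
  have rel: "(x, y) \<in> ?r \<longleftrightarrow> x \<in> topspace M \<and> (\<exists>g\<in>padic_carrier p. y = act x g)" for x y
    by (simp add: orbit_rel_def)
  define hat where "hat U = U \<union> (topspace M - K)" for U
  define \<pi> where "\<pi> A = (\<lambda>x. ?r `` {x}) ` A" for A
  have UK: "U \<subseteq> K" if "U \<in> \<U>" for U using U(4) that by blast
  have hat_open: "openin M (hat U)" if "U \<in> \<U>" for U
  proof -
    have "closedin (subtopology M K) (topspace (subtopology M K) - U)" using U(2)[OF that] by blast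
    then have "closedin M (K - U)"
      using K(1) closedin_trans_full KM by (metis inf.absorb_iff2 topspace_subtopology)
    then have "openin M (topspace M - (K - U))" by blast
    moreover have "topspace M - (K - U) = hat U" unfolding hat_def using UK[OF that] KM by blast
    ultimately show ?thesis by simp
  qed
  have hat_inv: "act x g \<in> hat U" if "U \<in> \<U>" "x \<in> hat U" "g \<in> padic_carrier p" for U x g
  proof (cases "x \<in> U")
    case True
    then show ?thesis using U(3) that unfolding hat_def by blast
  next
    case False
    then have x: "x \<in> topspace M - K" using that unfolding hat_def by blast
    have "act x g \<notin> K"
    proof
      assume "act x g \<in> K"
      from Kinv[OF this padic_neg_carrier[OF p that(3)]] x that(3) show False by (simp add: act_inverse)
    qed
    then show ?thesis using x that act_closed unfolding hat_def by blast
  qed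
  have hat_sub: "hat U \<subseteq> topspace M" if "U \<in> \<U>" for U using hat_open[OF that] openin_subset by blast
  have Union_\<pi>: "\<Union>(\<pi> (hat U)) = hat U" if UU: "U \<in> \<U>" for U
  proof
    show "\<Union>(\<pi> (hat U)) \<subseteq> hat U"
    proof
      fix y assume "y \<in> \<Union>(\<pi> (hat U))"
      then obtain x where x: "x \<in> hat U" "(x, y) \<in> ?r" unfolding \<pi>_def by blast
      then show "y \<in> hat U" unfolding rel using hat_inv[OF UU x(1)] by blast
    qed
    show "hat U \<subseteq> \<Union>(\<pi> (hat U))"
    proof
      fix x assume x: "x \<in> hat U"
      then have "x \<in> ?r `` {x}" using hat_sub[OF UU] by (intro equiv_class_self[OF eq]) blast
      then show "x \<in> \<Union>(\<pi> (hat U))" unfolding \<pi>_def using x by blast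
    qed
  qed
  have "\<exists>\<V>. finite \<V> \<and> (\<forall>V\<in>\<V>. openin ?O V) \<and> \<Union>\<V> = topspace ?O \<and>
     (\<forall>V\<in>\<V>. \<exists>W\<in>\<pi> ` hat ` \<U>. V \<subseteq> W) \<and> (\<forall>C\<in>topspace ?O. card {V \<in> \<V>. C \<in> V} \<le> k + 1)"
  proof (rule dim[unfolded covering_dim_le_def, rule_format], intro conjI ballI)
    show "finite (\<pi> ` hat ` \<U>)" using U(1) by simp
    fix W assume "W \<in> \<pi> ` hat ` \<U>"
    then obtain U where UU: "U \<in> \<U>" "W = \<pi> (hat U)" by blast
    have "\<pi> (hat U) \<subseteq> topspace M // ?r" unfolding \<pi>_def using hat_sub[OF UU(1)] by (auto intro: quotientI)
    then show "openin ?O W" unfolding openO UU(2) Union_\<pi>[OF UU(1)] using hat_open[OF UU(1)] by blast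
  next
    \<comment> \<open>As \<open>K\<close> is nonempty there is at least one \<open>U\<close>, and
      its enlargement already contains the complement of \<open>K\<close>.\<close>
    have cov: "topspace M \<subseteq> \<Union>(hat ` \<U>)" using U(4) K(2) unfolding hat_def by blast
    show "\<Union>(\<pi> ` hat ` \<U>) = topspace ?O"
    proof
      show "\<Union>(\<pi> ` hat ` \<U>) \<subseteq> topspace ?O" unfolding topO \<pi>_def using hat_sub by (auto intro!: quotientI)
      show "topspace ?O \<subseteq> \<Union>(\<pi> ` hat ` \<U>)" unfolding topO \<pi>_def quotient_def using cov by blast
    qed
  qed
  then obtain \<V> where V0: "finite \<V>" "\<forall>V\<in>\<V>. openin ?O V" "\<Union>\<V> = topspace ?O"
     "\<forall>V\<in>\<V>. \<exists>W\<in>\<pi> ` hat ` \<U>. V \<subseteq> W" "\<forall>C\<in>topspace ?O. card {V \<in> \<V>. C \<in> V} \<le> k + 1"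
    by (elim exE conjE) (rule that; assumption)
  note V = V0(1) V0(2)[rule_format] V0(3) V0(4)[rule_format] V0(5)[rule_format]
  define res where "res V = K \<inter> \<Union>V" for V :: "'a set set"
  have class_in: "?r `` {x} \<in> V" if *: "V \<in> \<V>" "x \<in> \<Union>V" for V x
  proof -
    obtain C where C: "C \<in> V" "x \<in> C" using *(2) by blast
    then have "C \<in> topspace M // ?r" using V(2)[OF *(1)] unfolding openO by blast
    then obtain y where y: "C = ?r `` {y}" by (meson quotientE)
    then have "(y, x) \<in> ?r" using C by blast
    then have "?r `` {x} = C" using equiv_class_eq[OF eq] y by metis
    then show ?thesis using C by simp
  qed
  show ?thesis
  proof (intro exI[of _ "res ` \<V>"] conjI ballI)
    show "finite (res ` \<V>)" using V(1) by simp
    show "openin (subtopology M K) W" if "W \<in> res ` \<V>" for W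
      using that V(2) unfolding res_def openO openin_subtopology by blast
    show "act x g \<in> W" if *: "W \<in> res ` \<V>" "x \<in> W" "g \<in> padic_carrier p" for W x g
    proof -
      obtain V' where V': "V' \<in> \<V>" "W = K \<inter> \<Union>V'" using *(1) unfolding res_def by blast
      then have x: "x \<in> K" "x \<in> \<Union>V'" using *(2) by auto
      have "(x, act x g) \<in> ?r" unfolding rel using x(1) KM *(3) by blast
      then have "act x g \<in> \<Union>V'" using class_in[OF V'(1) x(2)] by blast
      then show ?thesis using V'(2) Kinv[OF x(1) *(3)] by blast
    qed
    show "\<Union>(res ` \<V>) = K"
    proof
      show "\<Union>(res ` \<V>) \<subseteq> K" unfolding res_def by blast
      have "\<Union>(\<Union>\<V>) = topspace M" unfolding V(3) topO by (rule Union_quotient[OF eq])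
      then have cov: "x \<in> \<Union>(\<Union>\<V>)" if "x \<in> K" for x using KM that by auto
      show "K \<subseteq> \<Union>(res ` \<V>)"
      proof
        fix x assume x: "x \<in> K"
        then obtain V' where "V' \<in> \<V>" "x \<in> \<Union>V'" using cov[OF x] by blast
        then show "x \<in> \<Union>(res ` \<V>)" using x unfolding res_def by blast
      qed
    qed
    show "\<exists>U\<in>\<U>. W \<subseteq> U" if W: "W \<in> res ` \<V>" for W
    proof -
      obtain V' where V': "V' \<in> \<V>" "W = K \<inter> \<Union>V'" using W unfolding res_def by blast
      obtain U where UU: "U \<in> \<U>" "V' \<subseteq> \<pi> (hat U)" using V(4)[OF V'(1)] by (elim bexE imageE) simp
      have "\<Union>V' \<subseteq> \<Union>(\<pi> (hat U))" using UU(2) by (rule Union_mono)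
      then have "\<Union>V' \<subseteq> hat U" unfolding Union_\<pi>[OF UU(1)] .
      then show ?thesis using UU(1) V'(2) unfolding hat_def by blast
    qed
    fix x assume x: "x \<in> K"
    have cl: "?r `` {x} \<in> topspace ?O" unfolding topO using x KM by (auto intro: quotientI)
    have "{W \<in> res ` \<V>. x \<in> W} \<subseteq> res ` {V \<in> \<V>. ?r `` {x} \<in> V}"
    proof
      fix W assume "W \<in> {W \<in> res ` \<V>. x \<in> W}"
      then obtain V' where V': "V' \<in> \<V>" "W = res V'" "x \<in> W" by blast
      then have "x \<in> \<Union>V'" unfolding res_def by blast
      then show "W \<in> res ` {V \<in> \<V>. ?r `` {x} \<in> V}" using class_in[OF V'(1)] V'(1,2) by blast
    qed
    then have "card {W \<in> res ` \<V>. x \<in> W} \<le> card (res ` {V \<in> \<V>. ?r `` {x} \<in> V})"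
      using V(1) by (intro card_mono) auto
    \<comment> \<open>Different members may restrict to the same subset of \<open>K\<close>, which
      only lowers the count.\<close>
    also have "\<dots> \<le> card {V \<in> \<V>. ?r `` {x} \<in> V}" using V(1) by (intro card_image_le) auto
    also have "\<dots> \<le> k + 1" by (rule V(5)[OF cl])
    finally show "card {W \<in> res ` \<V>. x \<in> W} \<le> k + 1" .
  qed
qed

text \<open>This uses up the geometry of \<open>M\<close>; only maps between joins of finite cyclic
  groups remain. The first conjunct is what makes the product over all levels nonempty.\<close>

lemma finite_dimensional_orbit_space_imp_join_maps:
  assumes M: "topological_manifold d M" "topspace M \<noteq> {}" and sp: "padic_space p M act"
    and dim: "covering_dim_le (orbit_space (padic_group p) M act) k"
  shows "join_weights k (int p ^ n) \<noteq> {} \<and>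
    (\<exists>N F. n \<le> N \<and> (\<forall>w\<in>join_weights (Suc k) (int p ^ N). F w \<in> join_weights k (int p ^ n)) \<and>
      (\<forall>w\<in>join_weights (Suc k) (int p ^ N). \<forall>h. F (shift h w) = shift h (F w)) \<and>
      (\<forall>i a. continuous_map (top_of_set (join_weights (Suc k) (int p ^ N))) euclideanreal (\<lambda>w. F w i a)))"
proof -
  interpret padic_space p M act by (rule sp)
  \<comment> \<open>The source gets one colour more than the target; this surplus later takes in the
    extra join factor.\<close>
  define m where "m = Suc k"
  let ?l = "2 * (m + 1)"
  obtain x0 where x0: "x0 \<in> topspace M" using M(2) by blast
  obtain D U c where D0: "x0 \<in> D (0::nat)" "\<forall>i\<le>?l. compactin M (D i)"
    "\<forall>i<?l. openin M (U i) \<and> D i \<subseteq> U i \<and> U i \<subseteq> D (Suc i)"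
    "continuous_map (prod_topology (subtopology M (D ?l)) (top_of_set {0..1::real})) M (\<lambda>(x, s). c x s)"
    "\<forall>i\<le>?l. \<forall>x\<in>D i. \<forall>s\<in>{0..1}. c x s \<in> D i"
    "\<forall>x\<in>D ?l. c x 0 = x \<and> c x 1 = x0" "\<forall>i j. i \<le> j \<longrightarrow> D i \<subseteq> D j"
    by (rule manifold_contractible_neighbourhoods[OF M(1) x0, where l = ?l])
  note D = D0(1) D0(2)[rule_format] D0(3)[rule_format] D0(4) D0(5)[rule_format]
    D0(6)[rule_format, THEN conjunct1] D0(6)[rule_format, THEN conjunct2] D0(7)[rule_format]
  have "compactin M (D i)" if "i < ?l" for i using D(2) that by simp
  then obtain j where j: "\<forall>i<?l. \<forall>x\<in>D i. \<forall>g\<in>padic_carrier p. g j = 0 \<longrightarrow> act x g \<in> D (Suc i)"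
    by (rule small_subgroup_chain[where l = ?l and D = D and U = U, OF _ D(3)])
  define mult where "mult g = (\<lambda>n. (int p ^ j * g n) mod int p ^ n)" for g
  define act' where "act' x g = act x (mult g)" for x g
  have mult: "mult g \<in> padic_carrier p" if "g \<in> padic_carrier p" for g
    unfolding mult_def by (rule padic_multiple[OF that])
  have sp': "padic_space p M act'" unfolding act'_def mult_def by (rule padic_space_multiple)
  have "padic_contraction_axioms p M act' m x0 D c"
  proof
    show "D i \<subseteq> topspace M" if "i \<le> ?l" for i using D(2)[OF that] compactin_subset_topspace by blast
    show "act' x g \<in> D (Suc i)" if "i < ?l" "x \<in> D i" "g \<in> padic_carrier p" for i x g
      unfolding act'_def by (rule j[rule_format, OF that(1,2) mult[OF that(3)]]) (simp add: mult_def)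
  qed (fact D)+
  then interpret C: padic_contraction p M act' m x0 D c
    using sp' by (simp add: padic_contraction_def)
  \<comment> \<open>The saturation of the largest box under the whole group, not only under the
    small subgroup: the orbit space whose dimension is known belongs to the full action.\<close>
  define K where "K = (\<lambda>(x, g). act x g) ` (D ?l \<times> padic_carrier p)"
  have DM: "D ?l \<subseteq> topspace M" using D(2)[of ?l] compactin_subset_topspace by blast
  have DK: "D ?l \<subseteq> K"
  proof
    fix x assume x: "x \<in> D ?l"
    then have "act x (\<lambda>n. 0) = x" using act_zero DM by blast
    moreover have "(x, \<lambda>n. 0) \<in> D ?l \<times> padic_carrier p" using x padic_zero_carrier[OF p] by simp
    ultimately show "x \<in> K" unfolding K_def by (metis (no_types, lifting) case_prod_conv image_eqI)
  qed
  have Kne: "K \<noteq> {}" using DK D(1) D(8)[of 0 ?l] by auto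
  have "compactin (prod_topology M (padic_topology p)) (D ?l \<times> padic_carrier p)"
    using D(2)[of ?l] compact_space_padic[of p]
    by (auto simp: compactin_Times compact_space_def topspace_padic_topology)
  moreover have "continuous_map (prod_topology M (padic_topology p)) M (\<lambda>(x, g). act x g)"
    using action by (simp add: continuous_action_def)
  ultimately have Kcomp: "compactin M K" unfolding K_def by (rule image_compactin)
  have H: "Hausdorff_space M"
    using M(1) metrizable_imp_Hausdorff_space unfolding topological_manifold_def by blast
  have Kclosed: "closedin M K" by (rule compactin_imp_closedin[OF H Kcomp])
  have KM: "K \<subseteq> topspace M" using Kclosed closedin_subset by blast
  have Kinv: "act x g \<in> K" if *: "x \<in> K" "g \<in> padic_carrier p" for x g
  proof -
    obtain y h where y: "y \<in> D ?l" "h \<in> padic_carrier p" "x = act y h" using *(1) unfolding K_def by auto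
    then have "act x g = act y (\<lambda>n. (h n + g n) mod int p ^ n)" using act_act[OF _ y(2) *(2)] DM by auto
    moreover have "(y, \<lambda>n. (h n + g n) mod int p ^ n) \<in> D ?l \<times> padic_carrier p"
      using y(1) padic_add_carrier[OF p y(2) *(2)] by simp
    ultimately show ?thesis unfolding K_def by (metis (no_types, lifting) case_prod_conv image_eqI)
  qed
  let ?X = "subtopology M K"
  have tX: "topspace ?X = K" using KM by auto
  have spK: "padic_space p ?X act"
  proof
    have "continuous_map (prod_topology ?X (padic_topology p)) M (\<lambda>(x, g). act x g)"
      using action unfolding continuous_action_def prod_topology_subtopology
      by (blast intro: continuous_map_from_subtopology)
    then have "continuous_map (prod_topology ?X (padic_topology p)) ?X (\<lambda>(x, g). act x g)"
      using Kinv KM by (auto simp: continuous_map_in_subtopology topspace_padic_topology)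
    then show "continuous_action (padic_group p) (padic_topology p) ?X act"
      using action KM unfolding continuous_action_def tX by (auto simp: subset_iff)
    show "free_action (padic_group p) ?X act"
      using free KM unfolding free_action_def tX by blast
  qed (rule p)
  \<comment> \<open>An element of the small subgroup has residue \<open>p^j * h\<close> at this
    level, so \<open>coarsen\<close> loses \<open>j\<close> levels and leaves exactly level
    \<open>n\<close>.\<close>
  define n' where "n' = n + j"
  interpret K: padic_space p ?X act by (rule spK)
  obtain \<psi> where \<psi>0: "\<forall>x\<in>topspace ?X. \<psi> x \<in> join_weights k (int p ^ n')"
    "\<forall>i a. continuous_map ?X euclideanreal (\<lambda>x. \<psi> x i a)"
    "\<forall>x\<in>topspace ?X. \<forall>g\<in>padic_carrier p. \<psi> (act x g) = shift (g n') (\<psi> x)"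
  proof (rule K.equivariant_join_weights[where k = k and n = n'])
    show "compact_space ?X" using Kcomp by (simp add: compact_space_subtopology)
    show "Hausdorff_space ?X" using H by (rule Hausdorff_space_subtopology)
    fix \<U> assume cover: "finite \<U>" "\<And>U. U \<in> \<U> \<Longrightarrow> openin ?X U"
      "\<And>U x g. U \<in> \<U> \<Longrightarrow> x \<in> U \<Longrightarrow> g \<in> padic_carrier p \<Longrightarrow> act x g \<in> U" "\<Union>\<U> = topspace ?X"
    show "\<exists>\<V>. finite \<V> \<and> (\<forall>V\<in>\<V>. openin ?X V) \<and> (\<forall>V\<in>\<V>. \<forall>x\<in>V. \<forall>g\<in>padic_carrier p. act x g \<in> V) \<and>
        \<Union>\<V> = topspace ?X \<and> (\<forall>V\<in>\<V>. \<exists>U\<in>\<U>. V \<subseteq> U) \<and> (\<forall>x\<in>topspace ?X. card {V \<in> \<V>. x \<in> V} \<le> k + 1)"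
      unfolding tX by (rule orbit_cover_refinement[OF sp dim Kclosed Kne]) (fact Kinv cover[unfolded tX])+
  qed
  note \<psi> = \<psi>0(1)[unfolded tX, rule_format] \<psi>0(2)[rule_format] \<psi>0(3)[unfolded tX, rule_format]
  define \<Phi> where "\<Phi> t g = coarsen (int p ^ j) (\<psi> (C.join_map t g (m + 1)))" for t g
  have jK: "C.join_map t g (m + 1) \<in> K" if "\<And>i. t i \<in> {0..1}" "\<And>i. g i \<in> padic_carrier p" for t g
    using C.join_map_in_D[of t g "m + 1", OF that] DK by auto
  have pn': "int p ^ n' = int p ^ j * int p ^ n" unfolding n'_def by (simp add: power_add)
  have \<Phi>J: "\<Phi> t g \<in> join_weights k (int p ^ n)" if "\<And>i. t i \<in> {0..1}" "\<And>i. g i \<in> padic_carrier p" for t g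
    unfolding \<Phi>_def using \<psi>(1)[OF jK[of t g, OF that]] p unfolding pn' by (intro coarsen_join_weights) auto
  \<comment> \<open>The zero weights are not a point of the join, but \<open>\<Phi>\<close> is
    defined on the whole cube of weights, and any of its values is a witness.\<close>
  have "join_weights k (int p ^ n) \<noteq> {}"
    using \<Phi>J[of "\<lambda>_. 0" "\<lambda>_ _. 0"] padic_zero_carrier[OF p] by auto
  moreover
  let ?Z = "prod_topology (product_topology (\<lambda>_::nat. top_of_set {0..1::real}) UNIV)
        (product_topology (\<lambda>_::nat. padic_topology p) UNIV)"
  obtain N F where "n \<le> N" "\<forall>w\<in>join_weights m (int p ^ N). F w \<in> join_weights k (int p ^ n)"
    "\<forall>w\<in>join_weights m (int p ^ N). \<forall>h. F (shift h w) = shift h (F w)"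
    "\<forall>i a. continuous_map (top_of_set (join_weights m (int p ^ N))) euclideanreal (\<lambda>w. F w i a)"
  proof (rule finite_level_map[OF p, where \<Phi> = \<Phi> and k = k and n = n and m = m])
    fix i a
    have tz: "continuous_map ?Z (top_of_set {0..1}) (\<lambda>z. fst z l)" for l
      using continuous_map_compose[OF continuous_map_fst continuous_map_product_projection[of l UNIV]] by (simp add: o_def)
    have gz: "continuous_map ?Z (padic_topology p) (\<lambda>z. snd z l)" for l
      using continuous_map_compose[OF continuous_map_snd continuous_map_product_projection[of l UNIV]] by (simp add: o_def)
    have "continuous_map ?Z M (\<lambda>z. C.join_map (fst z) (snd z) (m + 1))"
      by (rule C.continuous_map_join_map[OF tz gz]) simp
    moreover have "C.join_map (fst z) (snd z) (m + 1) \<in> K" if "z \<in> topspace ?Z" for z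
      using that by (intro jK) (auto simp: topspace_padic_topology PiE_iff)
    ultimately have "continuous_map ?Z ?X (\<lambda>z. C.join_map (fst z) (snd z) (m + 1))"
      unfolding continuous_map_in_subtopology by blast
    from continuous_map_compose[OF this \<psi>(2)]
    have "continuous_map ?Z euclideanreal (\<lambda>z. \<psi> (C.join_map (fst z) (snd z) (m + 1)) i b)" for b
      unfolding o_def .
    then show "continuous_map ?Z euclideanreal (\<lambda>(t, g). \<Phi> t g i a)"
      unfolding \<Phi>_def coarsen_def case_prod_unfold by (intro continuous_map_sum) auto
  next
    show "\<Phi> t g \<in> join_weights k (int p ^ n)" if "\<And>i. t i \<in> {0..1}" "\<And>i. g i \<in> padic_carrier p" for t g
      by (rule \<Phi>J[OF that])
  next
    fix t :: "nat \<Rightarrow> real" and g g' :: "nat \<Rightarrow> nat \<Rightarrow> int"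
    assume *: "\<And>i. t i \<in> {0..1}" "\<And>i. g i \<in> padic_carrier p" "\<And>i. g' i \<in> padic_carrier p"
      "\<And>i. i \<le> m \<Longrightarrow> t i = 0 \<or> g i = g' i"
    have "C.join_map t g (m + 1) = C.join_map t g' (m + 1)" by (rule C.join_map_cong[of t g g' "m + 1", OF *]) auto
    then show "\<Phi> t g = \<Phi> t g'" by (simp only: \<Phi>_def)
  next
    fix t :: "nat \<Rightarrow> real" and g :: "nat \<Rightarrow> nat \<Rightarrow> int" and h l
    assume *: "\<And>i. t i \<in> {0..1}" "\<And>i. g i \<in> padic_carrier p" "h \<in> padic_carrier p" "l \<le> m"
      "1 \<le> (real m + 1) * t l"
    let ?x = "C.join_map t g (m + 1)"
    have x: "?x \<in> K" by (rule jK[of t g, OF *(1,2)])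
    have cx: "coloured k (int p ^ n') (\<psi> ?x)" using \<psi>(1)[OF x] by (simp add: join_weights_def)
    have "C.join_map t (\<lambda>i n. (g i n + h n) mod int p ^ n) (m + 1) = act ?x (mult h)"
      using C.join_map_equivariant[of t g h l, OF *] by (simp only: act'_def)
    then have "\<Phi> t (\<lambda>i n. (g i n + h n) mod int p ^ n) = coarsen (int p ^ j) (shift (mult h n') (\<psi> ?x))"
      using \<psi>(3)[OF x mult[OF *(3)]] by (simp only: \<Phi>_def)
    also have "shift (mult h n') (\<psi> ?x) = shift (int p ^ j * h n') (\<psi> ?x)"
      unfolding shift_def mult_def by (intro ext colouredD(2)[OF cx]) (simp add: mod_simps)
    also have "coarsen (int p ^ j) (shift (int p ^ j * h n') (\<psi> ?x)) = shift (h n') (\<Phi> t g)"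
      unfolding \<Phi>_def by (rule coarsen_shift)
    \<comment> \<open>The translation is by the residue at level \<open>n'\<close>; coherence and
      periodicity modulo \<open>p^n\<close> reduce it to level \<open>n\<close>.\<close>
    also have "\<dots> = shift (h n) (\<Phi> t g)"
    proof -
      have "coloured k (int p ^ n) (\<Phi> t g)" using \<Phi>J[of t g, OF *(1,2)] by (simp add: join_weights_def)
      then show ?thesis unfolding shift_def
        using padic_coherent[OF *(3), of n n'] padic_mod_self[OF *(3), of n]
        by (intro ext colouredD(2)) (auto simp: n'_def intro: mod_diff_cong)
    qed
    finally show "\<Phi> t (\<lambda>i n. (g i n + h n) mod int p ^ n) = shift (h n) (\<Phi> t g)" .
  qed
  ultimately show ?thesis unfolding m_def by blast
qed

section \<open>The universal compact space\<close>

text \<open>Universal property of the quotient: the conditions at \<open>t = 0\<close> and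
  \<open>t = 1\<close> say that \<open>F\<close> is constant on the classes of
  \<open>join_rel\<close>.\<close>

lemma equivariant_map_from_join:
  assumes G: "topological_group G T" and act: "continuous_action G T X act"
    and F: "continuous_map (prod_topology X (prod_topology T (top_of_set {0..1::real}))) X (\<lambda>(x, h, t). F x h t)"
    and F0: "\<And>x x' h. \<lbrakk>x \<in> topspace X; x' \<in> topspace X; h \<in> carrier G\<rbrakk> \<Longrightarrow> F x h 0 = F x' h 0"
    and F1: "\<And>x h h'. \<lbrakk>x \<in> topspace X; h \<in> carrier G; h' \<in> carrier G\<rbrakk> \<Longrightarrow> F x h 1 = F x h' 1"
    and Feq: "\<And>x h t g. \<lbrakk>x \<in> topspace X; h \<in> carrier G; t \<in> {0..1}; g \<in> carrier G\<rbrakk> \<Longrightarrow>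
      F (act x g) (h \<otimes>\<^bsub>G\<^esub> g) t = act (F x h t) g"
  shows "\<exists>f. continuous_map (topological_join X T) X f \<and> equivariant G (topological_join X T) (join_action G act) act f"
proof -
  have tT: "topspace T = carrier G" using G by (simp add: topological_group_def)
  let ?P = "prod_topology X (prod_topology T (top_of_set {0..1::real}))"
  let ?r = "join_rel (topspace X) (carrier G)"
  let ?F = "\<lambda>(x, h, t). F x h t"
  have tP: "topspace ?P = topspace X \<times> carrier G \<times> {0..1}" by (simp add: tT)
  have eq: "equiv (topspace ?P) ?r" unfolding tP by (rule equiv_join_rel)
  have J: "topological_join X T = quotient_topology ?P ?r" by (simp add: topological_join_def tT)
  have const: "?F z = ?F z'" if "(z, z') \<in> ?r" for z z'
  proof -
    obtain x h t x' h' t' where z: "z = (x, h, t)" "z' = (x', h', t')" by (cases z, cases z')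
    then have "x \<in> topspace X" "x' \<in> topspace X" "h \<in> carrier G" "h' \<in> carrier G"
      "x = x' \<and> h = h' \<and> t = t' \<or> t = 0 \<and> t' = 0 \<and> h = h' \<or> t = 1 \<and> t' = 1 \<and> x = x'"
      using that unfolding join_rel_def by auto
    then show ?thesis using F0[of x x' h] F1[of x h h'] unfolding z by auto
  qed
  define f where "f C = ?F (SOME z. z \<in> C)" for C
  have f: "f (?r `` {z}) = ?F z" if z: "z \<in> topspace ?P" for z
  proof -
    have "z \<in> ?r `` {z}" by (rule equiv_class_self[OF eq z])
    then have "(SOME y. y \<in> ?r `` {z}) \<in> ?r `` {z}" by (rule someI)
    then have "(z, SOME y. y \<in> ?r `` {z}) \<in> ?r" by blast
    from const[OF this] show ?thesis unfolding f_def by (rule sym)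
  qed
  have "continuous_map ?P X (f \<circ> (\<lambda>z. ?r `` {z}))"
    by (rule continuous_map_eq[OF F]) (simp only: o_def f)
  then have "continuous_map (topological_join X T) X f"
    unfolding J by (rule continuous_compose_quotient_map[OF quotient_map_quotient_topology[OF eq]])
  moreover have "equivariant G (topological_join X T) (join_action G act) act f"
    unfolding equivariant_def
  proof (intro ballI)
    fix C g assume C: "C \<in> topspace (topological_join X T)" and g: "g \<in> carrier G"
    have "C \<in> topspace ?P // ?r" using C unfolding J topspace_quotient_topology[OF eq] .
    then obtain z where z: "z \<in> topspace ?P" "C = ?r `` {z}" by (meson quotientE)
    obtain x h t where xht: "z = (x, h, t)" by (cases z)
    have x: "x \<in> topspace X" "h \<in> carrier G" "t \<in> {0..1}" using z(1) unfolding tP xht by auto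
    have "h \<otimes>\<^bsub>G\<^esub> g \<in> carrier G"
      using G x(2) g by (simp add: topological_group_def group.is_monoid monoid.m_closed)
    then have z': "(act x g, h \<otimes>\<^bsub>G\<^esub> g, t) \<in> topspace ?P"
      unfolding tP using continuous_action_closed[OF G act x(1) g] x(3) by simp
    have "join_action G act C g = ?r `` {(act x g, h \<otimes>\<^bsub>G\<^esub> g, t)}"
      unfolding z(2) xht by (rule join_action_class[OF G act x g])
    then show "f (join_action G act C g) = act (f C) g"
      using f[OF z'] f[OF z(1)] Feq[OF x g] unfolding z(2) xht by simp
  qed
  ultimately show ?thesis by blast
qed

text \<open>Transport of a topology along an injection: the image of \<open>e\<close> gets the
  topology pulled back along the inverse, which makes \<open>e\<close> a homeomorphism onto
  it.\<close>

lemma homeomorphic_maps_pullback_inv: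
  assumes "inj e"
  shows "homeomorphic_maps X (pullback_topology (e ` topspace X) (inv_into UNIV e) X) e (inv_into UNIV e)"
    "topspace (pullback_topology (e ` topspace X) (inv_into UNIV e) X) = e ` topspace X"
proof -
  show top: "topspace (pullback_topology (e ` topspace X) (inv_into UNIV e) X) = e ` topspace X"
    unfolding topspace_pullback_topology using assms by auto
  have "continuous_map X (pullback_topology (e ` topspace X) (inv_into UNIV e) X) e"
    using assms by (intro continuous_map_pullback') (auto simp: o_def)
  moreover have "continuous_map (pullback_topology (e ` topspace X) (inv_into UNIV e) X) X (id \<circ> inv_into UNIV e)"
    by (rule continuous_map_pullback) simp
  ultimately show "homeomorphic_maps X (pullback_topology (e ` topspace X) (inv_into UNIV e) X) e (inv_into UNIV e)"
    unfolding homeomorphic_maps_def top using assms by auto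
qed

text \<open>Space, group, action and join map are copied along injections into the type
  \<open>'u\<close> on which the conjecture is assumed. The join is rebuilt there from its universal
  property instead of being transported.\<close>

lemma transported_equivariant_join_map:
  fixes X :: "'a topology" and G :: "'g monoid" and e :: "'a \<Rightarrow> 'u" and d :: "'g \<Rightarrow> 'u"
  assumes e: "inj e" and d: "inj d"
    and X: "compact_space X" "Hausdorff_space X" "topspace X \<noteq> {}"
    and G: "topological_group G T" "compact_space T" "Hausdorff_space T" "carrier G \<noteq> {\<one>\<^bsub>G\<^esub>}"
    and act: "continuous_action G T X act" "free_action G X act"
    and F: "continuous_map (prod_topology X (prod_topology T (top_of_set {0..1::real}))) X (\<lambda>(x, h, t). F x h t)"
    and F0: "\<And>x x' h. \<lbrakk>x \<in> topspace X; x' \<in> topspace X; h \<in> carrier G\<rbrakk> \<Longrightarrow> F x h 0 = F x' h 0"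
    and F1: "\<And>x h h'. \<lbrakk>x \<in> topspace X; h \<in> carrier G; h' \<in> carrier G\<rbrakk> \<Longrightarrow> F x h 1 = F x h' 1"
    and Feq: "\<And>x h t g. \<lbrakk>x \<in> topspace X; h \<in> carrier G; t \<in> {0..1}; g \<in> carrier G\<rbrakk> \<Longrightarrow>
      F (act x g) (h \<otimes>\<^bsub>G\<^esub> g) t = act (F x h t) g"
  shows "\<exists>(X' :: 'u topology) (G' :: 'u monoid) T' act'. compact_space X' \<and> Hausdorff_space X' \<and> topspace X' \<noteq> {} \<and>
      topological_group G' T' \<and> compact_space T' \<and> Hausdorff_space T' \<and> carrier G' \<noteq> {\<one>\<^bsub>G'\<^esub>} \<and>
      continuous_action G' T' X' act' \<and> free_action G' X' act' \<and>
      (\<exists>f. continuous_map (topological_join X' T') X' f \<and> equivariant G' (topological_join X' T') (join_action G' act') act' f)"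
proof -
  have tT: "topspace T = carrier G" using G(1) by (simp add: topological_group_def)
  interpret G: group G using G(1) by (simp add: topological_group_def)
  define X' where "X' = pullback_topology (e ` topspace X) (inv_into UNIV e) X"
  define T' where "T' = pullback_topology (d ` topspace T) (inv_into UNIV d) T"
  have [simp]: "inv_into UNIV e (e x) = x" "inv_into UNIV d (d g) = g" for x g using e d by auto
  have ed: "e x = e y \<longleftrightarrow> x = y" "d g = d h \<longleftrightarrow> g = h" for x y g h
    using e d by (auto simp: inj_eq)
  have hX: "homeomorphic_maps X X' e (inv_into UNIV e)" and tX': "topspace X' = e ` topspace X"
    unfolding X'_def by (rule homeomorphic_maps_pullback_inv[OF e])+
  have hT: "homeomorphic_maps T T' d (inv_into UNIV d)" and tT': "topspace T' = d ` carrier G"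
    unfolding T'_def using homeomorphic_maps_pullback_inv[OF d, of T] tT by auto
  have cX: "continuous_map X X' e" "continuous_map X' X (inv_into UNIV e)" and cT: "continuous_map T T' d" "continuous_map T' T (inv_into UNIV d)"
    using hX hT by (auto simp: homeomorphic_maps_def)
  define G' where "G' = \<lparr>carrier = d ` carrier G, monoid.mult = (\<lambda>a b. d (inv_into UNIV d a \<otimes>\<^bsub>G\<^esub> inv_into UNIV d b)), one = d \<one>\<^bsub>G\<^esub>\<rparr>"
  have G'_simps: "carrier G' = d ` carrier G" "a \<otimes>\<^bsub>G'\<^esub> b = d (inv_into UNIV d a \<otimes>\<^bsub>G\<^esub> inv_into UNIV d b)" "\<one>\<^bsub>G'\<^esub> = d \<one>\<^bsub>G\<^esub>" for a b
    by (simp_all add: G'_def)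
  have grp: "group G'"
  proof (rule groupI)
    fix a assume "a \<in> carrier G'"
    then obtain g where g: "g \<in> carrier G" "a = d g" by (auto simp: G'_simps)
    then have "d (inv\<^bsub>G\<^esub> g) \<in> carrier G'" "d (inv\<^bsub>G\<^esub> g) \<otimes>\<^bsub>G'\<^esub> a = \<one>\<^bsub>G'\<^esub>" by (auto simp: G'_simps)
    then show "\<exists>b\<in>carrier G'. b \<otimes>\<^bsub>G'\<^esub> a = \<one>\<^bsub>G'\<^esub>" by blast
  qed (auto simp: G'_simps G.m_assoc)
  have inv': "inv\<^bsub>G'\<^esub> a = d (inv\<^bsub>G\<^esub> (inv_into UNIV d a))" if a: "a \<in> carrier G'" for a
    using a by (intro group.inv_equality[OF grp]) (auto simp: G'_simps)
  have grpT: "topological_group G' T'"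
    unfolding topological_group_def
  proof (intro conjI grp)
    show "topspace T' = carrier G'" by (simp add: tT' G'_simps)
    have "continuous_map (prod_topology T T) T (\<lambda>(g, h). g \<otimes>\<^bsub>G\<^esub> h)"
      using G(1) by (simp add: topological_group_def)
    from continuous_map_compose2[OF this continuous_map_compose[OF continuous_map_fst cT(2), of T']
      continuous_map_compose[OF continuous_map_snd cT(2), of T']]
    have "continuous_map (prod_topology T' T') T (\<lambda>w. inv_into UNIV d (fst w) \<otimes>\<^bsub>G\<^esub> inv_into UNIV d (snd w))" by (simp add: o_def)
    from continuous_map_compose[OF this cT(1)]
    show "continuous_map (prod_topology T' T') T' (\<lambda>(g, h). g \<otimes>\<^bsub>G'\<^esub> h)"
      by (simp add: o_def G'_simps case_prod_unfold)
    have "continuous_map T T (\<lambda>g. inv\<^bsub>G\<^esub> g)" using G(1) by (simp add: topological_group_def)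
    from continuous_map_compose[OF continuous_map_compose[OF cT(2) this] cT(1)]
    show "continuous_map T' T' (\<lambda>g. inv\<^bsub>G'\<^esub> g)"
      by (rule continuous_map_eq) (simp add: tT' G'_simps(1)[symmetric] inv')
  qed
  define act' where "act' x g = e (act (inv_into UNIV e x) (inv_into UNIV d g))" for x g
  have acting: "continuous_action G' T' X' act'"
    unfolding continuous_action_def
  proof (intro conjI)
    have "continuous_map (prod_topology X T) X (\<lambda>(x, g). act x g)"
      using act(1) by (simp add: continuous_action_def)
    from continuous_map_compose2[OF this continuous_map_compose[OF continuous_map_fst cX(2), of T']
      continuous_map_compose[OF continuous_map_snd cT(2), of X']]
    have "continuous_map (prod_topology X' T') X (\<lambda>w. act (inv_into UNIV e (fst w)) (inv_into UNIV d (snd w)))" by (simp add: o_def)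
    from continuous_map_compose[OF this cX(1)]
    show "continuous_map (prod_topology X' T') X' (\<lambda>(x, g). act' x g)"
      by (simp add: o_def act'_def case_prod_unfold)
    show "\<forall>x\<in>topspace X'. act' x \<one>\<^bsub>G'\<^esub> = x"
      using act(1) by (auto simp: tX' act'_def G'_simps continuous_action_def)
    show "\<forall>x\<in>topspace X'. \<forall>g\<in>carrier G'. \<forall>h\<in>carrier G'. act' (act' x g) h = act' x (g \<otimes>\<^bsub>G'\<^esub> h)"
      using act(1) by (auto simp: tX' act'_def G'_simps continuous_action_def)
  qed
  have "free_action G' X' act'"
    using act(2) by (auto simp: free_action_def tX' act'_def G'_simps ed)
  moreover have "carrier G' \<noteq> {\<one>\<^bsub>G'\<^esub>}"
  proof -
    obtain g where g: "g \<in> carrier G" "g \<noteq> \<one>\<^bsub>G\<^esub>" using G(4) G.one_closed by blast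
    then have "d g \<in> carrier G'" "d g \<noteq> \<one>\<^bsub>G'\<^esub>" by (auto simp: G'_simps ed)
    then show ?thesis by blast
  qed
  moreover have "compact_space X'" "Hausdorff_space X'" "compact_space T'" "Hausdorff_space T'" "topspace X' \<noteq> {}"
    using hX hT X G(2,3) homeomorphic_compact_space homeomorphic_Hausdorff_space tX'
    unfolding homeomorphic_space_def by blast+
  moreover have "\<exists>f. continuous_map (topological_join X' T') X' f \<and> equivariant G' (topological_join X' T') (join_action G' act') act' f"
  proof (rule equivariant_map_from_join[OF grpT acting, where F = "\<lambda>x h t. e (F (inv_into UNIV e x) (inv_into UNIV d h) t)"])
    let ?I = "top_of_set {0..1::real}"
    let ?P = "prod_topology X' (prod_topology T' ?I)"
    have "continuous_map ?P X (\<lambda>z. inv_into UNIV e (fst z))"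
      using continuous_map_compose[OF continuous_map_fst cX(2)] by (simp add: o_def)
    moreover have "continuous_map ?P T (\<lambda>z. inv_into UNIV d (fst (snd z)))"
      using continuous_map_compose[OF continuous_map_compose[OF continuous_map_snd continuous_map_fst] cT(2), of X' ?I] by (simp add: o_def)
    moreover have "continuous_map ?P ?I (\<lambda>z. snd (snd z))"
      using continuous_map_compose[OF continuous_map_snd continuous_map_snd, of X' T' ?I] by (simp add: o_def)
    ultimately have "continuous_map ?P (prod_topology X (prod_topology T ?I)) (\<lambda>z. (inv_into UNIV e (fst z), inv_into UNIV d (fst (snd z)), snd (snd z)))"
      by (intro continuous_map_pairedI)
    from continuous_map_compose[OF continuous_map_compose[OF this F] cX(1)]
    show "continuous_map ?P X' (\<lambda>(x, h, t). e (F (inv_into UNIV e x) (inv_into UNIV d h) t))"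
      by (simp add: o_def case_prod_unfold)
    show "e (F (inv_into UNIV e x) (inv_into UNIV d h) 0) = e (F (inv_into UNIV e x') (inv_into UNIV d h) 0)"
      if "x \<in> topspace X'" "x' \<in> topspace X'" "h \<in> carrier G'" for x x' h
    proof -
      have "inv_into UNIV e x \<in> topspace X" "inv_into UNIV e x' \<in> topspace X" "inv_into UNIV d h \<in> carrier G"
        using that by (auto simp: tX' G'_simps)
      then show ?thesis using F0 by metis
    qed
    show "e (F (inv_into UNIV e x) (inv_into UNIV d h) 1) = e (F (inv_into UNIV e x) (inv_into UNIV d h') 1)"
      if "x \<in> topspace X'" "h \<in> carrier G'" "h' \<in> carrier G'" for x h h'
    proof -
      have "inv_into UNIV e x \<in> topspace X" "inv_into UNIV d h \<in> carrier G" "inv_into UNIV d h' \<in> carrier G"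
        using that by (auto simp: tX' G'_simps)
      then show ?thesis using F1 by metis
    qed
    show "e (F (inv_into UNIV e (act' x g)) (inv_into UNIV d (h \<otimes>\<^bsub>G'\<^esub> g)) t) = act' (e (F (inv_into UNIV e x) (inv_into UNIV d h) t)) g"
      if "x \<in> topspace X'" "h \<in> carrier G'" "t \<in> {0..1}" "g \<in> carrier G'" for x h t g
    proof -
      have "inv_into UNIV e x \<in> topspace X" "inv_into UNIV d h \<in> carrier G" "inv_into UNIV d g \<in> carrier G"
        using that by (auto simp: tX' G'_simps)
      then show ?thesis using Feq that(3) by (simp add: act'_def G'_simps)
    qed
  qed
  ultimately show ?thesis using grpT acting by blast
qed

text \<open>Reals are coded as sets of naturals; a countable family of such sets is again one set of
  naturals, by pairing each element with the code of its index.\<close>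

lemma countable_power_lepoll_reals:
  "(UNIV :: ('a::countable \<Rightarrow> real) set) \<lesssim> (UNIV :: real set)"
proof -
  obtain c :: "real \<Rightarrow> nat set" where c: "inj c"
    using eqpoll_imp_lepoll[OF eqpoll_sym[OF nat_sets_eqpoll_reals]] unfolding lepoll_def by auto
  define E where "E f = {prod_encode (to_nat a, n) | a n. n \<in> c (f a)}" for f :: "'a \<Rightarrow> real"
  have "inj E"
  proof (rule injI)
    fix f g assume eq: "E f = E g"
    have mem: "prod_encode (to_nat a, n) \<in> E f \<longleftrightarrow> n \<in> c (f a)" for f a n
      unfolding E_def by (auto simp: prod_encode_eq)
    have "c (f a) = c (g a)" for a using mem[of a _ f] mem[of a _ g] eq by blast
    then show "f = g" using c by (auto simp: fun_eq_iff inj_eq)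
  qed
  then have "(UNIV :: ('a \<Rightarrow> real) set) \<lesssim> (UNIV :: nat set set)" unfolding lepoll_def by auto
  then show ?thesis using nat_sets_eqpoll_reals lepoll_trans1 lepoll_trans eqpoll_imp_lepoll by blast
qed

text \<open>A full product: no compatibility between levels is imposed, so maps into it can be
  chosen one level at a time.\<close>

definition join_tower :: "nat \<Rightarrow> nat \<Rightarrow> (nat \<Rightarrow> nat \<Rightarrow> int \<Rightarrow> real) set" where
  "join_tower k p = {w. \<forall>n. w n \<in> join_weights k (int p ^ n)}"

definition tower_act :: "(nat \<Rightarrow> nat \<Rightarrow> int \<Rightarrow> real) \<Rightarrow> (nat \<Rightarrow> int) \<Rightarrow> nat \<Rightarrow> nat \<Rightarrow> int \<Rightarrow> real" where
  "tower_act w g = (\<lambda>n. shift (g n) (w n))"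

section \<open>Topology of the product of joins\<close>

lemma continuous_map_euclidean_fun:
  "continuous_map Z (euclidean :: ('i \<Rightarrow> 'b::topological_space) topology) f \<longleftrightarrow> (\<forall>i. continuous_map Z euclidean (\<lambda>z. f z i))"
  by (subst euclidean_product_topology[symmetric]) (rule continuous_map_componentwise_UNIV)

lemma continuous_map_euclidean_coordinate:
  "continuous_map Z (euclidean :: ('i \<Rightarrow> 'b::topological_space) topology) f \<Longrightarrow> continuous_map Z euclidean (\<lambda>z. f z i)"
  by (simp add: continuous_map_euclidean_fun)

text \<open>The fibres of \<open>d\<close> are open and on each of them the parameter is fixed. This
  handles translations, which depend on a p-adic integer only through one of its residues.\<close>

lemma continuous_map_discrete_parameter:
  assumes d: "continuous_map Z (discrete_topology A) d" and f: "\<And>b. b \<in> A \<Longrightarrow> continuous_map Z Y (f b)"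
  shows "continuous_map Z Y (\<lambda>z. f (d z) z)"
proof (rule pasting_lemma[where I = A and T = "\<lambda>b. {z \<in> topspace Z. d z \<in> {b}}" and f = f])
  show "openin Z {z \<in> topspace Z. d z \<in> {b}}" if "b \<in> A" for b
    by (rule openin_continuous_map_preimage[OF d]) (use that in simp)
  show "\<exists>j. j \<in> A \<and> z \<in> {z \<in> topspace Z. d z \<in> {j}} \<and> f (d z) z = f j z" if "z \<in> topspace Z" for z
    using continuous_map_image_subset_topspace[OF d] that by auto
qed (auto intro: continuous_map_from_subtopology f)

lemma closed_join_weights:
  fixes f :: "'c::topological_space \<Rightarrow> nat \<Rightarrow> int \<Rightarrow> real"
  assumes f: "\<And>i a. continuous_on UNIV (\<lambda>w. f w i a)"
  shows "closed {w. f w \<in> join_weights k q}"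
proof -
  \<comment> \<open>A condition on a nonzero value becomes an equation under a premise about
    residues that does not involve \<open>w\<close>, and so is visibly closed.\<close>
  have "(x \<noteq> (0::real) \<longrightarrow> P) \<longleftrightarrow> (\<not> P \<longrightarrow> x = 0)" for x P by auto
  then show ?thesis
    unfolding join_weights_def coloured_def total_def mem_Collect_eq
    by (simp only:) (intro closed_Collect_conj closed_Collect_all closed_Collect_imp closed_Collect_le closed_Collect_eq
      open_Collect_const continuous_intros f)
qed

lemma continuous_on_triple_coordinates:
  "continuous_on S (\<lambda>w::'a \<Rightarrow> 'b \<Rightarrow> 'c \<Rightarrow> 'd::topological_space. w n i a)"
  by (rule continuous_on_product_then_coordinatewise[OF continuous_on_coordinates])

lemma compact_join_tower:
  assumes p: "p > 0"
  shows "compact (join_tower k p)"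
proof -
  let ?C = "\<Pi>\<^sub>E n\<in>(UNIV::nat set). \<Pi>\<^sub>E i\<in>(UNIV::nat set). \<Pi>\<^sub>E a\<in>(UNIV::int set). {0..1::real}"
  have "compactin (product_topology (\<lambda>_. product_topology (\<lambda>_. product_topology (\<lambda>_. euclideanreal) UNIV) UNIV) UNIV) ?C"
    by (simp add: compactin_PiE compactin_euclidean_iff)
  then have "compact ?C" by (simp add: euclidean_product_topology compactin_euclidean_iff)
  moreover have "closed (join_tower k p)"
    unfolding join_tower_def
    by (intro closed_Collect_all closed_join_weights continuous_on_triple_coordinates)
  moreover have "join_tower k p \<subseteq> ?C"
  proof
    fix w assume w: "w \<in> join_tower k p"
    have "w n i a \<in> {0..1}" for n i a
    proof -
      have wn: "w n \<in> join_weights k (int p ^ n)" using w by (simp add: join_tower_def)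
      then have "coloured k (int p ^ n) (w n)" by (simp add: join_weights_def)
      then show ?thesis using join_weights_le_1[OF wn] colouredD(1) p by simp
    qed
    then show "w \<in> ?C" by (simp add: PiE_iff)
  qed
  ultimately show ?thesis by (metis compact_Int_closed inf.absorb2)
qed

text \<open>Freeness is obtained from all levels together: a nonzero weight at level
  \<open>n\<close> forces \<open>p^n\<close> to divide \<open>g n\<close>, which for every
  \<open>n\<close> means \<open>g = 0\<close>.\<close>

lemma join_tower_action:
  assumes p: "p > 0"
  shows "continuous_action (padic_group p) (padic_topology p) (top_of_set (join_tower k p)) tower_act"
    "free_action (padic_group p) (top_of_set (join_tower k p)) tower_act"
proof -
  let ?X = "top_of_set (join_tower k p)"
  let ?Z = "prod_topology ?X (padic_topology p)"
  have q: "0 < int p ^ n" for n using p by simp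
  have mem: "tower_act w g \<in> join_tower k p" if "w \<in> join_tower k p" for w g
  proof -
    have "shift (g n) (w n) \<in> join_weights k (int p ^ n)" for n
      using that by (intro shift_join_weights q) (simp add: join_tower_def)
    then show ?thesis unfolding join_tower_def tower_act_def by blast
  qed
  show "continuous_action (padic_group p) (padic_topology p) ?X tower_act"
    unfolding continuous_action_def
  proof (intro conjI ballI)
    have w: "continuous_map ?Z euclideanreal (\<lambda>z. fst z n i a)" for n i a
      by (rule continuous_map_euclidean_coordinate[OF continuous_map_euclidean_coordinate[OF continuous_map_euclidean_coordinate[OF
        continuous_map_into_fulltopology[OF continuous_map_fst]]]])
    have g: "continuous_map ?Z (discrete_topology {0..<int p ^ n}) (\<lambda>z. snd z n)" for n
      using continuous_map_compose[OF continuous_map_snd continuous_map_padic_proj] by (simp add: o_def)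
    have "continuous_map ?Z euclideanreal (\<lambda>z. fst z n i (a - snd z n))" for n i a
      by (rule continuous_map_discrete_parameter[OF g, where f = "\<lambda>b z. fst z n i (a - b)"]) (rule w)
    then have "continuous_map ?Z euclidean (\<lambda>z. tower_act (fst z) (snd z))"
      unfolding tower_act_def shift_def by (simp add: continuous_map_euclidean_fun)
    then show "continuous_map ?Z ?X (\<lambda>(w, g). tower_act w g)"
      using mem by (auto simp: continuous_map_in_subtopology case_prod_unfold)
    fix w assume "w \<in> topspace ?X"
    then have w: "w \<in> join_tower k p" by simp
    show "tower_act w \<one>\<^bsub>padic_group p\<^esub> = w" by (simp add: tower_act_def shift_def)
    fix g h assume "g \<in> carrier (padic_group p)" "h \<in> carrier (padic_group p)"
    show "tower_act (tower_act w g) h = tower_act w (g \<otimes>\<^bsub>padic_group p\<^esub> h)"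
    proof (intro ext)
      fix n i a
      have c: "coloured k (int p ^ n) (w n)" using w by (simp add: join_tower_def join_weights_def)
      have "w n i (a - h n - g n) = w n i (a - (g n + h n) mod int p ^ n)"
        by (rule colouredD(2)[OF c]) (simp add: mod_simps algebra_simps)
      then show "tower_act (tower_act w g) h n i a = tower_act w (g \<otimes>\<^bsub>padic_group p\<^esub> h) n i a"
        by (simp add: tower_act_def shift_def)
    qed
  qed
  show "free_action (padic_group p) ?X tower_act"
    unfolding free_action_def
  proof (intro ballI impI)
    fix w g assume "w \<in> topspace ?X" and g: "g \<in> carrier (padic_group p)" and eq: "tower_act w g = w"
    then have w: "w n \<in> join_weights k (int p ^ n)" for n by (simp add: join_tower_def)
    have "g n = 0" for n
    proof -
      have c: "coloured k (int p ^ n) (w n)" using w by (simp add: join_weights_def)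
      obtain i a where "i \<le> k" "1 / (k + 1) \<le> w n i a" by (rule join_weights_large[OF w q])
      moreover have "0 < 1 / real (k + 1)" by simp
      ultimately have a: "w n i a \<noteq> 0" by linarith
      have "shift (g n) (w n) i (a + g n) = w n i (a + g n)" using eq unfolding tower_act_def by metis
      then have "w n i (a + g n) \<noteq> 0" using a by (simp add: shift_def)
      from colouredD(4)[OF c this a] have "int p ^ n dvd g n" by (simp add: mod_eq_dvd_iff)
      then show ?thesis using padic_mod_self[of g p n] g by simp
    qed
    then show "g = \<one>\<^bsub>padic_group p\<^esub>" by (simp add: fun_eq_iff)
  qed
qed

text \<open>Joins with one more copy of \<open>\<int>/q\<close>; as in \<^const>\<open>join_rel\<close>, only \<open>b\<close> matters at \<open>t = 0\<close> and only \<open>w\<close> at \<open>t = 1\<close>.\<close>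

definition cone_weights :: "nat \<Rightarrow> int \<Rightarrow> (nat \<Rightarrow> int \<Rightarrow> real) \<Rightarrow> int \<Rightarrow> real \<Rightarrow> nat \<Rightarrow> int \<Rightarrow> real" where
  "cone_weights k q w b t i a =
     (if i \<le> k then t * w i a else if i = Suc k \<and> a mod q = b mod q then 1 - t else 0)"

lemma cone_weights_join:
  assumes w: "w \<in> join_weights k q" and q: "0 < q" and t: "t \<in> {0..1}"
  shows "cone_weights k q w b t \<in> join_weights (Suc k) q"
proof -
  have c: "coloured k q w" and tot: "total k q w = 1" using w by (auto simp: join_weights_def)
  have "coloured (Suc k) q (cone_weights k q w b t)"
  proof (rule colouredI)
    fix i and a a' :: int
    show "0 \<le> cone_weights k q w b t i a" using colouredD(1)[OF c] t by (simp add: cone_weights_def)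
    show "cone_weights k q w b t i a = cone_weights k q w b t i a'" if "a mod q = a' mod q"
      using colouredD(2)[OF c that, of i] that by (simp add: cone_weights_def)
    show "cone_weights k q w b t i a = 0" if "Suc k < i" using that by (simp add: cone_weights_def)
    show "a mod q = a' mod q" if "cone_weights k q w b t i a \<noteq> 0" "cone_weights k q w b t i a' \<noteq> 0"
      using that colouredD(4)[OF c, of i a a'] by (auto simp: cone_weights_def split: if_splits)
  qed
  moreover have "total (Suc k) q (cone_weights k q w b t) = 1"
  proof -
    have "(\<Sum>a\<in>{0..<q}. cone_weights k q w b t (Suc k) a) = (\<Sum>a\<in>{0..<q}. if a = b mod q then 1 - t else 0)"
      by (intro sum.cong) (auto simp: cone_weights_def)
    also have "\<dots> = 1 - t" using q by simp
    finally have "total (Suc k) q (cone_weights k q w b t) = t * total k q w + (1 - t)"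
      unfolding total_def sum_distrib_left by (simp add: cone_weights_def)
    then show ?thesis using tot by simp
  qed
  ultimately show ?thesis by (simp add: join_weights_def)
qed

lemma cone_weights_shift:
  "cone_weights k q (shift s w) ((b + s) mod q) t = shift s (cone_weights k q w b t)"
proof (intro ext)
  fix i a
  have "a mod q = (b + s) mod q \<longleftrightarrow> (a - s) mod q = b mod q"
    by (simp add: mod_eq_dvd_iff algebra_simps)
  then show "cone_weights k q (shift s w) ((b + s) mod q) t i a = shift s (cone_weights k q w b t) i a"
    by (simp add: cone_weights_def shift_def)
qed

text \<open>Component \<open>n\<close> reads level \<open>N n\<close>, where \<open>g\<close> acts
  by \<open>g (N n)\<close>, while the result is to be translated by \<open>g n\<close>. As
  \<open>n \<le> N n\<close>, the two agree modulo \<open>p^n\<close>, and weights at level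
  \<open>n\<close> see no more than that.\<close>

lemma join_tower_join_map:
  assumes p: "p > 0" and N: "\<And>n. n \<le> N n"
    and FJ: "\<And>n w. w \<in> join_weights (Suc k) (int p ^ N n) \<Longrightarrow> F n w \<in> join_weights k (int p ^ n)"
    and Feq: "\<And>n w h. w \<in> join_weights (Suc k) (int p ^ N n) \<Longrightarrow> F n (shift h w) = shift h (F n w)"
    and Fcont: "\<And>n i a. continuous_map (top_of_set (join_weights (Suc k) (int p ^ N n))) euclideanreal (\<lambda>w. F n w i a)"
  defines "J \<equiv> \<lambda>w h t n. F n (cone_weights k (int p ^ N n) (w (N n)) (h (N n)) t)"
  shows "continuous_map (prod_topology (top_of_set (join_tower k p)) (prod_topology (padic_topology p) (top_of_set {0..1})))
      (top_of_set (join_tower k p)) (\<lambda>(w, h, t). J w h t)"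
    and "\<And>w w' h. J w h 0 = J w' h 0" and "\<And>w h h'. J w h 1 = J w h' 1"
    and "\<And>w h t g. \<lbrakk>w \<in> join_tower k p; t \<in> {0..1}; g \<in> padic_carrier p\<rbrakk> \<Longrightarrow>
      J (tower_act w g) (h \<otimes>\<^bsub>padic_group p\<^esub> g) t = tower_act (J w h t) g"
proof -
  have q: "0 < int p ^ n" for n using p by simp
  have cone: "cone_weights k (int p ^ N n) (w (N n)) b t \<in> join_weights (Suc k) (int p ^ N n)"
    if "w \<in> join_tower k p" "t \<in> {0..1}" for w b t n
    using that q by (intro cone_weights_join) (auto simp: join_tower_def)
  have "cone_weights k Q w b 0 = cone_weights k Q w' b 0" "cone_weights k Q w b 1 = cone_weights k Q w b' 1" for Q w w' b b'
    by (auto simp: cone_weights_def fun_eq_iff)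
  then show "J w h 0 = J w' h 0" "J w h 1 = J w h' 1" for w w' h h' unfolding J_def by metis+
  show "J (tower_act w g) (h \<otimes>\<^bsub>padic_group p\<^esub> g) t = tower_act (J w h t) g"
    if w: "w \<in> join_tower k p" and t: "t \<in> {0..1}" and g: "g \<in> padic_carrier p" for w h t g
  proof
    fix n
    let ?c = "cone_weights k (int p ^ N n) (w (N n)) (h (N n)) t"
    have c: "coloured k (int p ^ n) (F n ?c)" using FJ[OF cone[OF w t]] by (simp add: join_weights_def)
    have "J (tower_act w g) (h \<otimes>\<^bsub>padic_group p\<^esub> g) t n = F n (shift (g (N n)) ?c)"
      by (simp add: J_def tower_act_def cone_weights_shift)
    also have "\<dots> = shift (g (N n)) (F n ?c)" by (rule Feq[OF cone[OF w t]])
    also have "\<dots> = shift (g n) (F n ?c)"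
      unfolding shift_def
    proof (intro ext colouredD(2)[OF c] mod_diff_cong refl)
      show "g (N n) mod int p ^ n = g n mod int p ^ n"
        using padic_coherent[OF g N[of n]] padic_mod_self[OF g, of n] by simp
    qed
    finally show "J (tower_act w g) (h \<otimes>\<^bsub>padic_group p\<^esub> g) t n = tower_act (J w h t) g n"
      by (simp add: J_def tower_act_def)
  qed
  let ?I = "top_of_set {0..1::real}"
  let ?X = "top_of_set (join_tower k p)"
  let ?Z = "prod_topology ?X (prod_topology (padic_topology p) ?I)"
  have w: "continuous_map ?Z euclideanreal (\<lambda>z. fst z n i a)" for n i a
    by (rule continuous_map_euclidean_coordinate[OF continuous_map_euclidean_coordinate[OF continuous_map_euclidean_coordinate[OF
        continuous_map_into_fulltopology[OF continuous_map_fst]]]])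
  have h: "continuous_map ?Z (discrete_topology {0..<int p ^ n}) (\<lambda>z. fst (snd z) n)" for n
    by (rule continuous_map_compose[OF continuous_map_compose[OF continuous_map_snd continuous_map_fst] continuous_map_padic_proj, unfolded o_def])
  have t: "continuous_map ?Z euclideanreal (\<lambda>z. snd (snd z))"
    by (rule continuous_map_into_fulltopology[OF continuous_map_compose[OF continuous_map_snd continuous_map_snd, unfolded o_def]])
  have tZ: "fst z \<in> join_tower k p \<and> snd (snd z) \<in> {0..1}" if "z \<in> topspace ?Z" for z
    using that by auto
  have "continuous_map ?Z euclideanreal (\<lambda>z. J (fst z) (fst (snd z)) (snd (snd z)) n i a)" for n i a
  proof -
    let ?c = "\<lambda>z. cone_weights k (int p ^ N n) (fst z (N n)) (fst (snd z) (N n)) (snd (snd z))"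
    have "continuous_map ?Z euclideanreal (\<lambda>z. cone_weights k (int p ^ N n) (fst z (N n)) b (snd (snd z)) i a)" for b i a
      unfolding cone_weights_def by (cases "i \<le> k"; cases "i = Suc k \<and> a mod int p ^ N n = b mod int p ^ N n")
        (auto intro!: continuous_intros w t)
    then have "continuous_map ?Z euclideanreal (\<lambda>z. ?c z i a)" for i a
      by (intro continuous_map_discrete_parameter[OF h, where f = "\<lambda>b z. cone_weights k (int p ^ N n) (fst z (N n)) b (snd (snd z)) i a"])
    then have "continuous_map ?Z euclidean ?c" by (simp add: continuous_map_euclidean_fun)
    then have "continuous_map ?Z (top_of_set (join_weights (Suc k) (int p ^ N n))) ?c"
      unfolding continuous_map_in_subtopology using cone tZ by blast
    from continuous_map_compose[OF this Fcont[of n i a]] show ?thesis by (simp add: J_def o_def)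
  qed
  then have "continuous_map ?Z euclidean (\<lambda>z. J (fst z) (fst (snd z)) (snd (snd z)))"
    by (simp add: continuous_map_euclidean_fun)
  moreover have "J (fst z) (fst (snd z)) (snd (snd z)) \<in> join_tower k p" if "z \<in> topspace ?Z" for z
    using tZ[OF that] FJ[OF cone] unfolding join_tower_def J_def by simp
  ultimately show "continuous_map ?Z ?X (\<lambda>(w, h, t). J w h t)"
    unfolding case_prod_unfold continuous_map_in_subtopology by blast
qed

text \<open>The spaces and groups of the conjecture are carried by arbitrary subsets of one type
  \<open>'u\<close>. The reals inject into it, which makes room for the product of joins and for the
  p-adic integers; the manifold may live on any type.\<close>

theorem corollary2p15:
  assumes universe: "(UNIV :: real set) \<lesssim> (UNIV :: 'u set)"
    and BDH: "\<And>(X :: 'u topology) (G :: 'u monoid) (T :: 'u topology) act.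
       \<lbrakk>compact_space X; Hausdorff_space X; topspace X \<noteq> {};
        topological_group G T; compact_space T; Hausdorff_space T; carrier G \<noteq> {\<one>\<^bsub>G\<^esub>};
        continuous_action G T X act; free_action G X act\<rbrakk> \<Longrightarrow>
       \<not> (\<exists>f. continuous_map (topological_join X T) X f \<and>
              equivariant G (topological_join X T) (join_action G act) act f)"
  shows "\<forall>p :: nat. prime p \<longrightarrow>
    (\<forall>M :: 'm topology.
       topspace M \<noteq> {} \<and> connected_space M \<and> (\<exists>n. topological_manifold n M) \<longrightarrow>
       \<not> (\<exists>act. continuous_action (padic_group p) (padic_topology p) M act \<and>
                free_action (padic_group p) M act \<and>
                finite_dimensional (orbit_space (padic_group p) M act)))"
proof (intro allI impI notI)
  fix p :: nat and M :: "'m topology"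
  assume prime: "prime p"
    and M: "topspace M \<noteq> {} \<and> connected_space M \<and> (\<exists>n. topological_manifold n M)"
    and "\<exists>act. continuous_action (padic_group p) (padic_topology p) M act \<and>
                free_action (padic_group p) M act \<and>
                finite_dimensional (orbit_space (padic_group p) M act)"
  then obtain act d k where act: "continuous_action (padic_group p) (padic_topology p) M act"
      "free_action (padic_group p) M act"
    and d: "topological_manifold d M" and k: "covering_dim_le (orbit_space (padic_group p) M act) k"
    unfolding finite_dimensional_def by blast
  have p: "p > 0" "p > 1" using prime prime_gt_0_nat prime_gt_1_nat by blast+
  have sp: "padic_space p M act" using p act by unfold_locales
  let ?P = "\<lambda>n N F. n \<le> N \<and> (\<forall>w\<in>join_weights (Suc k) (int p ^ N). F w \<in> join_weights k (int p ^ n)) \<and>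
      (\<forall>w\<in>join_weights (Suc k) (int p ^ N). \<forall>h. F (shift h w) = shift h (F w)) \<and>
      (\<forall>i a. continuous_map (top_of_set (join_weights (Suc k) (int p ^ N))) euclideanreal (\<lambda>w. F w i a))"
  have maps: "join_weights k (int p ^ n) \<noteq> {} \<and> (\<exists>N F. ?P n N F)" for n
    using finite_dimensional_orbit_space_imp_join_maps[OF d _ sp k] M by blast
  then have "\<forall>n. \<exists>N F. ?P n N F" by blast
  from choice[OF this] obtain N where "\<forall>n. \<exists>F. ?P n (N n) F" by blast
  from choice[OF this] obtain F where F: "\<forall>n. ?P n (N n) (F n)" by blast
  let ?X = "top_of_set (join_tower k p)"
  have "\<forall>n. \<exists>w. w \<in> join_weights k (int p ^ n)" using maps by blast
  from choice[OF this] have X: "topspace ?X \<noteq> {}" unfolding join_tower_def by auto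
  have one: "(\<lambda>n. 1 mod int p ^ n) \<in> padic_carrier p" by (rule padic_int_carrier[OF p(1)])
  have nontrivial: "carrier (padic_group p) \<noteq> {\<one>\<^bsub>padic_group p\<^esub>}"
  proof
    assume "carrier (padic_group p) = {\<one>\<^bsub>padic_group p\<^esub>}"
    then have "(\<lambda>n. 1 mod int p ^ n) = (\<lambda>n. 0)" using one by simp
    \<comment> \<open>All residues at level \<open>0\<close> vanish, so level \<open>1\<close> is
      the first at which \<open>1\<close> differs from \<open>0\<close>.\<close>
    from fun_cong[OF this, of 1] show False using p(2) by simp
  qed
  obtain u :: "real \<Rightarrow> 'u" where u: "inj u" using universe unfolding lepoll_def by auto
  obtain r :: "(nat \<times> nat \<times> int \<Rightarrow> real) \<Rightarrow> real" where r: "inj r"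
    using countable_power_lepoll_reals unfolding lepoll_def by auto
  have "inj (\<lambda>(w :: nat \<Rightarrow> nat \<Rightarrow> int \<Rightarrow> real) (n, i, a). w n i a)"
    by (rule injI) (auto simp: fun_eq_iff)
  from inj_compose[OF u inj_compose[OF r this]]
  obtain e :: "(nat \<Rightarrow> nat \<Rightarrow> int \<Rightarrow> real) \<Rightarrow> 'u" where e: "inj e" by blast
  \<comment> \<open>Families that are constant in \<open>i\<close> and \<open>a\<close> embed the
    group into the type of the space, so that \<open>e\<close> can be reused.\<close>
  have "inj (\<lambda>(g :: nat \<Rightarrow> int) (n :: nat) (i :: nat) (a :: int). real_of_int (g n))"
    by (rule injI) (auto simp: fun_eq_iff)
  from inj_compose[OF e this] obtain c :: "(nat \<Rightarrow> int) \<Rightarrow> 'u" where c: "inj c" by blast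
  let ?J = "\<lambda>w h t n. F n (cone_weights k (int p ^ N n) (w (N n)) (h (N n)) t)"
  have J: "n \<le> N n" "w \<in> join_weights (Suc k) (int p ^ N n) \<Longrightarrow> F n w \<in> join_weights k (int p ^ n)"
    "w \<in> join_weights (Suc k) (int p ^ N n) \<Longrightarrow> F n (shift h w) = shift h (F n w)"
    "continuous_map (top_of_set (join_weights (Suc k) (int p ^ N n))) euclideanreal (\<lambda>w. F n w i a)" for n w h i a
    using F by blast+
  note join_map = join_tower_join_map[where F = F and N = N, OF p(1) J]
  have "\<exists>(X' :: 'u topology) (G' :: 'u monoid) T' act'. compact_space X' \<and> Hausdorff_space X' \<and> topspace X' \<noteq> {} \<and>
      topological_group G' T' \<and> compact_space T' \<and> Hausdorff_space T' \<and> carrier G' \<noteq> {\<one>\<^bsub>G'\<^esub>} \<and>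
      continuous_action G' T' X' act' \<and> free_action G' X' act' \<and>
      (\<exists>f. continuous_map (topological_join X' T') X' f \<and> equivariant G' (topological_join X' T') (join_action G' act') act' f)"
  proof (rule transported_equivariant_join_map[OF e c _ _ X topological_group_padic[OF p(1)] compact_space_padic
      Hausdorff_space_padic nontrivial join_tower_action[OF p(1)], where F = ?J])
    show "compact_space ?X"
      using compact_join_tower[OF p(1)] by (simp add: compact_space_subtopology compactin_euclidean_iff)
    show "Hausdorff_space ?X" by (rule Hausdorff_space_subtopology) simp
    show "continuous_map (prod_topology ?X (prod_topology (padic_topology p) (top_of_set {0..1::real}))) ?X
       (\<lambda>(w, h, t). ?J w h t)"
      by (rule join_map(1))
    show "?J w h 0 = ?J w' h 0" for w w' h by (rule join_map(2))
    show "?J w h 1 = ?J w h' 1" for w h h' by (rule join_map(3))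
    show "?J (tower_act w g) (h \<otimes>\<^bsub>padic_group p\<^esub> g) t = tower_act (?J w h t) g"
      if "w \<in> topspace ?X" "t \<in> {0..1}" "g \<in> carrier (padic_group p)" for w h t g
      using that by (intro join_map(4)) auto
  qed
  then obtain X' :: "'u topology" and G' :: "'u monoid" and T' act' where
    "compact_space X'" "Hausdorff_space X'" "topspace X' \<noteq> {}" "topological_group G' T'" "compact_space T'"
    "Hausdorff_space T'" "carrier G' \<noteq> {\<one>\<^bsub>G'\<^esub>}" "continuous_action G' T' X' act'" "free_action G' X' act'"
    and f: "\<exists>f. continuous_map (topological_join X' T') X' f \<and> equivariant G' (topological_join X' T') (join_action G' act') act' f"
    by (elim exE conjE) (rule that; (assumption | blast))
  from BDH[OF this(1-9)] f show False by blast
qed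

end
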